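(* Let $j>0$ and $u\in L^\infty([0,1],\mathbb R_+)$ with $F(0;u)>0$. Then there exists a unique function $u(r,t)$, $r\in[0,1]$, $t>0$ (with $u(\cdot,0):=u$), which separates the barriers $\{S^{(\delta,\pm)}_{n\delta}(u)\}$, i.e. such that $$S^{(\delta,-)}_t(u)\le u(\cdot,t)\le S^{(\delta,+)}_t(u)$$ for all $\delta>0$ (for which the barriers are defined, i.e. $F(0;u)>j\delta$) and all $t=k\delta$, $k\in\mathbb N$. Moreover $u(r,t)$ is continuous on the compact subsets of $[0,1]\times(0,\infty)$ and $u(\cdot,t)$ converges weakly to $u$ as $t\to0$.
   Context: For a positive Borel measure $\mu$ on $[0,1]$ let $F(r;\mu)=\mu([r,1])$ (for a density $u$, $F(r;u)=\int_r^1u$); for two such measures $\mu\le\nu$ iff $F(r;\mu)\le F(r;\nu)$ for all $r\in[0,1]$. $\mathcal U$ is the set of measures $c D_0+\rho(r)dr$ with $c\ge0$, $\rho\in L^\infty([0,1],\mathbb R_+)$, $D_0$ the Dirac mass at $0$. For $\delta>0$, $\mathcal U_\delta=\{cD_0+\rho\in\mathcal U:\int_0^1\rho>j\delta\}$ and $K^{(\delta)}u=j\delta D_0+\mathbf 1_{[0,R_\delta(u)]}u$ on $\mathcal U_\delta$, with $R_\delta(u)=\inf\{r:F(r;u)=j\delta\}$. $G^{\rm neum}_t(r,r')$ is the heat kernel of $\partial_t=\frac12\partial_r^2$ on $[0,1]$ with Neumann boundary conditions, i.e. $\sum_kG_t(r,r'_k)$ with $G_t(r,r')=e^{-(r-r')^2/2t}/\sqrt{2\pi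 t}$ and $r'_k$ the images of $r'$ under repeated reflections of $[0,1]$; $G^{\rm neum}_t*\mu(r)=\int G^{\rm neum}_t(r,r')\mu(dr')$. Barriers: for $F(0;u)>j\delta$, $S^{(\delta,\pm)}_0(u)=u$, $S^{(\delta,-)}_{n\delta}(u)=K^{(\delta)}G^{\rm neum}_\delta*S^{(\delta,-)}_{(n-1)\delta}(u)$, $S^{(\delta,+)}_{n\delta}(u)=G^{\rm neum}_\delta*K^{(\delta)}S^{(\delta,+)}_{(n-1)\delta}(u)$. *)

theory Defs
  imports "HOL-Analysis.Analysis"
begin

text \<open>Elements of the class U: a measure  c D_0 + rho(r) dr  on [0,1] is represented
  by the pair (c, rho).\<close>
type_synonym umeas = "real \<times> (real \<Rightarrow> real)"

definition Fm :: "real \<Rightarrow> umeas \<Rightarrow> real" where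
  "Fm r mu = (if 0 \<in> {r..1} then fst mu else 0) + (LINT x:{r..1}|lborel. snd mu x)"

definition ule :: "umeas \<Rightarrow> umeas \<Rightarrow> bool" where
  "ule mu nu \<longleftrightarrow> (\<forall>r\<in>{0..1}. Fm r mu \<le> Fm r nu)"

definition Gk :: "real \<Rightarrow> real \<Rightarrow> real \<Rightarrow> real" where
  "Gk t r r' = exp (- ((r - r')\<^sup>2) / (2 * t)) / sqrt (2 * pi * t)"

text \<open>Neumann heat kernel on [0,1]: sum over the images 2n + r' and 2n - r' (n integer)
  of r' under repeated reflections at 0 and 1.\<close>
definition Gneum :: "real \<Rightarrow> real \<Rightarrow> real \<Rightarrow> real" where
  "Gneum t r r' = (\<Sum>\<^sub>\<infinity>n\<in>(UNIV::int set). Gk t r (2 * of_int n + r') + Gk t r (2 * of_int n - r'))"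

definition heat :: "real \<Rightarrow> umeas \<Rightarrow> umeas" where
  "heat t mu = (0, \<lambda>r. fst mu * Gneum t r 0 + (LINT r':{0..1}|lborel. Gneum t r r' * snd mu r'))"

definition Rdelta :: "real \<Rightarrow> real \<Rightarrow> umeas \<Rightarrow> real" where
  "Rdelta j \<delta> mu = Inf {r\<in>{0..1}. Fm r mu = j * \<delta>}"

text \<open>K^(delta) u = j delta D_0 + 1_{[0,R_delta(u)]} u  (u = c D_0 + rho, the atom c is dropped).\<close>
definition Kd :: "real \<Rightarrow> real \<Rightarrow> umeas \<Rightarrow> umeas" where
  "Kd j \<delta> mu = (j * \<delta>, \<lambda>r. indicator {0..Rdelta j \<delta> mu} r * snd mu r)"

fun Sminus :: "real \<Rightarrow> real \<Rightarrow> (real \<Rightarrow> real) \<Rightarrow> nat \<Rightarrow> umeas" where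
  "Sminus j \<delta> u 0 = (0, u)"
| "Sminus j \<delta> u (Suc n) = Kd j \<delta> (heat \<delta> (Sminus j \<delta> u n))"

fun Splus :: "real \<Rightarrow> real \<Rightarrow> (real \<Rightarrow> real) \<Rightarrow> nat \<Rightarrow> umeas" where
  "Splus j \<delta> u 0 = (0, u)"
| "Splus j \<delta> u (Suc n) = heat \<delta> (Kd j \<delta> (Splus j \<delta> u n))"

text \<open>U (a function of (r,t)) separates the barriers: for every delta > 0 with
  F(0;u) > j delta and every t = k delta (k \<ge> 1; k = 0 is trivial as u(.,0) := u),
  S^- \<le> U(.,t) \<le> S^+.\<close>
definition separates :: "real \<Rightarrow> (real \<Rightarrow> real) \<Rightarrow> (real \<Rightarrow> real \<Rightarrow> real) \<Rightarrow> bool" where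
  "separates j u U \<longleftrightarrow>
     (\<forall>\<delta>>0. Fm 0 (0, u) > j * \<delta> \<longrightarrow>
        (\<forall>k::nat. k \<ge> 1 \<longrightarrow>
            ule (Sminus j \<delta> u k) (0, \<lambda>r. U r (real k * \<delta>)) \<and>
            ule (0, \<lambda>r. U r (real k * \<delta>)) (Splus j \<delta> u k)))"

end

theory Submission
  imports Defs "HOL-Probability.Probability" "HOL-Real_Asymp.Real_Asymp"
begin

text \<open>Everything is expressed through the distribution functions F(r) = F(r; mu). Partial integration turns
  the Neumann heat flow of mu into an affine Dirichlet flow of F, which is monotone because the Dirichlet
  kernel is positive, while the cutting operator becomes F \<mapsto> max(F - j d, 0) away from r = 0. These two
  maps are monotone and their commutator has a sign, which yields monotonicity of the barriers under
  refinement of the time step; as K (G K)^n = (K G)^n K, upper and lower barriers with the same step d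
  differ by at most j d. So the barriers at time t have a unique common limit. The densities of the
  upper barriers are equicontinuous in r, uniformly in the time step, since the mass added and removed
  during the last time span s changes the density by at most O(sqrt s). Hence the limit distribution
  functions have densities, and these are jointly continuous.\<close>

section \<open>The heat kernel on the circle\<close>

text \<open>Two features shape the argument. At r = 0 the atom makes F jump, so there the cutting
  step is not F \<mapsto> max(F - j d, 0). A single point does not affect an integral against the
  Dirichlet kernel, and the mass M, which never changes, enters the flow as a fixed boundary value;
  at r = 0 the comparison with the lower barriers comes from conservation of mass instead. Moreover,
  monotonicity under refinement relates two steps only if one is a multiple of the other. At a fixed
  time t = p a = q b this suffices, because a and b have the common refinement a / q = b / p; so the
  dyadic steps t / 2^m determine the limit, and all other barriers are compared with them. The order
  arguments control distribution functions only. A density is recovered at a point from the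
  increment of F over a short interval, with an error given by its modulus of continuity in r. The
  same device transfers continuity in t from F to the density, in place of an estimate of the
  density in time. The sqrt s arises from summing d / sqrt(k d) over k d \<le> s, an integrable
  singularity.\<close>

definition theta :: "real \<Rightarrow> real \<Rightarrow> real" where
  "theta t x = (\<Sum>\<^sub>\<infinity>n\<in>(UNIV::int set). Gk t x (2 * of_int n))"

lemma Gk_pos: "t > 0 \<Longrightarrow> 0 < Gk t x y"
  by (simp add: Gk_def)

lemma Gk_nonneg: "t > 0 \<Longrightarrow> 0 \<le> Gk t x y"
  using Gk_pos less_imp_le by blast

lemma Gk_eq_normal_density: "t > 0 \<Longrightarrow> Gk t x y = normal_density y (sqrt t) x"
  by (simp add: Gk_def normal_density_def)

lemma Gk_diff: "Gk t x (a + b) = Gk t (x - a) b"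
  by (simp add: Gk_def algebra_simps)

lemma Gk_measurable [measurable]: "(\<lambda>y. Gk t x y) \<in> borel_measurable borel"
  "(\<lambda>y. Gk t y x) \<in> borel_measurable borel"
  unfolding Gk_def by measurable

lemma exp_neg_le_inverse:
  assumes "(z::real) \<ge> 0" shows "exp (-z) \<le> 1 / (1 + z)"
proof -
  have "1 + z \<le> exp z" by (rule exp_ge_add_one_self)
  then show ?thesis using assms by (simp add: exp_minus field_simps)
qed

lemma inverse_one_plus_sq_summable: "(\<lambda>n::int. 1 / (1 + (of_int n)\<^sup>2) :: real) summable_on UNIV"
proof -
  let ?f = "\<lambda>n::int. 1 / (1 + (of_int n)\<^sup>2) :: real"
  have s: "summable (\<lambda>n::nat. 1 / (1 + (real n)\<^sup>2))"
  proof (rule summable_comparison_test)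
    show "summable (\<lambda>n::nat. inverse ((real n)^2))"
      by (rule inverse_power_summable) simp
    show "\<exists>N. \<forall>n\<ge>N. norm (1 / (1 + (real n)\<^sup>2)) \<le> inverse ((real n)\<^sup>2)"
      by (rule exI[of _ 1]) (auto simp: inverse_eq_divide intro!: frac_le)
  qed
  have n: "(\<lambda>n::nat. 1 / (1 + (real n)\<^sup>2)) summable_on UNIV"
    by (rule norm_summable_imp_summable_on) (use s in simp)
  have p: "?f summable_on range int"
    by (subst summable_on_reindex) (use n in \<open>auto simp: o_def\<close>)
  have m: "?f summable_on range (\<lambda>n. - int n)"
    by (subst summable_on_reindex) (use n in \<open>auto simp: o_def inj_on_def\<close>)
  have "?f summable_on (range int \<union> (range (\<lambda>n. - int n) - range int))"
    by (rule summable_on_Un_disjoint[OF p summable_on_subset_banach[OF m]]) auto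
  moreover have "range int \<union> (range (\<lambda>n. - int n) - range int) = UNIV"
  proof -
    have "x \<in> range int \<union> range (\<lambda>n. - int n)" for x :: int
      by (cases x rule: int_cases2) auto
    then show ?thesis by blast
  qed
  ultimately show ?thesis by simp
qed

definition zeta_bound :: real where
  "zeta_bound = (\<Sum>\<^sub>\<infinity>n\<in>(UNIV::int set). 1 / (1 + (of_int n)\<^sup>2))"

text \<open>A majorant summable in \<open>n\<close> and uniform for t in [a, b] and |x| \<le> R, as
  the Weierstrass test in \<open>theta_continuous\<close> requires. The Gaussian decay in
  \<open>n\<close> is given up for 1 / (1 + n^2).\<close>

lemma Gk_lattice_bound:
  assumes "0 < a" "a \<le> t" "t \<le> b" "\<bar>x\<bar> \<le> R"
  shows "Gk t x (2 * of_int n)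
     \<le> exp (R\<^sup>2 / (2 * a)) / sqrt (2 * pi * a) * ((1 + b) * (1 / (1 + (of_int n)\<^sup>2)))"
proof -
  define N where "N = (of_int n :: real)"
  have t: "t > 0" "b > 0" using assms by auto
  have 1: "(x - 2 * N)\<^sup>2 \<ge> 2 * N\<^sup>2 - x\<^sup>2"
  proof -
    have "0 \<le> 2 * (x - N)\<^sup>2" by simp
    then show ?thesis by (simp add: power2_eq_square algebra_simps)
  qed
  have x2: "x\<^sup>2 \<le> R\<^sup>2" using assms(4) by (metis abs_ge_zero power2_abs power_mono)
  have "- ((x - 2 * N)\<^sup>2) / (2 * t) \<le> (x\<^sup>2 - 2 * N\<^sup>2) / (2 * t)"
    using 1 t by (intro divide_right_mono) auto
  also have "\<dots> = x\<^sup>2 / (2*t) - N\<^sup>2 / t" using t by (simp add: field_simps)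
  also have "\<dots> \<le> R\<^sup>2 / (2*a) - N\<^sup>2 / b"
    using x2 assms t by (intro diff_mono frac_le) auto
  finally have "exp (- ((x - 2 * N)\<^sup>2) / (2 * t)) \<le> exp (R\<^sup>2 / (2*a)) * exp (- (N\<^sup>2 / b))"
    by (simp flip: exp_add)
  also have "\<dots> \<le> exp (R\<^sup>2 / (2*a)) * (1 / (1 + N\<^sup>2 / b))"
    using t by (intro mult_left_mono exp_neg_le_inverse) auto
  also have "1 / (1 + N\<^sup>2 / b) \<le> (1 + b) * (1 / (1 + N\<^sup>2))"
  proof -
    have "1 + N\<^sup>2 \<le> (1 + b) * (1 + N\<^sup>2 / b)"
      using t by (simp add: field_simps)
    moreover have "1 + N\<^sup>2 > 0" "1 + N\<^sup>2 / b > 0" using t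
      by (auto intro!: add_pos_nonneg)
    ultimately show ?thesis by (simp add: field_simps)
  qed
  finally have 2: "exp (- ((x - 2 * N)\<^sup>2) / (2 * t)) \<le> exp (R\<^sup>2 / (2*a)) * ((1 + b) * (1 / (1 + N\<^sup>2)))"
    by simp
  have "Gk t x (2 * N) \<le> exp (R\<^sup>2 / (2*a)) * ((1 + b) * (1 / (1 + N\<^sup>2))) / sqrt (2 * pi * a)"
    unfolding Gk_def using 2 assms t
    by (intro frac_le) (auto intro!: mult_nonneg_nonneg divide_nonneg_nonneg add_nonneg_nonneg)
  then show ?thesis by (simp add: N_def mult.commute mult.left_commute)
qed

lemma Gk_lattice_dominated_summable:
  "(\<lambda>n::int. C * ((1 + b) * (1 / (1 + (of_int n)\<^sup>2))) :: real) summable_on UNIV"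
  by (intro summable_on_cmult_right inverse_one_plus_sq_summable)

lemma Gk_lattice_summable: "t > 0 \<Longrightarrow> (\<lambda>n::int. Gk t x (2 * of_int n)) summable_on A"
  by (rule summable_on_subset_banach[of _ UNIV],
      rule summable_on_comparison_test[OF Gk_lattice_dominated_summable[of "exp (\<bar>x\<bar>\<^sup>2 / (2 * t)) / sqrt (2 * pi * t)" t]])
     (use Gk_lattice_bound[of t t t x "\<bar>x\<bar>"] in \<open>simp_all only: Gk_nonneg order.refl subset_UNIV\<close>)

lemma theta_continuous: "continuous_on ({0<..} \<times> UNIV) (\<lambda>(t, x). theta t x)"
proof -
  have A: "continuous_on ({a<..<b} \<times> {-R<..<R}) (\<lambda>(t, x). theta t x)" if "0 < a" for a b R
  proof -
    have "uniform_limit ({a<..<b} \<times> {-R<..<R}) (\<lambda>X y. \<Sum>n\<in>X. (\<lambda>n::int. \<lambda>(t,x). Gk t x (2 * of_int n)) n y) 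
      (\<lambda>y. \<Sum>\<^sub>\<infinity>n\<in>UNIV. (\<lambda>n::int. \<lambda>(t,x). Gk t x (2 * of_int n)) n y) (finite_subsets_at_top UNIV)"
      apply (rule Weierstrass_m_test_general[OF _ Gk_lattice_dominated_summable[of "exp (R\<^sup>2 / (2 * a)) / sqrt (2 * pi * a)" b]])
      using Gk_lattice_bound[of a _ b _ R] that by (auto simp: Gk_nonneg)
    then have "continuous_on ({a<..<b} \<times> {-R<..<R}) (\<lambda>y. \<Sum>\<^sub>\<infinity>n\<in>UNIV. (\<lambda>n::int. \<lambda>(t,x). Gk t x (2 * of_int n)) n y)"
      apply (rule uniform_limit_theorem[rotated])
       apply (auto intro!: always_eventually continuous_on_sum)
      unfolding Gk_def case_prod_unfold using that
      apply (intro continuous_intros)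
      apply auto
      done
    then show ?thesis by (simp add: theta_def case_prod_unfold)
  qed
  show ?thesis
  proof (rule continuous_at_imp_continuous_on, rule ballI)
    fix z :: "real \<times> real" assume "z \<in> {0<..} \<times> UNIV"
    then obtain t x where z: "z = (t, x)" and t: "t > 0" by auto
    have "open ({t/2<..<t+1} \<times> {-(\<bar>x\<bar>+1)<..<\<bar>x\<bar>+1})" by (intro open_Times) auto
    moreover have "(t,x) \<in> {t/2<..<t+1} \<times> {-(\<bar>x\<bar>+1)<..<\<bar>x\<bar>+1}" using t by auto
    ultimately show "isCont (\<lambda>(t,x). theta t x) z"
      unfolding z using A[of "t/2" "t+1" "\<bar>x\<bar>+1"] t by (simp add: continuous_on_eq_continuous_at)
  qed
qed

lemma theta_continuous_compose [continuous_intros]: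
  assumes "continuous_on S f" "continuous_on S g" "\<And>x. x \<in> S \<Longrightarrow> f x > 0"
  shows "continuous_on S (\<lambda>x. theta (f x) (g x))"
proof -
  have "continuous_on S (\<lambda>x. (\<lambda>(t, x). theta t x) (f x, g x))"
    using theta_continuous by (rule continuous_on_compose2) (use assms in \<open>auto intro!: continuous_intros\<close>)
  then show ?thesis by simp
qed

lemma theta_nonneg: "t > 0 \<Longrightarrow> 0 \<le> theta t x"
  unfolding theta_def by (intro infsum_nonneg) (auto simp: Gk_nonneg)

lemma theta_minus: "theta t (- x) = theta t x"
proof -
  have "(\<Sum>\<^sub>\<infinity>n\<in>(UNIV::int set). Gk t (-x) (2 * of_int n)) = (\<Sum>\<^sub>\<infinity>n\<in>UNIV. Gk t (-x) (2 * of_int (- n)))"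
    by (rule infsum_reindex_bij_betw[symmetric, where g = uminus]) (auto simp: bij_betw_def inj_on_def)
  also have "\<dots> = (\<Sum>\<^sub>\<infinity>n\<in>UNIV. Gk t x (2 * of_int n))"
    by (intro infsum_cong) (simp add: Gk_def power2_commute add.commute)
  finally show ?thesis by (simp add: theta_def)
qed

lemma theta_plus_2n: "theta t (x + 2 * of_int m) = theta t x"
proof -
  have "theta t (x + 2 * of_int m) = (\<Sum>\<^sub>\<infinity>n\<in>UNIV. Gk t (x + 2 * of_int m) (2 * of_int (n + m)))"
    unfolding theta_def
    by (rule infsum_reindex_bij_betw[symmetric, where g = "\<lambda>n. n + m"])
       (auto simp: bij_betw_def inj_on_def intro: image_eqI[of _ _ "_ - m"])
  also have "\<dots> = theta t x" unfolding theta_def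
    by (intro infsum_cong) (simp add: Gk_def)
  finally show ?thesis .
qed

lemma theta_plus_2: "theta t (x + 2) = theta t x"
  using theta_plus_2n[of t x 1] by simp

lemma theta_2_minus: "theta t (2 - x) = theta t x"
  using theta_plus_2[of t "-x"] by (simp add: theta_minus)

lemma theta_diff_swap: "theta t (x - y) = theta t (y - x)"
  using theta_minus[of t "x - y"] by simp

text \<open>The reflections at 0 and 1 generate the shifts by 2 and the sign change, so [0,1] is
  half of a circle of length 2 and the images of y form the two families 2n + y and 2n - y. Neumann
  and Dirichlet kernels thus reduce to the even, 2-periodic function \<open>theta\<close>.\<close>

lemma Gneum_eq_theta: "t > 0 \<Longrightarrow> Gneum t x y = theta t (x - y) + theta t (x + y)"
proof -
  assume t: "t > 0"
  have a: "Gk t x (2 * of_int n + y) = Gk t (x - y) (2 * of_int n)" for n::int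
    using Gk_diff[of t x y "2 * of_int n"] by (simp add: add.commute)
  have b: "Gk t x (2 * of_int n - y) = Gk t (x + y) (2 * of_int n)" for n::int
    using Gk_diff[of t x "-y" "2 * of_int n"] by (simp add: add.commute)
  show ?thesis unfolding Gneum_def theta_def a b
    by (rule infsum_add) (auto intro: Gk_lattice_summable t)
qed

lemma Gk_le_theta: "t > 0 \<Longrightarrow> Gk t x 0 \<le> theta t x"
proof -
  assume t: "t > 0"
  have "(\<Sum>\<^sub>\<infinity>n\<in>{0::int}. Gk t x (2 * of_int n)) \<le> theta t x"
    unfolding theta_def
    by (rule infsum_mono_neutral) (auto intro: Gk_lattice_summable t Gk_nonneg)
  then show ?thesis by simp
qed

text \<open>The 16 is the 8 of 2 / z^2 = 8 t^2 / n^4 for z = n^2 / (2 t), doubled by 1 + n^2 \<le> 2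
  n^2 for n \<noteq> 0.\<close>

definition tail_const :: real where "tail_const = 16 * zeta_bound / sqrt (2 * pi)"

lemma zeta_bound_nonneg: "zeta_bound \<ge> 0"
  unfolding zeta_bound_def by (intro infsum_nonneg) auto

lemma tail_const_nonneg: "tail_const \<ge> 0"
  using zeta_bound_nonneg by (simp add: tail_const_def)

text \<open>The lattice points 2n with n \<noteq> 0 are at distance at least |n| from x. The
  exponential is bounded by 2 / z^2 rather than 1 / z so that the remainder is of order t^(3/2):
  only a power larger than 1 survives the summation over n steps of length t / n in
  \<open>dir_nonneg\<close>.\<close>

lemma theta_upper:
  assumes t: "t > 0" and x: "\<bar>x\<bar> \<le> 1"
  shows "theta t x \<le> Gk t x 0 + tail_const * t\<^sup>2 / sqrt t"
proof -
  have b: "Gk t x (2 * of_int n) \<le> (16 * t\<^sup>2 / sqrt (2 * pi * t)) * (1 / (1 + (of_int n)\<^sup>2))" if "n \<noteq> 0" for n :: int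
  proof -
    define N where "N = (of_int n :: real)"
    have "\<bar>n\<bar> \<ge> 1" using that by auto
    then have N: "\<bar>N\<bar> \<ge> 1" unfolding N_def by (metis of_int_1_le_iff of_int_abs)
    then have N2: "N\<^sup>2 \<ge> 1" by (metis abs_ge_zero one_le_power power2_abs)
    have "\<bar>x - 2 * N\<bar> \<ge> \<bar>N\<bar>" using x N by linarith
    then have "N\<^sup>2 \<le> (x - 2*N)\<^sup>2" using abs_le_square_iff by blast
    then have 1: "exp (- ((x - 2 * N)\<^sup>2) / (2 * t)) \<le> exp (- (N\<^sup>2 / (2*t)))"
      using t by (simp add: divide_right_mono)
    define z where "z = N\<^sup>2 / (2*t)"
    have z: "z > 0" unfolding z_def using N2 t by (intro divide_pos_pos) linarith+
    have "exp (- z) \<le> 2 / z\<^sup>2"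
    proof -
      have "z\<^sup>2 / 2 \<le> exp z" using exp_lower_Taylor_quadratic[of z] z by linarith
      then show ?thesis using z by (simp add: exp_minus field_simps)
    qed
    also have "2 / z\<^sup>2 = 8 * t\<^sup>2 / (N\<^sup>2)\<^sup>2" using t by (simp add: z_def power_divide power_mult_distrib)
    also have "\<dots> \<le> 8 * t\<^sup>2 / N\<^sup>2" using N2 self_le_power[of "N\<^sup>2" 2] by (intro divide_left_mono) auto
    also have "\<dots> \<le> 16 * t\<^sup>2 * (1 / (1 + N\<^sup>2))"
    proof -
      have "8 * t\<^sup>2 * (1 + N\<^sup>2) \<le> 8 * t\<^sup>2 * (2 * N\<^sup>2)" using N2 by (intro mult_left_mono) auto
      then have "8 * t\<^sup>2 * (1 + N\<^sup>2) \<le> 16 * t\<^sup>2 * N\<^sup>2" by simp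
      moreover have "N\<^sup>2 > 0" "1 + N\<^sup>2 > 0" using N2 by auto
      ultimately show ?thesis by (simp add: frac_le_eq field_simps)
    qed
    finally have 2: "exp (-z) \<le> 16 * t\<^sup>2 * (1 / (1 + N\<^sup>2))" .
    have "Gk t x (2 * N) \<le> 16 * t\<^sup>2 * (1 / (1 + N\<^sup>2)) / sqrt (2 * pi * t)"
      unfolding Gk_def using order_trans[OF 1 2[unfolded z_def]] t by (intro divide_right_mono) auto
    then show ?thesis by (simp add: N_def mult.commute)
  qed
  let ?c = "16 * t\<^sup>2 / sqrt (2 * pi * t)"
  have c: "?c \<ge> 0" using t by simp
  have "theta t x = (\<Sum>\<^sub>\<infinity>n\<in>{0::int}. Gk t x (2 * of_int n)) + (\<Sum>\<^sub>\<infinity>n\<in>-{0::int}. Gk t x (2 * of_int n))"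
    unfolding theta_def
    by (subst infsum_Un_disjoint[symmetric]) (auto intro: Gk_lattice_summable t)
  also have "(\<Sum>\<^sub>\<infinity>n\<in>-{0::int}. Gk t x (2 * of_int n)) \<le> (\<Sum>\<^sub>\<infinity>n\<in>UNIV. ?c * (1 / (1 + (of_int n)\<^sup>2)))"
  proof (rule infsum_mono_neutral)
    show "(\<lambda>n::int. ?c * (1 / (1 + (of_int n)\<^sup>2))) summable_on UNIV"
      by (intro summable_on_cmult_right inverse_one_plus_sq_summable)
  qed (use c b in \<open>auto intro: Gk_lattice_summable t\<close>)
  also have "\<dots> = ?c * zeta_bound" unfolding zeta_bound_def by (rule infsum_cmult_right')
  also have "\<dots> = tail_const * t\<^sup>2 / sqrt t" by (simp add: tail_const_def real_sqrt_mult)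
  finally show ?thesis by simp
qed

section \<open>Periodization: total mass and semigroup law on the circle\<close>

lemma theta_borel [measurable]: "t > 0 \<Longrightarrow> theta t \<in> borel_measurable borel"
  by (intro borel_measurable_continuous_onI continuous_intros) auto

text \<open>Sums and integrals are interchanged by \<open>nn_integral_suminf\<close>, which is about
  series over the naturals; \<open>int_decode\<close> enumerates the integers for it.\<close>

lemma theta_sums_Gk:
  assumes "t > 0"
  shows "(\<lambda>k. Gk t x (2 * of_int (int_decode k))) sums theta t x"
proof -
  have "((\<lambda>n::int. Gk t x (2 * of_int n)) has_sum theta t x) UNIV"
    unfolding theta_def by (rule has_sum_infsum[OF Gk_lattice_summable[OF assms]])
  then have "((\<lambda>k. Gk t x (2 * of_int (int_decode k))) has_sum theta t x) UNIV"
    by (subst has_sum_reindex_bij_betw[OF bij_int_decode])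
  then show ?thesis by (rule has_sum_imp_sums)
qed

lemma ennreal_theta: "t > 0 \<Longrightarrow> ennreal (theta t x) = (\<Sum>k. ennreal (Gk t x (2 * of_int (int_decode k))))"
  using theta_sums_Gk[of t x] by (subst suminf_ennreal2) (auto simp: Gk_nonneg sums_iff)

text \<open>The cells [2n - 1, 2n + 1) are half-open so that they tile the line and every point is
  counted exactly once.\<close>

lemma suminf_indicator_unit_cells:
  "(\<Sum>k. indicator {2 * of_int (int_decode k) - 1..<2 * of_int (int_decode k) + 1} (y::real)) = (1::ennreal)"
proof -
  define n where "n = \<lfloor>(y + 1) / 2\<rfloor>"
  have iff: "y \<in> {2 * of_int m - 1..<2 * of_int m + 1} \<longleftrightarrow> m = n" for m :: int
    unfolding n_def by (auto simp: floor_eq_iff eq_commute[of m] field_simps)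
  define k0 where "k0 = int_encode n"
  have "(\<lambda>k. indicator {2 * of_int (int_decode k) - 1..<2 * of_int (int_decode k) + 1} (y::real) :: ennreal)
     = (\<lambda>k. if k = k0 then 1 else 0)"
    using iff by (auto simp: indicator_def fun_eq_iff k0_def)
  moreover have "(\<Sum>k. if k = k0 then 1 else (0::ennreal)) = 1"
    by (rule sums_unique[symmetric]) (rule sums_If_finite_set[of "{k0}" "\<lambda>_. 1::ennreal", simplified])
  ultimately show ?thesis by simp
qed

text \<open>Unfolding the circle: periodizing the kernel is the same as integrating a periodic function
  against the kernel on the whole line.\<close>
lemma nn_integral_theta_unfold:
  assumes t: "t > 0" and [measurable]: "q \<in> borel_measurable borel"
    and per: "\<And>y n. q (y + 2 * of_int n) = (q y :: ennreal)"
  shows "(\<integral>\<^sup>+y. ennreal (theta t (x - y)) * q y * indicator {-1..<1} y \<partial>lborel)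
       = (\<integral>\<^sup>+y. ennreal (Gk t x y) * q y \<partial>lborel)"
proof -
  let ?d = "\<lambda>k. 2 * real_of_int (int_decode k)"
  have "(\<integral>\<^sup>+y. ennreal (theta t (x - y)) * q y * indicator {-1..<1} y \<partial>lborel)
     = (\<integral>\<^sup>+y. (\<Sum>k. ennreal (Gk t (x - y) (?d k)) * q y * indicator {-1..<1} y) \<partial>lborel)"
    using t by (simp add: ennreal_theta)
  also have "\<dots> = (\<Sum>k. \<integral>\<^sup>+y. ennreal (Gk t (x - y) (?d k)) * q y * indicator {-1..<1} y \<partial>lborel)"
    by (subst nn_integral_suminf) (auto simp: Gk_def)
  also have "\<dots> = (\<Sum>k. \<integral>\<^sup>+y. ennreal (Gk t x y) * q y * indicator {?d k - 1..<?d k + 1} y \<partial>lborel)"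
  proof (rule suminf_cong)
    fix k
    have "(\<integral>\<^sup>+y. ennreal (Gk t x y) * q y * indicator {?d k - 1..<?d k + 1} y \<partial>lborel)
      = (\<integral>\<^sup>+y. ennreal (Gk t x (?d k + y)) * q (?d k + y) * indicator {?d k - 1..<?d k + 1} (?d k + y) \<partial>lborel)"
      by (subst nn_integral_real_affine[where c = 1 and t = "?d k"]) auto
    also have "\<dots> = (\<integral>\<^sup>+y. ennreal (Gk t (x - y) (?d k)) * q y * indicator {-1..<1} y \<partial>lborel)"
    proof (rule nn_integral_cong)
      fix y
      have "q (?d k + y) = q y" using per[of y "int_decode k"] by (simp add: add.commute)
      moreover have "Gk t x (?d k + y) = Gk t (x - y) (?d k)" by (simp add: Gk_diff[symmetric] add.commute)
      ultimately show "ennreal (Gk t x (?d k + y)) * q (?d k + y) * indicator {?d k - 1..<?d k + 1} (?d k + y)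
        = ennreal (Gk t (x - y) (?d k)) * q y * indicator {-1..<1} y"
        by (auto simp: indicator_def)
    qed
    finally show "(\<integral>\<^sup>+y. ennreal (Gk t (x - y) (?d k)) * q y * indicator {-1..<1} y \<partial>lborel) =
      (\<integral>\<^sup>+y. ennreal (Gk t x y) * q y * indicator {?d k - 1..<?d k + 1} y \<partial>lborel)" by simp
  qed
  also have "\<dots> = (\<integral>\<^sup>+y. (\<Sum>k. ennreal (Gk t x y) * q y * indicator {?d k - 1..<?d k + 1} y) \<partial>lborel)"
    by (subst nn_integral_suminf) auto
  also have "\<dots> = (\<integral>\<^sup>+y. ennreal (Gk t x y) * q y \<partial>lborel)"
    by (simp add: suminf_indicator_unit_cells)
  finally show ?thesis .
qed

lemma nn_integral_Gk: "t > 0 \<Longrightarrow> (\<integral>\<^sup>+y. ennreal (Gk t x y) \<partial>lborel) = 1"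
proof -
  assume t: "t > 0"
  have "Gk t x y = normal_density x (sqrt t) y" for y
    using t by (simp add: Gk_def normal_density_def power2_commute)
  then show ?thesis
    using t nn_integral_eq_integral[of lborel "normal_density x (sqrt t)"]
    by (simp add: normal_density_nonneg)
qed

lemma nn_integral_Gk_Gk:
  assumes s: "s > 0" and t: "t > 0"
  shows "(\<integral>\<^sup>+y. ennreal (Gk s x y) * ennreal (Gk t y z) \<partial>lborel) = ennreal (Gk (s + t) x z)"
proof -
  have "(\<integral>\<^sup>+y. ennreal (Gk s x y) * ennreal (Gk t y z) \<partial>lborel)
     = (\<integral>\<^sup>+y. ennreal (Gk s x (z + y)) * ennreal (Gk t (z + y) z) \<partial>lborel)"
    by (subst nn_integral_real_affine[where c = 1 and t = z]) auto
  also have "\<dots> = (\<integral>\<^sup>+y. ennreal (normal_density 0 (sqrt s) ((x - z) - y) * normal_density 0 (sqrt t) y) \<partial>lborel)"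
    using s t by (intro nn_integral_cong) (simp add: ennreal_mult'[symmetric] Gk_eq_normal_density normal_density_nonneg normal_density_def algebra_simps)
  also have "\<dots> = ennreal (normal_density 0 (sqrt (s + t)) (x - z))"
    using conv_normal_density_zero_mean[of "sqrt s" "sqrt t", THEN fun_cong, of "x - z"] s t by simp
  also have "\<dots> = ennreal (Gk (s + t) x z)"
    using s t by (simp add: Gk_def normal_density_def)
  finally show ?thesis .
qed

lemma nn_integral_theta: 
  assumes t: "t > 0"
  shows "(\<integral>\<^sup>+y. ennreal (theta t (x - y)) * indicator {-1..<1} y \<partial>lborel) = 1"
  using nn_integral_theta_unfold[OF t, of "\<lambda>_. 1" x] nn_integral_Gk[OF t, of x] by simp

text \<open>Chapman-Kolmogorov on the circle. Only the first kernel is unfolded, with the second in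
  the role of the periodic function; then the second is expanded into its images, and each term is
  the Gaussian identity on the line.\<close>

lemma nn_integral_theta_theta:
  assumes s: "s > 0" and t: "t > 0"
  shows "(\<integral>\<^sup>+y. ennreal (theta s (x - y)) * ennreal (theta t (y - z)) * indicator {-1..<1} y \<partial>lborel)
    = ennreal (theta (s + t) (x - z))"
proof -
  have [measurable]: "(\<lambda>y. theta t (y - z)) \<in> borel_measurable borel"
    using t by (intro borel_measurable_continuous_onI continuous_intros) auto
  have "(\<integral>\<^sup>+y. ennreal (theta s (x - y)) * ennreal (theta t (y - z)) * indicator {-1..<1} y \<partial>lborel)
     = (\<integral>\<^sup>+y. ennreal (Gk s x y) * ennreal (theta t (y - z)) \<partial>lborel)"
  proof (rule nn_integral_theta_unfold[OF s])
    show "ennreal (theta t (y + 2 * of_int n - z)) = ennreal (theta t (y - z))" for y n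
      using theta_plus_2n[of t "y - z" n] by (simp add: algebra_simps)
  qed simp
  also have "\<dots> = (\<integral>\<^sup>+y. (\<Sum>k. ennreal (Gk s x y) * ennreal (Gk t y (z + 2 * of_int (int_decode k)))) \<partial>lborel)"
    using t by (simp add: ennreal_theta Gk_diff)
  also have "\<dots> = (\<Sum>k. \<integral>\<^sup>+y. ennreal (Gk s x y) * ennreal (Gk t y (z + 2 * of_int (int_decode k))) \<partial>lborel)"
    by (subst nn_integral_suminf) auto
  also have "\<dots> = (\<Sum>k. ennreal (Gk (s + t) (x - z) (2 * of_int (int_decode k))))"
    using s t by (simp add: nn_integral_Gk_Gk Gk_diff[symmetric])
  also have "\<dots> = ennreal (theta (s + t) (x - z))"
    using s t by (simp add: ennreal_theta)
  finally show ?thesis .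
qed

lemma nn_integral_cont_Ico:
  fixes f :: "real \<Rightarrow> real"
  assumes "continuous_on UNIV f" "\<And>x. 0 \<le> f x" "(\<integral>\<^sup>+y. ennreal (f y) * indicator {a..<b} y \<partial>lborel) = ennreal c" "c \<ge> 0"
  shows "(f has_integral c) {a..b}"
proof -
  have [measurable]: "f \<in> borel_measurable borel" by (rule borel_measurable_continuous_onI[OF assms(1)])
  have "(\<integral>\<^sup>+y. ennreal (f y) * indicator {a..b} y \<partial>lborel) = (\<integral>\<^sup>+y. ennreal (f y) * indicator {a..<b} y \<partial>lborel)"
  proof (rule nn_integral_cong_AE)
    have "AE y in lborel. y \<noteq> b" by (rule AE_lborel_singleton)
    then show "AE y in lborel. ennreal (f y) * indicator {a..b} y = ennreal (f y) * indicator {a..<b} y"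
      by eventually_elim (auto simp: indicator_def)
  qed
  then have "(\<integral>\<^sup>+y. ennreal (indicator {a..b} y * f y) \<partial>lborel) = ennreal c"
    using assms by (simp add: ennreal_mult'' ennreal_indicator mult.commute)
  then have "((\<lambda>y. indicator {a..b} y * f y) has_integral c) UNIV"
    using assms by (intro nn_integral_has_integral) (use assms in auto)
  moreover have "(\<lambda>y. indicator {a..b} y * f y) = (\<lambda>x. if x \<in> {a..b} then f x else 0)"
    by (auto simp: indicator_def)
  ultimately show ?thesis
    by (subst has_integral_restrict_UNIV[symmetric]) simp
qed

lemma has_integral_shift_real:
  fixes f :: "real \<Rightarrow> real"
  assumes "(f has_integral i) {a..b}"
  shows "((\<lambda>x. f (x + c)) has_integral i) {a - c..b - c}"
  using has_integral_affinity[of f i a b 1 c] assms by (simp add: add.commute)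

lemma has_integral_theta: "t > 0 \<Longrightarrow> ((\<lambda>y. theta t (x - y)) has_integral 1) {-1..1}"
  using nn_integral_theta[of t x]
  by (intro nn_integral_cont_Ico) (auto intro!: continuous_intros simp: theta_nonneg)

lemma has_integral_theta_theta:
  assumes s: "s > 0" and t: "t > 0"
  shows "((\<lambda>y. theta s (x - y) * theta t (y - z)) has_integral theta (s + t) (x - z)) {-1..1}"
  using nn_integral_theta_theta[OF assms, of x z] assms
  by (intro nn_integral_cont_Ico) (auto intro!: continuous_intros simp: theta_nonneg ennreal_mult)

section \<open>The odd primitive of \<open>theta\<close>\<close>

definition Theta :: "real \<Rightarrow> real \<Rightarrow> real" where
  "Theta t x = (if x \<ge> 0 then integral {0..x} (theta t) else - integral {x..0} (theta t))"

lemma theta_integrable: "t > 0 \<Longrightarrow> theta t integrable_on {a..b}"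
  by (intro integrable_continuous_real continuous_intros) auto

lemma integral_theta_Theta:
  assumes t: "t > 0" and ab: "a \<le> b"
  shows "(theta t has_integral Theta t b - Theta t a) {a..b}"
proof -
  have I: "(theta t has_integral integral {a..b} (theta t)) {a..b}"
    using theta_integrable[OF t] by (rule integrable_integral)
  have c: "integral {p..q} (theta t) + integral {q..r} (theta t) = integral {p..r} (theta t)" if "p \<le> q" "q \<le> r" for p q r
    using that theta_integrable[OF t] by (intro Henstock_Kurzweil_Integration.integral_combine) auto
  have "integral {a..b} (theta t) = Theta t b - Theta t a"
    unfolding Theta_def using c[of 0 a b] c[of a 0 b] c[of a b 0] ab by auto
  with I show ?thesis by simp
qed

lemma Theta_minus: "Theta t (- x) = - Theta t x"
proof -
  have "integral {-x..0} (theta t) = integral {0..x} (theta t)" for x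
    using Henstock_Kurzweil_Integration.integral_reflect_real[of x 0 "theta t"] by (simp add: theta_minus)
  from this[of x] this[of "-x"] show ?thesis by (auto simp: Theta_def)
qed

lemma Theta_0: "Theta t 0 = 0" by (simp add: Theta_def)

lemma Theta_1: "t > 0 \<Longrightarrow> Theta t 1 = 1 / 2"
proof -
  assume t: "t > 0"
  have "(theta t has_integral 1) {-1..1}"
    using has_integral_theta[OF t, of 0] by (simp add: theta_minus)
  moreover have "(theta t has_integral Theta t 1 - Theta t (-1)) {-1..1}"
    by (rule integral_theta_Theta[OF t]) simp
  ultimately have "Theta t 1 - Theta t (-1) = 1" by (rule has_integral_unique[symmetric])
  then show ?thesis by (simp add: Theta_minus)
qed

lemma Theta_mono: "t > 0 \<Longrightarrow> a \<le> b \<Longrightarrow> Theta t a \<le> Theta t b"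
  using has_integral_nonneg[OF integral_theta_Theta[of t a b]] by (simp add: theta_nonneg)

text \<open>Evenness and period 2 make \<open>theta\<close> symmetric about 1, so its integrals over
  [1 - y, 1] and [1, 1 + y] agree. The identity evaluates the boundary terms at r = 1 in the tail
  integrals of the Neumann kernel.\<close>

lemma Theta_reflect_1: 
  assumes t: "t > 0" shows "Theta t (1 + y) + Theta t (1 - y) = 1"
proof -
  have *: "Theta t (1 + y) + Theta t (1 - y) = 1" if y: "y \<ge> 0" for y
  proof -
    have "(theta t has_integral Theta t (1 + y) - Theta t 1) {1..1+y}"
      using y by (intro integral_theta_Theta t) auto
    moreover have "(theta t has_integral Theta t 1 - Theta t (1 - y)) {1..1+y}"
    proof -
      have "(theta t has_integral Theta t (-(1 - y)) - Theta t (-1)) {-1..-(1-y)}"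
        using y by (intro integral_theta_Theta t) auto
      then have "((\<lambda>x. theta t (x - 2)) has_integral Theta t (-(1 - y)) - Theta t (-1)) {1..1+y}"
        using has_integral_shift_real[of "theta t" _ "-1" "-(1-y)" "-2"] by (simp add: algebra_simps)
      moreover have "theta t (x - 2) = theta t x" for x
        using theta_plus_2[of t "x - 2"] by simp
      ultimately show ?thesis by (simp add: Theta_minus[of t "1 - y", simplified] Theta_minus[of t 1])
    qed
    ultimately have "Theta t (1 + y) - Theta t 1 = Theta t 1 - Theta t (1 - y)" by (rule has_integral_unique)
    then show ?thesis using Theta_1[OF t] by simp
  qed
  show ?thesis using *[of y] *[of "-y"] by (cases "y \<ge> 0") auto
qed

text \<open>Bounds the contribution to theta of all images but the nearest one.\<close>
definition eps :: "real \<Rightarrow> real" where "eps t = tail_const * t\<^sup>2 / sqrt t"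

text \<open>Of order t^(-1/2) as t tends to 0, hence integrable in time; this keeps the accumulated
  effect of the cuts small.\<close>

definition theta_sup :: "real \<Rightarrow> real" where "theta_sup t = 1 / sqrt (2 * pi * t) + eps t"

lemma eps_nonneg: "t > 0 \<Longrightarrow> 0 \<le> eps t"
  by (simp add: eps_def tail_const_nonneg)

lemma theta_sup_nonneg: "t > 0 \<Longrightarrow> 0 \<le> theta_sup t"
  by (simp add: theta_sup_def eps_nonneg)

lemma theta_le_sup: "t > 0 \<Longrightarrow> theta t x \<le> theta_sup t"
proof -
  assume t: "t > 0"
  define n where "n = \<lfloor>(x + 1) / 2\<rfloor>"
  define w where "w = x - 2 * of_int n"
  have "of_int n \<le> (x + 1) / 2" "(x + 1) / 2 < of_int n + 1" unfolding n_def by linarith+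
  then have w: "\<bar>w\<bar> \<le> 1" by (auto simp: w_def)
  have "theta t x = theta t w" using theta_plus_2n[of t w n] by (simp add: w_def)
  also have "\<dots> \<le> Gk t w 0 + eps t" using theta_upper[OF t w] by (simp add: eps_def)
  also have "Gk t w 0 \<le> 1 / sqrt (2 * pi * t)"
    using t by (auto simp: Gk_def intro!: divide_right_mono)
  finally show ?thesis by (simp add: theta_sup_def)
qed

section \<open>Dirichlet and Neumann kernels on the unit interval\<close>

text \<open>The Dirichlet kernel governs the distribution functions of solutions of the Neumann problem.\<close>
definition dir :: "real \<Rightarrow> real \<Rightarrow> real \<Rightarrow> real" where
  "dir t x y = theta t (x - y) - theta t (x + y)"

definition neu :: "real \<Rightarrow> real \<Rightarrow> real \<Rightarrow> real" where
  "neu t x y = theta t (x - y) + theta t (x + y)"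

lemma dir_commute: "dir t x y = dir t y x"
  by (simp add: dir_def theta_diff_swap[of t x y] add.commute)

lemma neu_nonneg: "t > 0 \<Longrightarrow> 0 \<le> neu t x y"
  by (simp add: neu_def theta_nonneg)

lemma neu_le: "t > 0 \<Longrightarrow> neu t x y \<le> 2 * theta_sup t"
  using theta_le_sup[of t "x - y"] theta_le_sup[of t "x + y"] by (simp add: neu_def)

lemma dir_le_neu: "t > 0 \<Longrightarrow> \<bar>dir t x y\<bar> \<le> neu t x y"
  using theta_nonneg[of t "x - y"] theta_nonneg[of t "x + y"] by (simp add: neu_def dir_def)

lemma dir_continuous [continuous_intros]:
  assumes "continuous_on S f" "continuous_on S g" "continuous_on S h" "\<And>x. x \<in> S \<Longrightarrow> f x > 0"
  shows "continuous_on S (\<lambda>x. dir (f x) (g x) (h x))"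
  unfolding dir_def using assms by (intro continuous_intros) auto

lemma neu_continuous [continuous_intros]:
  assumes "continuous_on S f" "continuous_on S g" "continuous_on S h" "\<And>x. x \<in> S \<Longrightarrow> f x > 0"
  shows "continuous_on S (\<lambda>x. neu (f x) (g x) (h x))"
  unfolding neu_def using assms by (intro continuous_intros) auto

lemma has_integral_even_half:
  fixes g :: "real \<Rightarrow> real"
  assumes g: "(g has_integral c) {-1..1}" and even: "\<And>y. g (- y) = g y"
  shows "(g has_integral c / 2) {0..1}"
proof -
  have i: "g integrable_on {0..1}" "g integrable_on {-1..0}"
    using g by (auto intro: integrable_on_subinterval[of g "{-1..1}"] simp: has_integral_integrable)
  then obtain d where d: "(g has_integral d) {0..1}" by blast
  then have "((\<lambda>x. g (- x)) has_integral d) {- 1..-0}"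
    by (subst has_integral_reflect_real) 
  then have "(g has_integral d) {-1..0}" by (simp add: even)
  from has_integral_combine[OF _ _ this d] have "(g has_integral d + d) {-1..1}" by auto
  then have "c = d + d" using g has_integral_unique by blast
  then show ?thesis using d by simp
qed

lemma has_integral_neu: "t > 0 \<Longrightarrow> ((\<lambda>y. neu t x y) has_integral 1) {0..1}"
proof -
  assume t: "t > 0"
  have "((\<lambda>y. theta t (x - y) + theta t (- x - y)) has_integral 1 + 1) {-1..1}"
    by (intro has_integral_add has_integral_theta t)
  moreover have "theta t (- x - y) = theta t (x + y)" for y using theta_minus[of t "x + y"] by simp
  ultimately have "((\<lambda>y. neu t x y) has_integral 2) {-1..1}" by (simp add: neu_def)
  from has_integral_even_half[OF this] show ?thesis by (simp add: neu_def add.commute)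
qed

text \<open>Replacing x by -x and z by -z in the circle identity gives four integrals; the signs + -
  - + combine them into the product of Dirichlet kernels, all plus signs into the Neumann product.
  Both products are even in y, the Dirichlet one because each factor is odd, so [0,1] carries half
  of the circle integral.\<close>

lemma has_integral_dir_dir:
  assumes s: "s > 0" and t: "t > 0"
  shows "((\<lambda>y. dir s x y * dir t y z) has_integral dir (s + t) x z) {0..1}"
    and has_integral_neu_neu: "((\<lambda>y. neu s x y * neu t y z) has_integral neu (s + t) x z) {0..1}"
proof -
  note I = has_integral_theta_theta[OF assms]
  have m: "theta s (- x - y) = theta s (x + y)" "theta t (y - - z) = theta t (y + z)"
     "theta (s + t) (- x - z) = theta (s + t) (x + z)" "theta (s + t) (- x + z) = theta (s + t) (x - z)" for y
    using theta_minus[of s "x + y"] theta_minus[of "s + t" "x + z"] theta_minus[of "s + t" "x - z"] by simp_all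
  have "((\<lambda>y. theta s (x - y) * theta t (y - z) - theta s (x - y) * theta t (y - - z)
      - theta s (- x - y) * theta t (y - z) + theta s (- x - y) * theta t (y - - z)) has_integral
      theta (s + t) (x - z) - theta (s + t) (x - - z) - theta (s + t) (- x - z) + theta (s + t) (- x - - z)) {-1..1}"
    by (intro has_integral_add has_integral_diff I)
  then have d: "((\<lambda>y. dir s x y * dir t y z) has_integral 2 * dir (s + t) x z) {-1..1}"
    using theta_diff_swap[of "s + t" x z] by (simp add: m dir_def algebra_simps)
  have "((\<lambda>y. theta s (x - y) * theta t (y - z) + theta s (x - y) * theta t (y - - z)
      + theta s (- x - y) * theta t (y - z) + theta s (- x - y) * theta t (y - - z)) has_integral
      theta (s + t) (x - z) + theta (s + t) (x - - z) + theta (s + t) (- x - z) + theta (s + t) (- x - - z)) {-1..1}"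
    by (intro has_integral_add I)
  then have n: "((\<lambda>y. neu s x y * neu t y z) has_integral 2 * neu (s + t) x z) {-1..1}"
    using theta_diff_swap[of "s + t" x z] by (simp add: m neu_def algebra_simps)
  have z: "theta t (- y - z) = theta t (y + z)" "theta t (z - y) = theta t (y - z)" for y
    using theta_minus[of t "y + z"] theta_minus[of t "y - z"] by simp_all
  show "((\<lambda>y. dir s x y * dir t y z) has_integral dir (s + t) x z) {0..1}"
  proof -
    have "dir s x (- y) * dir t (- y) z = dir s x y * dir t y z" for y
      by (simp add: dir_def z algebra_simps)
    from has_integral_even_half[OF d this] show ?thesis by simp
  qed
  show "((\<lambda>y. neu s x y * neu t y z) has_integral neu (s + t) x z) {0..1}"
  proof -
    have "neu s x (- y) * neu t (- y) z = neu s x y * neu t y z" for y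
      by (simp add: neu_def z algebra_simps)
    from has_integral_even_half[OF n this] show ?thesis by simp
  qed
qed

section \<open>Positivity of the Dirichlet kernel\<close>

lemma has_integral_dir_le_1:
  assumes "t > 0" "((\<lambda>y. dir t x y) has_integral c) {0..1}"
  shows "c \<le> 1"
  using dir_le_neu[OF assms(1)] by (intro has_integral_le[OF assms(2) has_integral_neu[OF assms(1), of x]]) (auto simp: abs_le_iff)

text \<open>The distance w of x + y to the nearest even integer is at least |x - y|, so the leading
  Gaussian of \<open>theta t (x + y)\<close> is dominated by that of \<open>theta t (x - y)\<close>.
  Only the other images of the former, at most \<open>eps t\<close> in total, can spoil the
  sign.\<close>

lemma dir_almost_nonneg:
  assumes t: "t > 0" and x: "x \<in> {0..1}" and y: "y \<in> {0..1}"
  shows "- eps t \<le> dir t x y"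
proof -
  define w where "w = (if x + y \<le> 1 then x + y else 2 - (x + y))"
  have w: "theta t (x + y) = theta t w" "\<bar>w\<bar> \<le> 1" "\<bar>x - y\<bar> \<le> \<bar>w\<bar>"
    using x y theta_2_minus[of t "x + y"] by (auto simp: w_def)
  have "theta t w \<le> Gk t w 0 + eps t" using theta_upper[OF t w(2)] by (simp add: eps_def)
  also have "Gk t w 0 \<le> Gk t (x - y) 0"
  proof -
    have "(x - y)\<^sup>2 \<le> w\<^sup>2" using w(3) by (simp add: abs_le_square_iff)
    then show ?thesis using t by (auto simp: Gk_def intro!: divide_right_mono)
  qed
  also have "Gk t (x - y) 0 \<le> theta t (x - y)" by (rule Gk_le_theta[OF t])
  finally show ?thesis by (simp add: dir_def w)
qed

text \<open>With lower bounds -e at time s and -h at time t, the product of the two kernels raised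
  by e and h is nonnegative. Integrating it, both kernels having total integral at most 1, yields
  the lower bound -(h + e + e h) at time s + t, which is the recursion of (1 + e)^k - 1.\<close>

lemma dir_almost_nonneg_iterate:
  assumes s: "s > 0" and x: "x \<in> {0..1}" and z: "z \<in> {0..1}"
  shows "- ((1 + eps s) ^ Suc k - 1) \<le> dir (real (Suc k) * s) x z"
  using x
proof (induction k arbitrary: x)
  case 0
  then show ?case using dir_almost_nonneg[OF s _ z] by simp
next
  case (Suc k)
  define e where "e = eps s"
  define h where "h = (1 + e) ^ Suc k - 1"
  define t where "t = real (Suc k) * s"
  have t: "t > 0" using s by (simp add: t_def)
  have e: "e \<ge> 0" using eps_nonneg[OF s] by (simp add: e_def)
  have h: "h \<ge> 0" unfolding h_def using e one_le_power[of "1 + e" "Suc k"] by linarith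
  have int1: "(\<lambda>y. dir s x y) integrable_on {0..1}" and int2: "(\<lambda>y. dir t z y) integrable_on {0..1}"
    using s t by (auto intro!: integrable_continuous_real continuous_intros)
  then obtain a b where a: "((\<lambda>y. dir s x y) has_integral a) {0..1}" and b: "((\<lambda>y. dir t z y) has_integral b) {0..1}"
    by blast
  have ab: "a \<le> 1" "b \<le> 1" using has_integral_dir_le_1 a b s t by blast+
  have c: "((\<lambda>y::real. e * h) has_integral e * h) {0..1}"
    using has_integral_const_real[of "e*h" 0 1] by (metis content_real diff_zero real_scaleR_def mult_1 zero_le_one)
  have I: "((\<lambda>y. - h * dir s x y - e * dir t z y - e * h) has_integral - h * a - e * b - e * h) {0..1}"
    by (intro has_integral_diff has_integral_mult_right a b c)
  have "- h * a - e * b - e * h \<le> dir (s + t) x z"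
  proof (rule has_integral_le[OF I has_integral_dir_dir(1)[OF s t]])
    fix y :: real assume y: "y \<in> {0..1}"
    have "0 \<le> dir s x y + e" using dir_almost_nonneg[OF s Suc.prems y] by (simp add: e_def)
    moreover have "0 \<le> dir t y z + h" using Suc.IH[OF y] by (simp add: h_def t_def e_def)
    ultimately have "0 \<le> (dir s x y + e) * (dir t y z + h)" by (rule mult_nonneg_nonneg)
    then show "- h * dir s x y - e * dir t z y - e * h \<le> dir s x y * dir t y z"
      by (simp add: algebra_simps dir_commute[of t z y])
  qed
  moreover have "h * a \<le> h * 1" "e * b \<le> e * 1" using ab e h by (intro mult_left_mono; simp)+
  ultimately have "- (h + e + e * h) \<le> dir (s + t) x z" by linarith
  moreover have "(1 + e) ^ Suc (Suc k) - 1 = h + e + e * h" by (simp add: h_def algebra_simps)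
  moreover have "real (Suc (Suc k)) * s = s + t" by (simp add: t_def algebra_simps)
  ultimately show ?case unfolding e_def[symmetric] by metis
qed

text \<open>Positivity of the Dirichlet kernel: at time t/n it is nonnegative up to O(n^(-3/2)), and
  these errors add up to O(n^(-1/2)) over n steps.\<close>
lemma dir_nonneg:
  assumes t: "t > 0" and x: "x \<in> {0..1}" and y: "y \<in> {0..1}"
  shows "0 \<le> dir t x y"
proof -
  let ?h = "\<lambda>k. tail_const * t\<^sup>2 / sqrt t * (1 / sqrt (real (Suc k)))"
  have b: "- (exp (?h k) - 1) \<le> dir t x y" for k
  proof -
    define N where "N = real (Suc k)"
    have N: "N > 0" by (simp add: N_def)
    have tn: "t / N > 0" using t N by simp
    have "- ((1 + eps (t / N)) ^ Suc k - 1) \<le> dir (N * (t / N)) x y"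
      unfolding N_def by (rule dir_almost_nonneg_iterate) (use tn x y in \<open>auto simp: N_def\<close>)
    also have "N * (t / N) = t" using N by simp
    finally have "- ((1 + eps (t / N)) ^ Suc k - 1) \<le> dir t x y" .
    moreover have "(1 + eps (t / N)) ^ Suc k \<le> exp (?h k)"
    proof -
      have "(1 + eps (t / N)) ^ Suc k \<le> exp (eps (t / N)) ^ Suc k"
        using eps_nonneg[OF tn] exp_ge_add_one_self[of "eps (t/N)"] by (intro power_mono) auto
      also have "\<dots> = exp (N * eps (t / N))" unfolding N_def by (rule exp_of_nat_mult[symmetric])
      also have "N * eps (t / N) = ?h k"
      proof -
        have "N * (sqrt N / N\<^sup>2) = 1 / sqrt N"
          using N by (simp add: power2_eq_square field_simps)
        moreover have "N * eps (t / N) = tail_const * t\<^sup>2 / sqrt t * (N * (sqrt N / N\<^sup>2))"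
          by (simp add: eps_def real_sqrt_divide power_divide ac_simps)
        ultimately show ?thesis by (simp add: N_def)
      qed
      finally show ?thesis .
    qed
    ultimately show ?thesis by linarith
  qed
  have "(\<lambda>k. 1 / sqrt (real (Suc k))) \<longlonglongrightarrow> 0"
    by real_asymp
  then have "(\<lambda>k. - (exp (?h k) - 1)) \<longlonglongrightarrow> - (exp (tail_const * t\<^sup>2 / sqrt t * 0) - 1)"
    by (intro tendsto_intros)
  then show ?thesis using b by (intro LIMSEQ_le_const2[of _ 0]) auto
qed

section \<open>The heat flow of distribution functions\<close>

definition UI :: "real measure" where "UI = restrict_space lborel {0..1}"

lemma space_UI [simp]: "space UI = {0..1}"
  by (simp add: UI_def space_restrict_space)

lemma measurable_UI_borel: "f \<in> borel_measurable borel \<Longrightarrow> f \<in> borel_measurable UI"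
  by (simp add: UI_def measurable_restrict_space1)

lemma id_measurable_UI [measurable (raw)]: "(\<lambda>x. x) \<in> borel_measurable UI"
  by (rule measurable_UI_borel) simp

lemma emeasure_UI: "emeasure UI {0..1} = 1"
  by (simp add: UI_def emeasure_restrict_space)

interpretation UI: finite_measure UI
  by (rule finite_measureI) (simp add: emeasure_UI)

interpretation UI2: pair_sigma_finite UI UI ..

lemma fst_snd_measurable_UI [measurable (raw)]:
  "fst \<in> borel_measurable (UI \<Otimes>\<^sub>M UI)" "snd \<in> borel_measurable (UI \<Otimes>\<^sub>M UI)"
  using measurable_compose[OF measurable_fst id_measurable_UI] measurable_compose[OF measurable_snd id_measurable_UI] by auto

lemma measure_UI [simp]: "measure UI {0..1} = 1"
  by (simp add: measure_def emeasure_UI)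

lemma set_integral_UI: "(LINT x:{0..1}|lborel. f x) = (LINT x|UI. f x)"
  for f :: "real \<Rightarrow> real"
  by (simp add: UI_def integral_restrict_space set_lebesgue_integral_def)

lemma set_integrable_UI: "set_integrable lborel {0..1} f \<longleftrightarrow> integrable UI f"
  for f :: "real \<Rightarrow> real"
  by (simp add: UI_def integrable_restrict_space set_integrable_def)

lemma AE_UI: "(AE x in UI. P x) \<longleftrightarrow> (AE x in lborel. x \<in> {0..1} \<longrightarrow> P x)"
  unfolding UI_def by (subst AE_restrict_space_iff) auto

lemma AE_UI_neq: "AE x in UI. x \<noteq> c"
  unfolding AE_UI using AE_lborel_singleton[of c] by eventually_elim auto

lemma AE_UI_mem: "AE x in UI. x \<in> {0..1}"
  by (rule AE_I2) simp

lemma set_integral_UI_Icc: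
  fixes f :: "real \<Rightarrow> real"
  assumes "r \<in> {0..1}"
  shows "(LINT x:{r..1}|lborel. f x) = (LINT x|UI. indicator {r..1} x * f x)"
  unfolding UI_def using assms
  by (subst integral_restrict_space)
     (auto simp: set_lebesgue_integral_def indicator_def intro!: Bochner_Integration.integral_cong)

lemma integrable_UI_bounded:
  fixes f :: "real \<Rightarrow> real"
  assumes "f \<in> borel_measurable UI" "\<And>x. x \<in> {0..1} \<Longrightarrow> \<bar>f x\<bar> \<le> B"
  shows "integrable UI f"
  by (rule UI.integrable_const_bound[of _ B]) (use assms in auto)

lemma continuous_measurable_UI:
  fixes f :: "real \<Rightarrow> real"
  assumes "continuous_on {0..1} f"
  shows "f \<in> borel_measurable UI"
proof -
  have "f \<in> borel_measurable (restrict_space borel {0..1})"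
    by (rule borel_measurable_continuous_on_restrict[OF assms])
  moreover have "sets UI = sets (restrict_space borel {0..1::real})"
    unfolding UI_def by (rule sets_restrict_space_cong) simp
  ultimately show ?thesis by (simp cong: measurable_cong_sets)
qed

lemma has_integral_UI:
  fixes f :: "real \<Rightarrow> real"
  assumes "continuous_on {0..1} f" "(f has_integral c) {0..1}"
  shows "integrable UI f" "(LINT x|UI. f x) = c"
proof -
  have "set_integrable lborel {0..1} f" by (rule borel_integrable_atLeastAtMost'[OF assms(1)])
  then show "integrable UI f" by (simp add: set_integrable_UI)
  show "(LINT x|UI. f x) = c"
    using set_borel_integral_eq_integral(2)[OF \<open>set_integrable lborel {0..1} f\<close>] assms(2)
    by (simp add: set_integral_UI integral_unique)
qed

lemma has_integral_UI_Icc: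
  fixes f :: "real \<Rightarrow> real"
  assumes "continuous_on {0..1} f" "(f has_integral c) {a..b}" "0 \<le> a" "b \<le> 1"
  shows "(LINT x|UI. indicator {a..b} x * f x) = c"
proof -
  have "continuous_on {a..b} f" using assms by (auto intro: continuous_on_subset)
  then have "set_integrable lborel {a..b} f" by (rule borel_integrable_atLeastAtMost')
  from set_borel_integral_eq_integral(2)[OF this] assms(2)
  have "(LINT x:{a..b}|lborel. f x) = c" by (simp add: integral_unique)
  moreover have "(LINT x|UI. indicator {a..b} x * f x) = (LINT x:{a..b}|lborel. f x)"
    unfolding UI_def using assms(3,4)
    by (subst integral_restrict_space)
       (auto simp: set_lebesgue_integral_def indicator_def intro!: Bochner_Integration.integral_cong)
  ultimately show ?thesis by simp
qed

lemma theta_measurable_compose [measurable]: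
  assumes "t > 0" "f \<in> borel_measurable M" 
  shows "(\<lambda>x. theta t (f x)) \<in> borel_measurable M"
  using assms(2) theta_borel[OF assms(1)] by (rule measurable_compose)

lemma neu_measurable [measurable]: 
  "t > 0 \<Longrightarrow> f \<in> borel_measurable M \<Longrightarrow> g \<in> borel_measurable M \<Longrightarrow> (\<lambda>x. neu t (f x) (g x)) \<in> borel_measurable M"
  unfolding neu_def by (intro borel_measurable_add borel_measurable_diff theta_measurable_compose)

lemma dir_measurable [measurable]: 
  "t > 0 \<Longrightarrow> f \<in> borel_measurable M \<Longrightarrow> g \<in> borel_measurable M \<Longrightarrow> (\<lambda>x. dir t (f x) (g x)) \<in> borel_measurable M"
  unfolding dir_def by (intro borel_measurable_add borel_measurable_diff theta_measurable_compose)

lemma UI_Fubini: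
  fixes k :: "real \<Rightarrow> real \<Rightarrow> real"
  assumes k: "(\<lambda>p. k (fst p) (snd p)) \<in> borel_measurable (UI \<Otimes>\<^sub>M UI)"
    and bound: "\<And>x y. x \<in> {0..1} \<Longrightarrow> y \<in> {0..1} \<Longrightarrow> \<bar>k x y\<bar> \<le> C"
    and rho: "integrable UI \<rho>"
  shows "integrable UI (\<lambda>x. LINT y|UI. k x y * \<rho> y)"
    "integrable UI (\<lambda>y. (LINT x|UI. k x y) * \<rho> y)"
    "(LINT x|UI. (LINT y|UI. k x y * \<rho> y)) = (LINT y|UI. (LINT x|UI. k x y) * \<rho> y)"
proof -
  have [measurable]: "\<rho> \<in> borel_measurable UI" using rho by simp
  note k [measurable]
  have C: "0 \<le> C" using bound[of 0 0] by simp
  have dom: "integrable (UI \<Otimes>\<^sub>M UI) (\<lambda>p. C * \<rho> (snd p))"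
  proof (rule UI2.Fubini_integrable)
    show "integrable UI (\<lambda>x. LINT y|UI. norm (C * \<rho> (snd (x, y))))" by simp
    show "AE x in UI. integrable UI (\<lambda>y. C * \<rho> (snd (x, y)))" using rho by simp
  qed measurable
  have I: "integrable (UI \<Otimes>\<^sub>M UI) (\<lambda>p. k (fst p) (snd p) * \<rho> (snd p))"
  proof (rule Bochner_Integration.integrable_bound[OF dom])
    show "AE p in UI \<Otimes>\<^sub>M UI. norm (k (fst p) (snd p) * \<rho> (snd p)) \<le> norm (C * \<rho> (snd p))"
      using bound C by (intro AE_I2) (auto simp: space_pair_measure abs_mult intro!: mult_right_mono)
  qed measurable
  from UI2.integrable_fst'[OF I] show "integrable UI (\<lambda>x. LINT y|UI. k x y * \<rho> y)" by simp
  have I': "integrable (UI \<Otimes>\<^sub>M UI) (\<lambda>(x, y). k x y * \<rho> y)" using I by (simp add: case_prod_unfold)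
  from UI2.integrable_snd[OF I'] show "integrable UI (\<lambda>y. (LINT x|UI. k x y) * \<rho> y)" by simp
  from UI2.Fubini_integral[OF I'] show "(LINT x|UI. (LINT y|UI. k x y * \<rho> y)) = (LINT y|UI. (LINT x|UI. k x y) * \<rho> y)"
    by simp
qed

section \<open>Partial integration of the Neumann flow\<close>

lemma Theta_lipschitz: "t > 0 \<Longrightarrow> \<bar>Theta t a - Theta t b\<bar> \<le> theta_sup t * \<bar>a - b\<bar>"
proof -
  assume t: "t > 0"
  have *: "\<bar>Theta t b - Theta t a\<bar> \<le> theta_sup t * (b - a)" if "a \<le> b" for a b
  proof -
    have "Theta t b - Theta t a \<le> theta_sup t * (b - a)"
      using has_integral_le[OF integral_theta_Theta[OF t that] has_integral_const_real[of "theta_sup t"]] theta_le_sup[OF t] that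
      by (simp add: mult.commute)
    then show ?thesis using Theta_mono[OF t that] by simp
  qed
  from *[of a b] *[of b a] show ?thesis by (cases "a \<le> b") (auto simp: abs_minus_commute)
qed

lemma Theta_continuous_x: "t > 0 \<Longrightarrow> continuous_on S (Theta t)"
  unfolding continuous_on_iff dist_real_def
proof (intro ballI allI impI)
  fix x e :: real assume t: "t > 0" and e: "e > 0"
  have p: "theta_sup t + 1 > 0" using theta_sup_nonneg[OF t] by simp
  show "\<exists>d>0. \<forall>x'\<in>S. \<bar>x' - x\<bar> < d \<longrightarrow> \<bar>Theta t x' - Theta t x\<bar> < e"
  proof (intro exI[of _ "e / (theta_sup t + 1)"] conjI ballI impI)
    show "e / (theta_sup t + 1) > 0" using p e by simp
    fix x' assume "\<bar>x' - x\<bar> < e / (theta_sup t + 1)"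
    then have "(theta_sup t + 1) * \<bar>x' - x\<bar> < e" using p by (simp add: field_simps)
    then show "\<bar>Theta t x' - Theta t x\<bar> < e" using Theta_lipschitz[OF t, of x' x]
      by (smt (verit, best) abs_ge_zero mult_right_mono)
  qed
qed

lemma Theta_measurable [measurable]:
  assumes "t > 0" "f \<in> borel_measurable M" 
  shows "(\<lambda>x. Theta t (f x)) \<in> borel_measurable M"
  using assms(2) borel_measurable_continuous_onI[OF Theta_continuous_x[OF assms(1)]] by (rule measurable_compose)

lemma Theta_bound: "t > 0 \<Longrightarrow> \<bar>x\<bar> \<le> 2 \<Longrightarrow> \<bar>Theta t x\<bar> \<le> 2 * theta_sup t"
  using Theta_lipschitz[of t x 0] mult_left_mono[of "\<bar>x\<bar>" 2 "theta_sup t"] theta_sup_nonneg[of t] by (simp add: Theta_0)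

lemma has_integral_neu_tail:
  assumes t: "t > 0" and r: "r \<in> {0..1}"
  shows "((\<lambda>x. neu t x y) has_integral 1 - Theta t (r - y) - Theta t (r + y)) {r..1}"
proof -
  have "((\<lambda>x. theta t (x + - y)) has_integral Theta t (1 - y) - Theta t (r - y)) {r..1}"
    using has_integral_shift_real[OF integral_theta_Theta[OF t, of "r - y" "1 - y"], of "-y"] r by simp
  moreover have "((\<lambda>x. theta t (x + y)) has_integral Theta t (1 + y) - Theta t (r + y)) {r..1}"
    using has_integral_shift_real[OF integral_theta_Theta[OF t, of "r + y" "1 + y"], of y] r by simp
  ultimately have "((\<lambda>x. theta t (x + - y) + theta t (x + y)) has_integral
     (Theta t (1 - y) - Theta t (r - y)) + (Theta t (1 + y) - Theta t (r + y))) {r..1}"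
    by (rule has_integral_add)
  then show ?thesis using Theta_reflect_1[OF t, of y] by (simp add: neu_def algebra_simps)
qed

text \<open>As a function of z this differs from the tail in \<open>has_integral_neu_tail\<close>,
  taken at y = z, only by 2 Theta t r - 1: the z-derivative of the Neumann tail over [r, 1] is the
  Dirichlet kernel. Partial integration rests on this.\<close>

lemma has_integral_dir_initial:
  assumes t: "t > 0" and z: "z \<ge> 0"
  shows "((\<lambda>y. dir t r y) has_integral 2 * Theta t r - Theta t (r - z) - Theta t (r + z)) {0..z}"
proof -
  have "((\<lambda>y. theta t (y + - r)) has_integral Theta t (z - r) - Theta t (- r)) {0..z}"
    using has_integral_shift_real[OF integral_theta_Theta[OF t, of "-r" "z - r"], of "-r"] z by simp
  moreover have "((\<lambda>y. theta t (y + r)) has_integral Theta t (z + r) - Theta t r) {0..z}"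
    using has_integral_shift_real[OF integral_theta_Theta[OF t, of r "z + r"], of r] z by simp
  ultimately have "((\<lambda>y. theta t (y + - r) - theta t (y + r)) has_integral
     (Theta t (z - r) - Theta t (- r)) - (Theta t (z + r) - Theta t r)) {0..z}"
    by (rule has_integral_diff)
  then show ?thesis
    using Theta_minus[of t "r - z"] by (simp add: dir_def theta_diff_swap[of t r] Theta_minus add.commute algebra_simps)
qed

text \<open>Wider than the class U: densities are integrable, with a sign almost everywhere. The
  class is stable under \<open>heat\<close>, and under \<open>Kd\<close> on measures without atom
  whose mass exceeds the positive amount to be cut.\<close>

definition adm :: "umeas \<Rightarrow> bool" where
  "adm mu \<longleftrightarrow> 0 \<le> fst mu \<and> integrable UI (snd mu) \<and> (AE y in UI. 0 \<le> snd mu y)"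

definition mass :: "umeas \<Rightarrow> real" where "mass mu = fst mu + (LINT y|UI. snd mu y)"

lemma Fm_UI: "r \<in> {0..1} \<Longrightarrow> Fm r mu = (if r = 0 then fst mu else 0) + (LINT y|UI. indicator {r..1} y * snd mu y)"
  unfolding Fm_def by (auto simp: set_integral_UI_Icc)

lemma Fm_0: "Fm 0 mu = mass mu"
proof -
  have "(LINT y|UI. indicator {0..1} y * snd mu y) = (LINT y|UI. snd mu y)"
    by (intro Bochner_Integration.integral_cong) auto
  then show ?thesis by (simp add: Fm_UI mass_def)
qed

lemma Fm_1: "Fm 1 mu = 0"
proof -
  have "AE y in UI. indicator {1..1} y * snd mu y = 0"
    using AE_UI_neq[of 1] by eventually_elim (simp add: indicator_def)
  then have "(LINT y|UI. indicator {1..1} y * snd mu y) = 0"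
    by (rule integral_eq_zero_AE)
  then show ?thesis by (simp add: Fm_UI)
qed

lemma heat_UI: "t > 0 \<Longrightarrow> heat t mu = (0, \<lambda>r. fst mu * neu t r 0 + (LINT y|UI. neu t r y * snd mu y))"
  by (simp add: heat_def set_integral_UI Gneum_eq_theta neu_def)

lemma neu_integrable: 
  assumes t: "t > 0" and rho: "integrable UI \<rho>"
  shows "integrable UI (\<lambda>y. neu t r y * \<rho> y)"
proof (rule Bochner_Integration.integrable_bound)
  show "integrable UI (\<lambda>y. 2 * theta_sup t * \<rho> y)" using rho by simp
  have [measurable]: "\<rho> \<in> borel_measurable UI" using rho by simp
  show "(\<lambda>y. neu t r y * \<rho> y) \<in> borel_measurable UI" using t by measurable
  show "AE y in UI. norm (neu t r y * \<rho> y) \<le> norm (2 * theta_sup t * \<rho> y)"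
    using neu_le[OF t] neu_nonneg[OF t] theta_sup_nonneg[OF t]
    by (auto simp: abs_mult intro!: AE_I2 mult_right_mono)
qed

lemma heat_integrable:
  assumes t: "t > 0" and rho: "integrable UI (snd mu)"
  shows "integrable UI (snd (heat t mu))"
proof -
  have "integrable UI (\<lambda>r. neu t r 0)"
    using t neu_le[OF t] neu_nonneg[OF t] by (intro integrable_UI_bounded[of _ "2 * theta_sup t"]) auto
  moreover have "integrable UI (\<lambda>r. LINT y|UI. neu t r y * snd mu y)"
    by (rule UI_Fubini(1)[OF _ _ rho, of _ "2 * theta_sup t"]) (use t neu_le[OF t] neu_nonneg[OF t] in auto)
  ultimately show ?thesis using t by (simp add: heat_UI)
qed

lemma heat_nonneg: "t > 0 \<Longrightarrow> adm mu \<Longrightarrow> 0 \<le> snd (heat t mu) r"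
  by (auto simp: heat_UI adm_def neu_nonneg intro!: add_nonneg_nonneg integral_nonneg_AE)

lemma heat_adm: "t > 0 \<Longrightarrow> adm mu \<Longrightarrow> adm (heat t mu)"
  using heat_nonneg[of t mu] heat_integrable[of t mu] by (auto simp: adm_def heat_def)

lemma heat_semigroup:
  assumes s: "s > 0" and t: "t > 0" and rho: "integrable UI (snd mu)"
  shows "heat s (heat t mu) = heat (s + t) mu"
proof -
  have N: "(LINT x|UI. neu s r x * neu t x y) = neu (s + t) r y" "integrable UI (\<lambda>x. neu s r x * neu t x y)" for r y
    by (rule has_integral_UI[OF _ has_integral_neu_neu[OF s t]], use s t in \<open>auto intro!: continuous_intros\<close>)+
  have b: "\<bar>neu s r x * neu t x y\<bar> \<le> (2 * theta_sup s) * (2 * theta_sup t)" for r x y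
    unfolding abs_mult using neu_le s t neu_nonneg theta_sup_nonneg by (intro mult_mono) auto
  have [measurable]: "snd mu \<in> borel_measurable UI" using rho by simp
  have "(LINT x|UI. neu s r x * (fst mu * neu t x 0 + (LINT y|UI. neu t x y * snd mu y)))
     = fst mu * neu (s + t) r 0 + (LINT y|UI. neu (s + t) r y * snd mu y)" for r
  proof -
    have 1: "(LINT x|UI. neu s r x * (LINT y|UI. neu t x y * snd mu y)) = (LINT x|UI. LINT y|UI. (neu s r x * neu t x y) * snd mu y)"
      by (simp add: mult.assoc)
    also have "\<dots> = (LINT y|UI. neu (s + t) r y * snd mu y)"
      by (subst UI_Fubini(3)[OF _ b rho]) (use s t in \<open>auto simp: N\<close>)
    finally have 1: "(LINT x|UI. neu s r x * (LINT y|UI. neu t x y * snd mu y)) = (LINT y|UI. neu (s + t) r y * snd mu y)" .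
    have i1: "integrable UI (\<lambda>x. fst mu * (neu s r x * neu t x 0))" by (intro integrable_mult_right N)
    have "integrable UI (\<lambda>x. LINT y|UI. (neu s r x * neu t x y) * snd mu y)"
      by (rule UI_Fubini(1)[OF _ b rho]) (use s t in auto)
    then have i2: "integrable UI (\<lambda>x. neu s r x * (LINT y|UI. neu t x y * snd mu y))" by (simp add: mult.assoc)
    have "(LINT x|UI. neu s r x * (fst mu * neu t x 0 + (LINT y|UI. neu t x y * snd mu y)))
      = (LINT x|UI. fst mu * (neu s r x * neu t x 0) + neu s r x * (LINT y|UI. neu t x y * snd mu y))"
      by (simp add: algebra_simps)
    also have "\<dots> = fst mu * neu (s + t) r 0 + (LINT y|UI. neu (s + t) r y * snd mu y)"
      using i1 i2 by (simp add: N 1)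
    finally show ?thesis .
  qed
  then show ?thesis using s t by (simp add: heat_UI)
qed

text \<open>Fubini moves the tail integral onto the kernel. This form, prior to partial integration,
  also serves for t tending to 0, where the kernel tends to the indicator of [r, 1].\<close>

lemma Fm_heat_tail:
  assumes t: "t > 0" and rho: "integrable UI (snd mu)" and r: "r \<in> {0..1}"
  shows "Fm r (heat t mu) = fst mu * (1 - 2 * Theta t r) + (LINT y|UI. (1 - Theta t (r - y) - Theta t (r + y)) * snd mu y)"
proof -
  have b: "\<bar>indicator {r..1} x * neu t x y\<bar> \<le> 2 * theta_sup t" for x y :: real
    using neu_le[OF t] neu_nonneg[OF t] theta_sup_nonneg[OF t] by (auto simp: indicator_def)
  have H: "(LINT x|UI. indicator {r..1} x * neu t x y) = 1 - Theta t (r - y) - Theta t (r + y)" for y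
    using r t by (intro has_integral_UI_Icc has_integral_neu_tail continuous_intros) auto
  have i1: "integrable UI (\<lambda>x. indicator {r..1} x * neu t x 0)"
    using b t by (intro integrable_UI_bounded[of _ "2 * theta_sup t"]) auto
  have i2: "integrable UI (\<lambda>x. LINT y|UI. (indicator {r..1} x * neu t x y) * snd mu y)"
    by (rule UI_Fubini(1)[OF _ b rho]) (use t in measurable)
  have "Fm r (heat t mu) = (LINT x|UI. indicator {r..1} x * (fst mu * neu t x 0 + (LINT y|UI. neu t x y * snd mu y)))"
    using r t by (simp add: Fm_UI heat_UI)
  also have "\<dots> = (LINT x|UI. fst mu * (indicator {r..1} x * neu t x 0) + (LINT y|UI. (indicator {r..1} x * neu t x y) * snd mu y))"
    by (intro Bochner_Integration.integral_cong) (auto simp: indicator_def)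
  also have "\<dots> = fst mu * (1 - 2 * Theta t r) + (LINT x|UI. LINT y|UI. (indicator {r..1} x * neu t x y) * snd mu y)"
    using i1 i2 by (simp add: H)
  also have "(LINT x|UI. LINT y|UI. (indicator {r..1} x * neu t x y) * snd mu y)
    = (LINT y|UI. (1 - Theta t (r - y) - Theta t (r + y)) * snd mu y)"
    by (subst UI_Fubini(3)[OF _ b rho]) (use t in \<open>auto simp: H\<close>)
  finally show ?thesis .
qed

text \<open>M is the mass, that is, the boundary value at 0 of the distribution function f; the factor of M is
  the distribution function of the heat flow started from the Dirac mass at 0.\<close>
definition Top :: "real \<Rightarrow> real \<Rightarrow> (real \<Rightarrow> real) \<Rightarrow> real \<Rightarrow> real" where
  "Top t M f r = M * (1 - 2 * Theta t r) + (LINT y|UI. dir t r y * f y)"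

lemma dir_bound: "t > 0 \<Longrightarrow> \<bar>dir t r y\<bar> \<le> 2 * theta_sup t"
  using dir_le_neu[of t r y] neu_le[of t r y] by simp

text \<open>Fubini on the triangle y \<le> z. The atom enters \<open>Fm\<close> only at y = 0, a
  null set, and drops out. Applied with \<open>g\<close> the Dirichlet kernel and, for weak
  convergence, with \<open>g\<close> the derivative of a polynomial.\<close>

lemma Fm_by_parts:
  fixes g G :: "real \<Rightarrow> real"
  assumes g: "continuous_on UNIV g" and G: "\<And>z. z \<in> {0..1} \<Longrightarrow> (g has_integral G z) {0..z}"
    and rho: "integrable UI (snd mu)"
  shows "(LINT y|UI. g y * Fm y mu) = (LINT z|UI. G z * snd mu z)"
    "integrable UI (\<lambda>z. G z * snd mu z)"
proof -
  have [measurable]: "snd mu \<in> borel_measurable UI" using rho by simp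
  have gb[measurable]: "g \<in> borel_measurable borel" using g by (rule borel_measurable_continuous_onI)
  have [measurable]: "g \<in> borel_measurable UI" by (rule measurable_UI_borel[OF gb])
  have gc: "continuous_on {0..1} g" using g by (rule continuous_on_subset) simp
  have "compact (g ` {0..1})" by (intro compact_continuous_image gc) simp
  then obtain C where "\<forall>x\<in>g ` {0..1}. norm x \<le> C" using compact_imp_bounded bounded_iff by metis
  then have C: "\<And>y. y \<in> {0..1} \<Longrightarrow> \<bar>g y\<bar> \<le> C" by auto
  let ?k = "\<lambda>y z. g y * indicator {y..1} z"
  have b: "\<bar>?k y z\<bar> \<le> C" if "y \<in> {0..1}" for y z :: real
    using C[OF that] abs_ge_zero[of "g y"] by (auto simp: indicator_def)
  have J: "(LINT y|UI. ?k y z) = G z" if "z \<in> {0..1}" for z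
  proof -
    have "(LINT y|UI. ?k y z) = (LINT y|UI. indicator {0..z} y * g y)"
      using that by (intro Bochner_Integration.integral_cong) (auto simp: indicator_def)
    also have "\<dots> = G z" using that by (intro has_integral_UI_Icc[OF gc G]) auto
    finally show ?thesis .
  qed
  have m: "(\<lambda>p. ?k (fst p) (snd p)) \<in> borel_measurable (UI \<Otimes>\<^sub>M UI)"
  proof -
    have "(\<lambda>p. ?k (fst p) (snd p)) = (\<lambda>p. g (fst p) * (if fst p \<le> snd p \<and> snd p \<le> 1 then 1 else 0))"
      by (auto simp: fun_eq_iff)
    also have "\<dots> \<in> borel_measurable (UI \<Otimes>\<^sub>M UI)" by measurable
    finally show ?thesis .
  qed
  have "(LINT y|UI. g y * Fm y mu) = (LINT y|UI. LINT z|UI. ?k y z * snd mu z)"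
  proof (rule integral_cong_AE)
    show "AE y in UI. g y * Fm y mu = (LINT z|UI. ?k y z * snd mu z)"
      using AE_UI_neq[of 0] AE_UI_mem by eventually_elim (simp add: Fm_UI mult.assoc)
    show 2: "(\<lambda>y. LINT z|UI. ?k y z * snd mu z) \<in> borel_measurable UI"
      using UI_Fubini(1)[OF m b rho] by simp
    show "(\<lambda>y. g y * Fm y mu) \<in> borel_measurable UI"
    proof -
      have "(\<lambda>y. (LINT z|UI. ?k y z * snd mu z) + g y * (if y = 0 then fst mu else 0)) \<in> borel_measurable UI"
        using 2 by measurable
      then show ?thesis
        by (rule measurable_cong[THEN iffD1, rotated]) (auto simp: Fm_UI mult.assoc distrib_left)
    qed
  qed
  also have "\<dots> = (LINT z|UI. (LINT y|UI. ?k y z) * snd mu z)"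
    by (rule UI_Fubini(3)[OF m b rho])
  also have "\<dots> = (LINT z|UI. G z * snd mu z)"
    by (intro Bochner_Integration.integral_cong) (auto simp: J)
  finally show "(LINT y|UI. g y * Fm y mu) = (LINT z|UI. G z * snd mu z)" .
  have "integrable UI (\<lambda>z. (LINT y|UI. ?k y z) * snd mu z)" by (rule UI_Fubini(2)[OF m b rho])
  then show "integrable UI (\<lambda>z. G z * snd mu z)"
    by (rule Bochner_Integration.integrable_cong[THEN iffD1, rotated 2]) (auto simp: J)
qed

text \<open>The tail kernel of \<open>Fm_heat_tail\<close> is the primitive of the Dirichlet kernel
  plus 1 - 2 Theta t r. The latter does not depend on the integration variable, so it multiplies the
  mass of the density, which joins the atom to form the total mass.\<close>

lemma Fm_heat:
  assumes t: "t > 0" and rho: "integrable UI (snd mu)" and r: "r \<in> {0..1}"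
  shows "Fm r (heat t mu) = Top t (mass mu) (\<lambda>y. Fm y mu) r"
proof -
  let ?G = "\<lambda>z. 2 * Theta t r - Theta t (r - z) - Theta t (r + z)"
  have g: "continuous_on UNIV (dir t r)" using t by (auto intro!: continuous_intros)
  have h: "(dir t r has_integral ?G z) {0..z}" if "z \<in> {0..1}" for z
    using has_integral_dir_initial[OF t, of z r] that by simp
  note P = Fm_by_parts[OF g h rho]
  have "(LINT z|UI. (1 - Theta t (r - z) - Theta t (r + z)) * snd mu z)
     = (LINT z|UI. ?G z * snd mu z + (1 - 2 * Theta t r) * snd mu z)"
    by (intro Bochner_Integration.integral_cong) (auto simp: algebra_simps)
  also have "\<dots> = (LINT y|UI. dir t r y * Fm y mu) + (1 - 2 * Theta t r) * (LINT z|UI. snd mu z)"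
    using P rho by simp
  finally show ?thesis using Fm_heat_tail[OF assms] by (simp add: Top_def mass_def algebra_simps)
qed

lemma mass_heat:
  assumes "t > 0" "integrable UI (snd mu)"
  shows "mass (heat t mu) = mass mu"
proof -
  have "(LINT y|UI. dir t 0 y * Fm y mu) = 0" by (simp add: dir_def theta_minus)
  then show ?thesis using Fm_heat[OF assms, of 0] by (simp add: Fm_0 Top_def Theta_0)
qed

text \<open>Of a distribution function only measurability and the bounds 0 and M are recorded:
  \<open>Kop\<close> and \<open>Top\<close> preserve them, and they make the integrals against the
  Dirichlet kernel exist.\<close>

definition cls :: "real \<Rightarrow> (real \<Rightarrow> real) \<Rightarrow> bool" where
  "cls M f \<longleftrightarrow> f \<in> borel_measurable UI \<and> (\<forall>y\<in>{0..1}. 0 \<le> f y \<and> f y \<le> M)"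

definition le01 :: "(real \<Rightarrow> real) \<Rightarrow> (real \<Rightarrow> real) \<Rightarrow> bool" where
  "le01 f g \<longleftrightarrow> (\<forall>y\<in>{0..1}. f y \<le> g y)"

lemma le01_trans: "le01 f g \<Longrightarrow> le01 g h \<Longrightarrow> le01 f h"
  unfolding le01_def by fastforce

lemma le01_refl: "le01 f f" by (simp add: le01_def)

lemma cls_integrable: "cls M f \<Longrightarrow> integrable UI f"
  by (rule integrable_UI_bounded[of _ M]) (auto simp: cls_def abs_le_iff intro: order_trans[of _ 0])

section \<open>The affine Dirichlet flow as a monotone semigroup\<close>

lemma dir_integrable:
  assumes t: "t > 0" and rho: "integrable UI \<rho>"
  shows "integrable UI (\<lambda>y. dir t r y * \<rho> y)"
proof (rule Bochner_Integration.integrable_bound)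
  show "integrable UI (\<lambda>y. 2 * theta_sup t * \<rho> y)" using rho by simp
  have [measurable]: "\<rho> \<in> borel_measurable UI" using rho by simp
  show "(\<lambda>y. dir t r y * \<rho> y) \<in> borel_measurable UI" using t by measurable
  show "AE y in UI. norm (dir t r y * \<rho> y) \<le> norm (2 * theta_sup t * \<rho> y)"
    using dir_bound[OF t] theta_sup_nonneg[OF t]
    by (auto simp: abs_mult intro!: AE_I2 mult_right_mono)
qed

lemma Theta_le_half: "t > 0 \<Longrightarrow> r \<le> 1 \<Longrightarrow> Theta t r \<le> 1 / 2"
  using Theta_mono[of t r 1] Theta_1[of t] by simp

text \<open>The point 0 is null. This allows the distribution function after a cut, which jumps at 0
  because of the new atom, to be replaced by \<open>Kop\<close>, which ignores the atom.\<close>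

lemma Top_cong: "(\<And>y. y \<in> {0<..1} \<Longrightarrow> f y = g y) \<Longrightarrow> f \<in> borel_measurable UI \<Longrightarrow> g \<in> borel_measurable UI \<Longrightarrow> t > 0 \<Longrightarrow> Top t M f r = Top t M g r"
proof -
  assume *: "\<And>y. y \<in> {0<..1} \<Longrightarrow> f y = g y" "f \<in> borel_measurable UI" "g \<in> borel_measurable UI" "t > 0"
  note [measurable] = *(2,3)
  have "(LINT y|UI. dir t r y * f y) = (LINT y|UI. dir t r y * g y)"
  proof (rule integral_cong_AE)
    show "AE y in UI. dir t r y * f y = dir t r y * g y"
      using AE_UI_neq[of 0] AE_UI_mem by eventually_elim (use * in auto)
  qed (use *(4) in measurable)
  then show ?thesis by (simp add: Top_def)
qed

text \<open>The Dirichlet kernel is nonnegative with total integral at most 1, so raising the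
  initial function by c raises the flow by at most c. The case c = 0 is monotonicity; c = a gives
  the sign of the commutator with the cut.\<close>

lemma Top_shift:
  assumes t: "t > 0" and r: "r \<in> {0..1}" and f: "cls M f" and g: "cls M g" and c: "c \<ge> 0"
    and le: "\<And>y. y \<in> {0..1} \<Longrightarrow> f y \<le> g y + c"
  shows "Top t M f r \<le> Top t M g r + c"
proof -
  have d1: "integrable UI (\<lambda>y. dir t r y)" using dir_integrable[OF t, of "\<lambda>_. 1" r] by simp
  note I = dir_integrable[OF t cls_integrable]
  have "(LINT y|UI. dir t r y * f y) \<le> (LINT y|UI. dir t r y * g y + c * dir t r y)"
  proof (rule integral_mono[OF I[OF f]])
    show "integrable UI (\<lambda>y. dir t r y * g y + c * dir t r y)" using I[OF g] d1 by auto
    fix y assume y: "y \<in> space UI"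
    then show "dir t r y * f y \<le> dir t r y * g y + c * dir t r y"
      using mult_left_mono[OF le[of y] dir_nonneg[OF t r, of y]] by (simp add: algebra_simps)
  qed
  also have "\<dots> = (LINT y|UI. dir t r y * g y) + c * (LINT y|UI. dir t r y)" using I[OF g] d1 by simp
  also have "c * (LINT y|UI. dir t r y) \<le> c * 1"
  proof (rule mult_left_mono[OF _ c])
    have "continuous_on {0..1} (dir t r)" using t by (auto intro!: continuous_intros)
    moreover have "((\<lambda>y. dir t r y) has_integral 2 * Theta t r - Theta t (r - 1) - Theta t (r + 1)) {0..1}"
      by (rule has_integral_dir_initial[OF t]) simp
    ultimately show "(LINT y|UI. dir t r y) \<le> 1"
      using has_integral_UI(2)[of "dir t r"] has_integral_dir_le_1[OF t, of r] by simp
  qed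
  finally show ?thesis by (simp add: Top_def)
qed

lemma Top_mono:
  assumes "t > 0" "cls M f" "cls M g" "le01 f g"
  shows "le01 (Top t M f) (Top t M g)"
  using Top_shift[OF assms(1) _ assms(2,3), of _ 0] assms(4) by (auto simp: le01_def)

text \<open>The upper bound is a comparison with the constant M, whose flow is M (2 - 2 Theta t (1 +
  r)); beyond 1 the value of \<open>Theta\<close> is at least 1/2.\<close>

lemma Top_cls:
  assumes t: "t > 0" and M: "M \<ge> 0" and f: "cls M f"
  shows "cls M (Top t M f)"
  unfolding cls_def
proof (intro conjI ballI)
  have [measurable]: "f \<in> borel_measurable UI" using f by (simp add: cls_def)
  have "(\<lambda>x. LINT y|UI. dir t x y * f y) \<in> borel_measurable UI"
    using t by (intro UI.borel_measurable_lebesgue_integral) (simp add: case_prod_unfold)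
  then show "Top t M f \<in> borel_measurable UI" unfolding Top_def using t by measurable
next
  fix r :: real assume r: "r \<in> {0..1}"
  have "0 \<le> (LINT y|UI. dir t r y * f y)"
    using f dir_nonneg[OF t r] by (intro Bochner_Integration.integral_nonneg) (auto simp: cls_def)
  moreover have "0 \<le> M * (1 - 2 * Theta t r)"
    using M Theta_le_half[OF t, of r] r by (intro mult_nonneg_nonneg) auto
  ultimately show "0 \<le> Top t M f r" by (simp add: Top_def)
  have "Top t M f r \<le> Top t M (\<lambda>_. M) r"
    using Top_mono[OF t f, of "\<lambda>_. M"] f M r by (auto simp: le01_def cls_def)
  also have "\<dots> = M * (1 - 2 * Theta t r) + M * (2 * Theta t r - Theta t (r - 1) - Theta t (r + 1))"
  proof -
    have "continuous_on {0..1} (dir t r)" using t by (auto intro!: continuous_intros)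
    moreover have "((\<lambda>y. dir t r y) has_integral 2 * Theta t r - Theta t (r - 1) - Theta t (r + 1)) {0..1}"
      by (rule has_integral_dir_initial[OF t]) simp
    ultimately have "(LINT y|UI. dir t r y) = 2 * Theta t r - Theta t (r - 1) - Theta t (r + 1)"
      by (rule has_integral_UI(2))
    then show ?thesis by (simp add: Top_def mult.commute)
  qed
  also have "\<dots> = M * (2 - 2 * Theta t (1 + r))"
  proof -
    have "Theta t (1 + r) = 1 - Theta t (1 - r)" using Theta_reflect_1[OF t, of r] by simp
    moreover have "Theta t (r - 1) = - Theta t (1 - r)" using Theta_minus[of t "1 - r"] by simp
    ultimately have "1 - 2 * Theta t r + (2 * Theta t r - Theta t (r - 1) - Theta t (r + 1)) = 2 - 2 * Theta t (1 + r)"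
      by (simp add: add.commute)
    then show ?thesis by (simp only: distrib_left[symmetric])
  qed
  also have "\<dots> \<le> M * 1"
    using Theta_mono[OF t, of 1 "1 + r"] Theta_1[OF t] r M by (intro mult_left_mono) auto
  finally show "Top t M f r \<le> M" by simp
qed

text \<open>Lebesgue measure is stationary for the Neumann flow and has distribution function 1 - r.
  Applying \<open>Fm_heat\<close> to it expresses the boundary term through the Dirichlet kernel, so
  that \<open>Top_semigroup\<close> reduces to Chapman-Kolmogorov for \<open>dir\<close>.\<close>

lemma Theta_dir_identity:
  assumes t: "t > 0" and r: "r \<in> {0..1}"
  shows "1 - 2 * Theta t r = (1 - r) - (LINT y|UI. dir t r y * (1 - y))"
proof -
  let ?mu = "(0, \<lambda>_. 1) :: umeas"
  have F: "Fm x ?mu = 1 - x" if "x \<in> {0..1}" for x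
    unfolding Fm_def using that by (simp add: set_lebesgue_integral_def)
  have h: "heat t ?mu = ?mu"
  proof -
    have "(LINT y|UI. neu t r y) = 1" for r
      using t by (intro has_integral_UI(2)[OF _ has_integral_neu]) (auto intro!: continuous_intros)
    then show ?thesis using t by (simp add: heat_UI)
  qed
  have "1 - r = Top t 1 (\<lambda>y. Fm y ?mu) r"
    using Fm_heat[OF t, of ?mu r] r F[of r] h by (simp add: mass_def)
  also have "\<dots> = 1 - 2 * Theta t r + (LINT y|UI. dir t r y * (1 - y))"
  proof -
    have "(LINT y|UI. dir t r y * Fm y ?mu) = (LINT y|UI. dir t r y * (1 - y))"
      by (intro Bochner_Integration.integral_cong) (auto simp: F)
    then show ?thesis by (simp add: Top_def)
  qed
  finally show ?thesis by simp
qed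

lemma dir_dir_UI:
  assumes s: "s > 0" and t: "t > 0" and f: "integrable UI f"
  shows "(LINT y|UI. dir s r y * (LINT z|UI. dir t y z * f z)) = (LINT z|UI. dir (s + t) r z * f z)"
    "integrable UI (\<lambda>y. dir s r y * (LINT z|UI. dir t y z * f z))"
proof -
  have N: "(LINT x|UI. dir s r x * dir t x y) = dir (s + t) r y" for y
    using s t by (intro has_integral_UI(2)[OF _ has_integral_dir_dir(1)]) (auto intro!: continuous_intros)
  have b: "\<bar>dir s r x * dir t x y\<bar> \<le> (2 * theta_sup s) * (2 * theta_sup t)" for x y
    unfolding abs_mult using dir_bound s t theta_sup_nonneg by (intro mult_mono) auto
  have m: "(\<lambda>p. dir s r (fst p) * dir t (fst p) (snd p)) \<in> borel_measurable (UI \<Otimes>\<^sub>M UI)"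
    using s t by simp
  have e: "(\<lambda>y. dir s r y * (LINT z|UI. dir t y z * f z)) = (\<lambda>y. LINT z|UI. (dir s r y * dir t y z) * f z)"
    by (simp add: mult.assoc)
  show "(LINT y|UI. dir s r y * (LINT z|UI. dir t y z * f z)) = (LINT z|UI. dir (s + t) r z * f z)"
    unfolding e using UI_Fubini(3)[OF m b f] by (simp add: N)
  show "integrable UI (\<lambda>y. dir s r y * (LINT z|UI. dir t y z * f z))"
    unfolding e using UI_Fubini(1)[OF m b f] .
qed

lemma Top_semigroup:
  assumes s: "s > 0" and t: "t > 0" and f: "integrable UI f" and r: "r \<in> {0..1}"
  shows "Top s M (Top t M f) r = Top (s + t) M f r"
proof -
  have l: "integrable UI (\<lambda>y. 1 - y)" by (rule integrable_UI_bounded[of _ 1]) auto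
  have i2: "integrable UI (\<lambda>y. dir s r y * (1 - y))" by (rule dir_integrable[OF s l])
  have e: "(LINT y|UI. dir s r y * (1 - 2 * Theta t y)) = (LINT y|UI. dir s r y * (1 - y)) - (LINT z|UI. dir (s + t) r z * (1 - z))"
  proof -
    have "(LINT y|UI. dir s r y * (1 - 2 * Theta t y)) = (LINT y|UI. dir s r y * (1 - y) - dir s r y * (LINT z|UI. dir t y z * (1 - z)))"
    proof (intro Bochner_Integration.integral_cong refl)
      fix x assume "x \<in> space UI"
      then show "dir s r x * (1 - 2 * Theta t x) = dir s r x * (1 - x) - dir s r x * (LINT z|UI. dir t x z * (1 - z))"
        by (simp only: Theta_dir_identity[OF t] space_UI right_diff_distrib)
    qed
    then show ?thesis using dir_dir_UI[OF s t l, of r] i2 by simp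
  qed
  have i1: "integrable UI (\<lambda>y. dir s r y * (1 - 2 * Theta t y))"
  proof (rule dir_integrable[OF s integrable_UI_bounded])
    show "(\<lambda>y. 1 - 2 * Theta t y) \<in> borel_measurable UI" using t by measurable
    fix y :: real assume "y \<in> {0..1}"
    then show "\<bar>1 - 2 * Theta t y\<bar> \<le> 1 + 4 * theta_sup t" using Theta_bound[OF t, of y] by auto
  qed
  have "(LINT y|UI. dir s r y * Top t M f y) = (LINT y|UI. M * (dir s r y * (1 - 2 * Theta t y)) + dir s r y * (LINT z|UI. dir t y z * f z))"
    by (simp add: Top_def algebra_simps)
  also have "\<dots> = M * ((LINT y|UI. dir s r y * (1 - y)) - (LINT z|UI. dir (s + t) r z * (1 - z))) + (LINT z|UI. dir (s + t) r z * f z)"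
    using i1 dir_dir_UI[OF s t f, of r] by (simp add: e)
  finally have "Top s M (Top t M f) r = M * (1 - 2 * Theta s r) + M * ((LINT y|UI. dir s r y * (1 - y)) - (LINT z|UI. dir (s + t) r z * (1 - z))) + (LINT z|UI. dir (s + t) r z * f z)"
    by (simp add: Top_def[of s])
  \<comment> \<open>After both boundary terms are rewritten by \<open>Theta_dir_identity\<close>,
    the integrals against \<open>dir s\<close> cancel.\<close>
  also have "\<dots> = M * (1 - 2 * Theta (s + t) r) + (LINT z|UI. dir (s + t) r z * f z)"
  proof -
    have "0 < s + t" using s t by simp
    note * = Theta_dir_identity[OF s r] Theta_dir_identity[OF this r]
    show ?thesis unfolding * by (simp only: right_diff_distrib)
  qed
  finally show ?thesis by (simp add: Top_def)
qed

section \<open>Barriers at the level of distribution functions\<close>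

text \<open>The action of the cutting operator on distribution functions, except at r = 0, where the Dirac mass
  restores the full mass. The value at 0 does not matter under Top.\<close>
definition Kop :: "real \<Rightarrow> (real \<Rightarrow> real) \<Rightarrow> real \<Rightarrow> real" where
  "Kop a f r = max (f r - a) 0"

lemma Kop_cls: "0 \<le> a \<Longrightarrow> cls M f \<Longrightarrow> cls M (Kop a f)"
  unfolding cls_def Kop_def by (auto intro!: borel_measurable_max borel_measurable_diff)

lemma Kop_mono: "le01 f g \<Longrightarrow> le01 (Kop a f) (Kop a g)"
  unfolding le01_def Kop_def by (intro ballI max.mono diff_mono) auto

lemma Kop_Kop: "0 \<le> a \<Longrightarrow> 0 \<le> b \<Longrightarrow> Kop a (Kop b f) = Kop (a + b) f"
  unfolding Kop_def by (auto simp: fun_eq_iff)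

text \<open>Since \<open>f\<close> is at most \<open>Kop a f + a\<close>, cutting before the flow
  lowers the result by at most a; nonnegativity of the flow accounts for the truncation at
  0.\<close>

lemma Kop_Top_le:
  assumes t: "t > 0" and M: "M \<ge> 0" and a: "a \<ge> 0" and f: "cls M f"
  shows "le01 (Kop a (Top t M f)) (Top t M (Kop a f))"
  unfolding le01_def
proof
  fix r :: real assume r: "r \<in> {0..1}"
  have k: "cls M (Kop a f)" using Kop_cls a f by blast
  have "0 \<le> Top t M (Kop a f) r" using Top_cls[OF t M k] r by (simp add: cls_def)
  moreover have "Top t M f r \<le> Top t M (Kop a f) r + a"
    by (rule Top_shift[OF t r f k a]) (auto simp: Kop_def)
  ultimately show "Kop a (Top t M f) r \<le> Top t M (Kop a f) r" by (simp add: Kop_def)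
qed

definition Am :: "real \<Rightarrow> real \<Rightarrow> real \<Rightarrow> (real \<Rightarrow> real) \<Rightarrow> real \<Rightarrow> real" where
  "Am j M d f = Kop (j * d) (Top d M f)"

definition Ap :: "real \<Rightarrow> real \<Rightarrow> real \<Rightarrow> (real \<Rightarrow> real) \<Rightarrow> real \<Rightarrow> real" where
  "Ap j M d f = Top d M (Kop (j * d) f)"

section \<open>Comparison of barriers with different time steps\<close>

context
  fixes j M :: real
  assumes j: "j \<ge> 0" and M: "M \<ge> 0"
begin

lemma Am_cls: "d > 0 \<Longrightarrow> cls M f \<Longrightarrow> cls M (Am j M d f)"
  unfolding Am_def using j M by (intro Kop_cls Top_cls) auto

lemma Ap_cls: "d > 0 \<Longrightarrow> cls M f \<Longrightarrow> cls M (Ap j M d f)"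
  unfolding Ap_def using j M by (intro Kop_cls Top_cls) auto

lemma Am_mono: "d > 0 \<Longrightarrow> cls M f \<Longrightarrow> cls M g \<Longrightarrow> le01 f g \<Longrightarrow> le01 (Am j M d f) (Am j M d g)"
  unfolding Am_def using j M by (intro Kop_mono Top_mono) auto

lemma Ap_mono: "d > 0 \<Longrightarrow> cls M f \<Longrightarrow> cls M g \<Longrightarrow> le01 f g \<Longrightarrow> le01 (Ap j M d f) (Ap j M d g)"
  unfolding Ap_def using j M by (intro Kop_mono Top_mono Kop_cls) auto

lemma Am_le_Ap: "d > 0 \<Longrightarrow> cls M f \<Longrightarrow> le01 (Am j M d f) (Ap j M d f)"
  unfolding Am_def Ap_def using j M by (intro Kop_Top_le) auto

lemma Am_pow_cls: "d > 0 \<Longrightarrow> cls M f \<Longrightarrow> cls M ((Am j M d ^^ n) f)"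
  by (induction n) (auto intro: Am_cls)

lemma Ap_pow_cls: "d > 0 \<Longrightarrow> cls M f \<Longrightarrow> cls M ((Ap j M d ^^ n) f)"
  by (induction n) (auto intro: Ap_cls)

lemma Am_pow_mono:
  assumes "d > 0" "cls M f" "cls M g" "le01 f g"
  shows "le01 ((Am j M d ^^ n) f) ((Am j M d ^^ n) g)"
  by (induction n) (use assms in \<open>auto intro!: Am_mono Am_pow_cls\<close>)

lemma Am_pow_le_Ap_pow:
  assumes d: "d > 0" and f: "cls M f"
  shows "le01 ((Am j M d ^^ n) f) ((Ap j M d ^^ n) f)"
proof (induction n)
  case (Suc n)
  have "le01 (Am j M d ((Am j M d ^^ n) f)) (Am j M d ((Ap j M d ^^ n) f))"
    using Suc by (intro Am_mono Am_pow_cls Ap_pow_cls d f)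
  then show ?case using Am_le_Ap[OF d Ap_pow_cls[OF d f, of n]] by (simp only: funpow.simps comp_apply) (rule le01_trans)
qed (simp add: le01_refl)

text \<open>The outer cut, applied to the upper barrier, costs at most j d. It turns the upper
  barrier into the lower one started from the cut initial function, and that start only lowers
  it.\<close>

lemma Ap_pow_gap:
  assumes d: "d > 0" and f: "cls M f" and r: "r \<in> {0..1}"
  shows "(Ap j M d ^^ n) f r \<le> (Am j M d ^^ n) f r + j * d"
proof -
  have jd: "j * d \<ge> 0" using j d by simp
  have "Kop (j * d) ((Ap j M d ^^ n) f) = (Am j M d ^^ n) (Kop (j * d) f)"
    by (induction n) (simp_all add: Am_def Ap_def)
  moreover have "(Ap j M d ^^ n) f r \<le> Kop (j * d) ((Ap j M d ^^ n) f) r + j * d"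
    by (simp add: Kop_def)
  moreover have "le01 ((Am j M d ^^ n) (Kop (j * d) f)) ((Am j M d ^^ n) f)"
  proof (rule Am_pow_mono[OF d Kop_cls[OF jd f] f])
    show "le01 (Kop (j * d) f) f" using f jd by (auto simp: le01_def Kop_def cls_def)
  qed
  ultimately have "(Ap j M d ^^ n) f r \<le> (Am j M d ^^ n) (Kop (j * d) f) r + j * d"
    "(Am j M d ^^ n) (Kop (j * d) f) r \<le> (Am j M d ^^ n) f r"
    using r unfolding le01_def by (simp, blast)
  then show ?thesis by linarith
qed

text \<open>A long step consists of flows over e and d followed by a joint cut of j (d + e). Making
  the cut of j e already before the second flow can only increase the result, by
  \<open>Kop_Top_le\<close>; the induction splits off one short step at a time.\<close>

lemma Am_refine:
  assumes d: "d > 0" and f: "cls M f"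
  shows "le01 (Am j M (real (Suc n) * d) f) ((Am j M d ^^ Suc n) f)"
proof (induction n)
  case 0 show ?case by (simp add: le01_refl)
next
  case (Suc n)
  define e where "e = real (Suc n) * d"
  have e: "e > 0" using d by (simp add: e_def)
  have jd: "j * d \<ge> 0" "j * e \<ge> 0" using j d e by auto
  have T: "cls M (Top e M f)" by (rule Top_cls[OF e M f])
  have "le01 (Kop (j * d) (Kop (j * e) (Top d M (Top e M f)))) (Kop (j * d) (Top d M (Kop (j * e) (Top e M f))))"
    by (intro Kop_mono Kop_Top_le) (use d M T jd in auto)
  moreover have "le01 (Am j M (d + e) f) (Kop (j * d) (Kop (j * e) (Top d M (Top e M f))))"
    using Top_semigroup[OF d e cls_integrable[OF f], of _ M]
    by (simp add: le01_def Kop_Kop[OF jd] Am_def Kop_def distrib_left)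
  ultimately have A: "le01 (Am j M (d + e) f) (Am j M d (Am j M e f))"
    unfolding Am_def[of j M d] Am_def[of j M e] by (rule le01_trans[rotated])
  have B: "le01 (Am j M d (Am j M e f)) (Am j M d ((Am j M d ^^ Suc n) f))"
    using Suc unfolding e_def[symmetric] by (intro Am_mono d Am_cls e f Am_pow_cls)
  have eq: "real (Suc (Suc n)) * d = d + e" by (simp add: e_def algebra_simps)
  show ?case unfolding eq using le01_trans[OF A B] by (simp only: funpow.simps comp_apply)
qed

text \<open>Mirror image of \<open>Am_refine\<close>: the cut of j d between the two flows of the
  refined barrier is moved in front of both, which can only increase the result.\<close>

lemma Ap_refine:
  assumes d: "d > 0" and f: "cls M f"
  shows "le01 ((Ap j M d ^^ Suc n) f) (Ap j M (real (Suc n) * d) f)"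
proof (induction n)
  case 0 show ?case by (simp add: le01_refl)
next
  case (Suc n)
  define e where "e = real (Suc n) * d"
  have e: "e > 0" using d by (simp add: e_def)
  have jd: "j * d \<ge> 0" "j * e \<ge> 0" using j d e by auto
  have K: "cls M (Kop (j * e) f)" by (rule Kop_cls[OF jd(2) f])
  have K2: "cls M (Kop (j * d) (Kop (j * e) f))" by (rule Kop_cls[OF jd(1) K])
  have "le01 (Top d M (Kop (j * d) (Top e M (Kop (j * e) f)))) (Top d M (Top e M (Kop (j * d) (Kop (j * e) f))))"
    by (intro Top_mono Kop_Top_le Kop_cls Top_cls K K2 d e M jd)
  moreover have "le01 (Top d M (Top e M (Kop (j * d) (Kop (j * e) f)))) (Ap j M (d + e) f)"
    using Top_semigroup[OF d e cls_integrable[OF K2], of _ M]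
    by (simp add: le01_def Kop_Kop[OF jd] Ap_def distrib_left)
  ultimately have B: "le01 (Ap j M d (Ap j M e f)) (Ap j M (d + e) f)"
    unfolding Ap_def[of j M d] Ap_def[of j M e] by (rule le01_trans)
  have A: "le01 (Ap j M d ((Ap j M d ^^ Suc n) f)) (Ap j M d (Ap j M e f))"
    using Suc unfolding e_def[symmetric] by (intro Ap_mono d Ap_cls e f Ap_pow_cls)
  have eq: "real (Suc (Suc n)) * d = d + e" by (simp add: e_def algebra_simps)
  show ?case unfolding eq using le01_trans[OF A B] by (simp only: funpow.simps comp_apply)
qed

lemma Am_pow_refine:
  assumes d: "d > 0" and f: "cls M f" and n: "n \<ge> 1"
  shows "le01 ((Am j M (real n * d) ^^ k) f) ((Am j M d ^^ (n * k)) f)"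
proof (induction k)
  case (Suc k)
  have nd: "real n * d > 0" using n d by simp
  obtain m where m: "n = Suc m" using n by (cases n) auto
  have "le01 (Am j M (real n * d) ((Am j M (real n * d) ^^ k) f)) (Am j M (real n * d) ((Am j M d ^^ (n * k)) f))"
    by (intro Am_mono nd Am_pow_cls f d Suc)
  moreover have "le01 (Am j M (real n * d) ((Am j M d ^^ (n * k)) f)) ((Am j M d ^^ n) ((Am j M d ^^ (n * k)) f))"
    unfolding m by (intro Am_refine d Am_pow_cls f)
  ultimately have "le01 (Am j M (real n * d) ((Am j M (real n * d) ^^ k) f)) ((Am j M d ^^ n) ((Am j M d ^^ (n * k)) f))"
    by (rule le01_trans)
  then show ?case by (simp add: funpow_add)
qed (simp add: le01_refl)

lemma Ap_pow_refine:
  assumes d: "d > 0" and f: "cls M f" and n: "n \<ge> 1"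
  shows "le01 ((Ap j M d ^^ (n * k)) f) ((Ap j M (real n * d) ^^ k) f)"
proof (induction k)
  case (Suc k)
  have nd: "real n * d > 0" using n d by simp
  obtain m where m: "n = Suc m" using n by (cases n) auto
  have "le01 (Ap j M (real n * d) ((Ap j M d ^^ (n * k)) f)) (Ap j M (real n * d) ((Ap j M (real n * d) ^^ k) f))"
    by (intro Ap_mono nd Ap_pow_cls f d Suc)
  moreover have "le01 ((Ap j M d ^^ n) ((Ap j M d ^^ (n * k)) f)) (Ap j M (real n * d) ((Ap j M d ^^ (n * k)) f))"
    unfolding m by (intro Ap_refine d Ap_pow_cls f)
  ultimately have "le01 ((Ap j M d ^^ n) ((Ap j M d ^^ (n * k)) f)) (Ap j M (real n * d) ((Ap j M (real n * d) ^^ k) f))"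
    by (rule le01_trans[rotated])
  then show ?case by (simp add: funpow_add)
qed (simp add: le01_refl)

text \<open>Both steps are multiples of c = a / q = b / p. Passing to c raises the lower and lowers
  the upper barrier, and barriers with the same step are ordered.\<close>

lemma Am_pow_le_Ap_pow_commensurable:
  assumes a: "a > 0" and b: "b > 0" and f: "cls M f" and p: "p \<ge> 1" and q: "q \<ge> 1" 
    and eq: "real p * a = real q * b"
  shows "le01 ((Am j M a ^^ p) f) ((Ap j M b ^^ q) f)"
proof -
  define c where "c = a / real q"
  have c: "c > 0" using a q by (simp add: c_def)
  have ac: "a = real q * c" "b = real p * c" using q p eq by (auto simp: c_def field_simps)
  have "le01 ((Am j M a ^^ p) f) ((Am j M c ^^ (q * p)) f)"
    unfolding ac(1) by (rule Am_pow_refine[OF c f q])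
  moreover have "le01 ((Am j M c ^^ (q * p)) f) ((Ap j M c ^^ (q * p)) f)"
    by (rule Am_pow_le_Ap_pow[OF c f])
  moreover have "le01 ((Ap j M c ^^ (p * q)) f) ((Ap j M b ^^ q) f)"
    unfolding ac(2) by (rule Ap_pow_refine[OF c f p])
  ultimately show ?thesis unfolding mult.commute[of q p] by (blast intro: le01_trans)
qed

text \<open>An infimum over dyadic steps rather than a limit, since the lower bound 0 gives its
  existence at once. By \<open>Am_le_Vlim\<close> and \<open>Vlim_le_Ap\<close> the barriers of
  every step enclose it, so the choice of dyadic steps leaves no trace.\<close>

definition Vlim :: "(real \<Rightarrow> real) \<Rightarrow> real \<Rightarrow> real \<Rightarrow> real" where
  "Vlim f t r = (INF m. (Ap j M (t / 2 ^ m) ^^ (2 ^ m)) f r)"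

lemma Ap_pow_bounds: "d > 0 \<Longrightarrow> cls M f \<Longrightarrow> r \<in> {0..1} \<Longrightarrow> 0 \<le> (Ap j M d ^^ n) f r \<and> (Ap j M d ^^ n) f r \<le> M"
  using Ap_pow_cls[of d f n] by (simp add: cls_def)

lemma Vlim_le: "t > 0 \<Longrightarrow> cls M f \<Longrightarrow> r \<in> {0..1} \<Longrightarrow> Vlim f t r \<le> (Ap j M (t / 2 ^ m) ^^ (2 ^ m)) f r"
  unfolding Vlim_def by (intro cINF_lower bdd_belowI[of _ 0]) (auto simp: Ap_pow_bounds)

lemma Am_le_Vlim:
  assumes d: "d > 0" and f: "cls M f" and r: "r \<in> {0..1}" and k: "k \<ge> 1"
  shows "(Am j M d ^^ k) f r \<le> Vlim f (real k * d) r"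
  unfolding Vlim_def
proof (rule cINF_greatest)
  fix m
  have "le01 ((Am j M d ^^ k) f) ((Ap j M (real k * d / 2 ^ m) ^^ (2 ^ m)) f)"
    by (rule Am_pow_le_Ap_pow_commensurable) (use d f k in auto)
  then show "(Am j M d ^^ k) f r \<le> (Ap j M (real k * d / 2 ^ m) ^^ (2 ^ m)) f r"
    using r by (simp add: le01_def)
qed simp

text \<open>The lower barrier of the same step lies below \<open>Vlim\<close> and within j t / 2^m
  of the upper one. The rate is uniform in r and locally uniform in t, which later gives continuity
  in t.\<close>

lemma Vlim_approx:
  assumes t: "t > 0" and f: "cls M f" and r: "r \<in> {0..1}"
  shows "\<bar>(Ap j M (t / 2 ^ m) ^^ (2 ^ m)) f r - Vlim f t r\<bar> \<le> j * t / 2 ^ m"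
  using Vlim_le[OF t f r, of m] Am_le_Vlim[of "t / 2 ^ m" f r "2 ^ m"] Ap_pow_gap[of "t / 2 ^ m" f r "2 ^ m"] assms
  by simp

text \<open>The step d need not be among those in the infimum. The lower barrier of step t / 2^m
  mediates: it lies below every upper barrier at time t, and \<open>Vlim\<close> exceeds it by at
  most j t / 2^m.\<close>

lemma Vlim_le_Ap:
  assumes d: "d > 0" and f: "cls M f" and r: "r \<in> {0..1}" and k: "k \<ge> 1"
  shows "Vlim f (real k * d) r \<le> (Ap j M d ^^ k) f r"
proof (rule LIMSEQ_le_const2)
  define t where "t = real k * d"
  have t: "t > 0" using d k by (simp add: t_def)
  have "Vlim f t r - j * t / 2 ^ m \<le> (Ap j M d ^^ k) f r" for m
  proof -
    have "le01 ((Am j M (t / 2 ^ m) ^^ (2 ^ m)) f) ((Ap j M d ^^ k) f)"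
    proof (rule Am_pow_le_Ap_pow_commensurable)
      show "real (2 ^ m) * (t / 2 ^ m) = real k * d" by (simp add: t_def)
    qed (use d f k t in auto)
    moreover have "Vlim f t r \<le> (Am j M (t / 2 ^ m) ^^ (2 ^ m)) f r + j * (t / 2 ^ m)"
      using Vlim_le[OF t f r, of m] Ap_pow_gap[of "t / 2 ^ m" f r "2 ^ m"] t f r by simp
    moreover from calculation(1) have "(Am j M (t / 2 ^ m) ^^ (2 ^ m)) f r \<le> (Ap j M d ^^ k) f r"
      using r unfolding le01_def by blast
    ultimately show ?thesis by (simp only: times_divide_eq_right)
  qed
  then show "\<exists>N. \<forall>m\<ge>N. Vlim f t r - j * t / 2 ^ m \<le> (Ap j M d ^^ k) f r" by (intro exI allI impI)
  show "(\<lambda>m. Vlim f t r - j * t / 2 ^ m) \<longlonglongrightarrow> Vlim f (real k * d) r"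
  proof -
    have "(\<lambda>m. Vlim f t r - j * t * (1 / 2) ^ m) \<longlonglongrightarrow> Vlim f t r - j * t * 0"
      by (intro tendsto_intros LIMSEQ_realpow_zero) auto
    then show ?thesis unfolding t_def[symmetric] by (simp add: power_one_over)
  qed
qed

end

section \<open>Identification of the barriers\<close>

lemma Fm_measurable:
  assumes "integrable UI (snd mu)"
  shows "(\<lambda>y. Fm y mu) \<in> borel_measurable UI"
proof -
  let ?k = "\<lambda>y z. indicator {y..1} z :: real"
  have m: "(\<lambda>p. ?k (fst p) (snd p)) \<in> borel_measurable (UI \<Otimes>\<^sub>M UI)"
  proof -
    have "(\<lambda>p. ?k (fst p) (snd p)) = (\<lambda>p. if fst p \<le> snd p \<and> snd p \<le> 1 then 1 else 0)"
      by (auto simp: fun_eq_iff)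
    also have "\<dots> \<in> borel_measurable (UI \<Otimes>\<^sub>M UI)" by measurable
    finally show ?thesis .
  qed
  have "integrable UI (\<lambda>y. LINT z|UI. ?k y z * snd mu z)"
    by (rule UI_Fubini(1)[OF m _ assms, of 1]) (auto simp: indicator_def)
  then have [measurable]: "(\<lambda>y. LINT z|UI. ?k y z * snd mu z) \<in> borel_measurable UI" by simp
  have "(\<lambda>y. (if y = 0 then fst mu else 0) + (LINT z|UI. ?k y z * snd mu z)) \<in> borel_measurable UI"
    by measurable
  then show ?thesis by (rule measurable_cong[THEN iffD1, rotated]) (auto simp: Fm_UI)
qed

lemma UI_indicator_integrable:
  assumes "integrable UI (f :: real \<Rightarrow> real)"
  shows "integrable UI (\<lambda>y. indicator {a..b} y * f y)"
proof (rule Bochner_Integration.integrable_bound[OF assms])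
  have [measurable]: "f \<in> borel_measurable UI" using assms by simp
  have "(\<lambda>y. indicator {a..b} y * f y) = (\<lambda>y. (if a \<le> y \<and> y \<le> b then 1 else 0) * f y)"
    by (auto simp: fun_eq_iff)
  also have "\<dots> \<in> borel_measurable UI" by measurable
  finally show "(\<lambda>y. indicator {a..b} y * f y) \<in> borel_measurable UI" .
qed (auto simp: indicator_def)

lemma Fm_antimono:
  assumes "adm mu" "0 \<le> r" "r \<le> s" "s \<le> 1"
  shows "Fm s mu \<le> Fm r mu"
proof -
  have "(LINT y|UI. indicator {s..1} y * snd mu y) \<le> (LINT y|UI. indicator {r..1} y * snd mu y)"
  proof (rule integral_mono_AE)
    show "AE y in UI. indicator {s..1} y * snd mu y \<le> indicator {r..1} y * snd mu y"
      using assms unfolding adm_def by (auto elim!: eventually_mono simp: indicator_def)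
  qed (use assms in \<open>auto simp: adm_def UI_indicator_integrable\<close>)
  then show ?thesis using assms by (auto simp: Fm_UI adm_def)
qed

lemma Fm_continuous:
  assumes rho: "integrable UI \<rho>"
  shows "continuous_on {0..1} (\<lambda>r. Fm r (0, \<rho>))"
proof -
  have s: "set_integrable lborel {0..1} \<rho>" using rho by (simp add: set_integrable_UI)
  have "Fm r (0, \<rho>) = integral {r..1} \<rho>" if "r \<in> {0..1}" for r
  proof -
    have "set_integrable lborel {r..1} \<rho>"
      by (rule set_integrable_subset[OF s]) (use that in auto)
    from set_borel_integral_eq_integral(2)[OF this] show ?thesis by (simp add: Fm_def)
  qed
  moreover have "continuous_on {0..1} (\<lambda>x. integral {x..1} \<rho>)"
    by (rule indefinite_integral_continuous_1'[OF set_borel_integral_eq_integral(1)[OF s]])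
  ultimately show ?thesis using continuous_on_eq[of "{0..1}" "\<lambda>x. integral {x..1} \<rho>" "\<lambda>r. Fm r (0, \<rho>)"] by simp
qed

lemma adm_Fm_cls: "adm mu \<Longrightarrow> mass mu = M \<Longrightarrow> cls M (\<lambda>r. Fm r mu)"
  using Fm_measurable[of mu] Fm_antimono[of mu 0] Fm_antimono[of mu _ 1]
  by (auto simp: cls_def adm_def Fm_0 Fm_1)

text \<open>The level set is nonempty, since F falls continuously from more than j d to 0, and
  closed, so that it contains its infimum.\<close>

lemma Rdelta_props:
  assumes adm: "adm (0, \<rho>)" and m: "mass (0, \<rho>) > j * d" and jd: "j * d > 0"
  defines "R \<equiv> Rdelta j d (0, \<rho>)"
  shows "R \<in> {0..1}" "Fm R (0, \<rho>) = j * d"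
proof -
  let ?F = "\<lambda>r. Fm r (0, \<rho>)"
  define S where "S = {r\<in>{0..1}. ?F r = j * d}"
  have c: "continuous_on {0..1} ?F" using adm by (intro Fm_continuous) (simp add: adm_def)
  have "\<exists>x\<ge>0. x \<le> 1 \<and> ?F x = j * d"
    using m jd by (intro IVT2' c) (auto simp: Fm_0 Fm_1)
  then have ne: "S \<noteq> {}" unfolding S_def by auto
  have "closed S" unfolding S_def
    by (intro continuous_closed_preimage_constant c) simp
  moreover have "bdd_below S" unfolding S_def by (intro bdd_belowI[of _ 0]) auto
  ultimately have "Inf S \<in> S" using ne closed_contains_Inf by blast
  then show "R \<in> {0..1}" "Fm R (0, \<rho>) = j * d" unfolding R_def Rdelta_def S_def by auto
qed

text \<open>\<open>Kd\<close> discards an existing atom, so it is described on measures without one.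
  To the right of R the density carries mass exactly j d; deleting it lowers F by j d up to R and
  leaves nothing beyond, where F was at most j d. At r = 0 the new atom makes up for the loss, hence
  r > 0 in the formula.\<close>

lemma Kd_props:
  assumes adm: "adm (0, \<rho>)" and m: "mass (0, \<rho>) > j * d" and jd: "j * d > 0"
  shows "adm (Kd j d (0, \<rho>))" "mass (Kd j d (0, \<rho>)) = mass (0, \<rho>)"
    "\<And>r. r \<in> {0<..1} \<Longrightarrow> Fm r (Kd j d (0, \<rho>)) = Kop (j * d) (\<lambda>r. Fm r (0, \<rho>)) r"
    "AE y in UI. snd (Kd j d (0, \<rho>)) y \<le> \<rho> y"
proof -
  define R where "R = Rdelta j d (0, \<rho>)"
  have R: "R \<in> {0..1}" "Fm R (0, \<rho>) = j * d" using Rdelta_props[OF assms] by (auto simp: R_def)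
  have rho: "integrable UI \<rho>" "AE y in UI. 0 \<le> \<rho> y" using adm by (auto simp: adm_def)
  have K: "Kd j d (0, \<rho>) = (j * d, \<lambda>r. indicator {0..R} r * \<rho> r)" by (simp add: Kd_def R_def)
  show "adm (Kd j d (0, \<rho>))"
    unfolding adm_def K fst_conv snd_conv
  proof (intro conjI UI_indicator_integrable rho)
    show "AE y in UI. 0 \<le> indicator {0..R} y * \<rho> y" using rho(2) by eventually_elim (simp add: indicator_def)
  qed (use jd in simp)
  show "AE y in UI. snd (Kd j d (0, \<rho>)) y \<le> \<rho> y"
    unfolding K using rho by (auto simp: indicator_def elim!: eventually_mono)
  have cut: "(LINT y|UI. indicator {r..1} y * (indicator {0..R} y * \<rho> y))
    = (LINT y|UI. indicator {r..1} y * \<rho> y) - (LINT y|UI. indicator {R..1} y * \<rho> y)" if "0 \<le> r" "r \<le> R" for r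
  proof -
    have "(LINT y|UI. indicator {r..1} y * (indicator {0..R} y * \<rho> y))
      = (LINT y|UI. indicator {r..1} y * \<rho> y - indicator {R..1} y * \<rho> y)"
    proof (rule integral_cong_AE)
      show "AE y in UI. indicator {r..1} y * (indicator {0..R} y * \<rho> y) = indicator {r..1} y * \<rho> y - indicator {R..1} y * \<rho> y"
        using AE_UI_neq[of R] AE_UI_mem by eventually_elim (use that R in \<open>auto simp: indicator_def\<close>)
    qed (use rho in \<open>auto intro!: borel_measurable_integrable UI_indicator_integrable Bochner_Integration.integrable_diff\<close>)
    then show ?thesis using rho by (simp add: UI_indicator_integrable)
  qed
  have FR: "(LINT y|UI. indicator {R..1} y * \<rho> y) = j * d" using R by (simp add: Fm_UI split: if_splits)
  have e: "(LINT y|UI. indicator {0..1} y * f y) = (LINT y|UI. f y)" for f :: "real \<Rightarrow> real"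
    by (intro Bochner_Integration.integral_cong) auto
  show "mass (Kd j d (0, \<rho>)) = mass (0, \<rho>)"
    using cut[of 0] R by (simp add: mass_def K FR e)
  fix r :: real assume r: "r \<in> {0<..1}"
  show "Fm r (Kd j d (0, \<rho>)) = Kop (j * d) (\<lambda>r. Fm r (0, \<rho>)) r"
  proof (cases "r \<le> R")
    case True
    then have "Fm r (0, \<rho>) \<ge> j * d" using Fm_antimono[OF adm, of r R] r R by auto
    then show ?thesis using cut[of r] True r by (simp add: Fm_UI K Kop_def FR)
  next
    case False
    then have "Fm r (0, \<rho>) \<le> j * d" using Fm_antimono[OF adm, of R r] r R by auto
    moreover have "(LINT y|UI. indicator {r..1} y * (indicator {0..R} y * \<rho> y)) = (LINT y|UI. 0)"
      using False by (intro Bochner_Integration.integral_cong) (auto simp: indicator_def)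
    ultimately show ?thesis using r by (simp add: Fm_UI K Kop_def)
  qed
qed

lemma heat_fst [simp]: "fst (heat t mu) = 0" by (simp add: heat_def)

lemma Top_Fm_cong:
  assumes "d > 0" "integrable UI (snd mu)" "cls M g" "\<And>y. y \<in> {0<..1} \<Longrightarrow> Fm y mu = g y"
  shows "Top d M (\<lambda>y. Fm y mu) r = Top d M g r"
  using assms by (intro Top_cong) (auto simp: Fm_measurable cls_def)

text \<open>The absence of an atom belongs to the invariant because the next \<open>Kd\<close>
  relies on it. Each step ends with a flow, so the formula includes r = 0, in contrast to
  \<open>Sminus_props\<close>, where the final cut leaves an atom.\<close>

lemma Splus_props:
  assumes adm: "adm (0, u)" and m: "mass (0, u) > j * d" and j: "j > 0" and d: "d > 0"
  defines "M \<equiv> mass (0, u)"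
  shows "adm (Splus j d u n) \<and> fst (Splus j d u n) = 0 \<and> mass (Splus j d u n) = M \<and>
    (\<forall>r\<in>{0..1}. Fm r (Splus j d u n) = (Ap j M d ^^ n) (\<lambda>r. Fm r (0, u)) r)"
proof (induction n)
  case 0 then show ?case using adm by (simp add: M_def)
next
  case (Suc n)
  have jd: "j * d > 0" using j d by simp
  have M: "M \<ge> 0" using m jd by (simp add: M_def)
  let ?f = "(Ap j M d ^^ n) (\<lambda>r. Fm r (0, u))"
  define \<rho> where "\<rho> = snd (Splus j d u n)"
  have S: "Splus j d u n = (0, \<rho>)" using Suc by (simp add: \<rho>_def prod_eq_iff)
  have a: "adm (0, \<rho>)" "mass (0, \<rho>) = M" using Suc S by auto
  have mm: "mass (0, \<rho>) > j * d" using a m by (simp add: M_def)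
  note K = Kd_props[OF a(1) mm jd]
  have Ki: "integrable UI (snd (Kd j d (0, \<rho>)))" using K(1) by (simp add: adm_def)
  have f: "cls M ?f" using j M d adm by (intro Ap_pow_cls adm_Fm_cls) (auto simp: M_def)
  have "Fm r (Splus j d u (Suc n)) = (Ap j M d ^^ Suc n) (\<lambda>r. Fm r (0, u)) r" if r: "r \<in> {0..1}" for r
  proof -
    have "Fm r (Splus j d u (Suc n)) = Top d M (\<lambda>y. Fm y (Kd j d (0, \<rho>))) r"
      using Fm_heat[OF d Ki r] K(2) a S by simp
    also have "\<dots> = Top d M (Kop (j * d) ?f) r"
    proof (rule Top_Fm_cong[OF d Ki])
      show "cls M (Kop (j * d) ?f)" using f jd by (intro Kop_cls) auto
      fix y :: real assume y: "y \<in> {0<..1}"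
      have "Fm y (0, \<rho>) = ?f y" using Suc S y by auto
      then show "Fm y (Kd j d (0, \<rho>)) = Kop (j * d) ?f y" using K(3)[OF y] by (simp add: Kop_def)
    qed
    finally show ?thesis by (simp add: Ap_def)
  qed
  moreover have "adm (Splus j d u (Suc n))" "mass (Splus j d u (Suc n)) = M"
    using heat_adm[OF d K(1)] mass_heat[OF d Ki] K(2) a S by auto
  ultimately show ?case by simp
qed

lemma Sminus_props:
  assumes adm: "adm (0, u)" and m: "mass (0, u) > j * d" and j: "j > 0" and d: "d > 0"
  defines "M \<equiv> mass (0, u)"
  shows "adm (Sminus j d u n) \<and> mass (Sminus j d u n) = M \<and>
    (\<forall>r\<in>{0<..1}. Fm r (Sminus j d u n) = (Am j M d ^^ n) (\<lambda>r. Fm r (0, u)) r)"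
proof (induction n)
  case 0 then show ?case using adm by (simp add: M_def)
next
  case (Suc n)
  have jd: "j * d > 0" using j d by simp
  have M: "M \<ge> 0" using m jd by (simp add: M_def)
  let ?f = "(Am j M d ^^ n) (\<lambda>r. Fm r (0, u))"
  let ?S = "Sminus j d u n"
  define \<rho> where "\<rho> = snd (heat d ?S)"
  have S: "heat d ?S = (0, \<rho>)" by (simp add: \<rho>_def prod_eq_iff)
  have i: "integrable UI (snd ?S)" using Suc by (simp add: adm_def)
  have a: "adm (0, \<rho>)" "mass (0, \<rho>) = M" 
    using Suc heat_adm[OF d, of ?S] mass_heat[OF d i] S by auto
  have mm: "mass (0, \<rho>) > j * d" using a m by (simp add: M_def)
  note K = Kd_props[OF a(1) mm jd]
  have f: "cls M ?f" using j M d adm by (intro Am_pow_cls adm_Fm_cls) (auto simp: M_def)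
  have "Fm r (Sminus j d u (Suc n)) = (Am j M d ^^ Suc n) (\<lambda>r. Fm r (0, u)) r" if r: "r \<in> {0<..1}" for r
  proof -
    have r': "r \<in> {0..1}" using r by auto
    have "Fm r (0, \<rho>) = Top d M (\<lambda>y. Fm y ?S) r" using Fm_heat[OF d i r'] S Suc by simp
    also have "\<dots> = Top d M ?f r" using Suc by (intro Top_Fm_cong[OF d i f]) auto
    finally show ?thesis using K(3)[OF r] S by (simp add: Am_def Kop_def)
  qed
  then show ?case using K S a by simp
qed

text \<open>The mass moved by the cutting operator is j d, so after a time t it changes the density
  by at most j d times the maximum of the heat kernel.\<close>
lemma heat_Kd_diff:
  assumes adm: "adm (0, \<rho>)" and m: "mass (0, \<rho>) > j * d" and j: "j > 0" and d: "d > 0" and t: "t > 0"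
  shows "\<bar>snd (heat t (Kd j d (0, \<rho>))) r - snd (heat t (0, \<rho>)) r\<bar> \<le> 2 * j * d * theta_sup t"
proof -
  have jd: "j * d > 0" using j d by simp
  note K = Kd_props[OF adm m jd]
  let ?k = "snd (Kd j d (0, \<rho>))"
  have i: "integrable UI \<rho>" "integrable UI ?k" using adm K(1) by (auto simp: adm_def)
  have fK: "fst (Kd j d (0, \<rho>)) = j * d" by (simp add: Kd_def)
  define W where "W = (LINT y|UI. neu t r y * (\<rho> y - ?k y))"
  have W: "W = (LINT y|UI. neu t r y * \<rho> y) - (LINT y|UI. neu t r y * ?k y)"
    using neu_integrable[OF t i(1), of r] neu_integrable[OF t i(2), of r] by (simp add: W_def right_diff_distrib)
  have int: "(LINT y|UI. \<rho> y - ?k y) = j * d" using K(2) i fK by (simp add: mass_def)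
  have "0 \<le> W" unfolding W_def
    by (rule integral_nonneg_AE) (use K(4) neu_nonneg[OF t] in \<open>auto elim!: eventually_mono\<close>)
  moreover have "W \<le> (LINT y|UI. 2 * theta_sup t * (\<rho> y - ?k y))"
    unfolding W_def
  proof (rule integral_mono_AE)
    show "integrable UI (\<lambda>y. neu t r y * (\<rho> y - ?k y))" using i by (intro neu_integrable t) auto
    show "AE y in UI. neu t r y * (\<rho> y - ?k y) \<le> 2 * theta_sup t * (\<rho> y - ?k y)"
      using K(4) by eventually_elim (intro mult_right_mono neu_le t, simp)
  qed (use i in auto)
  then have "W \<le> 2 * theta_sup t * (j * d)" using int by simp
  moreover have "0 \<le> j * d * neu t r 0" "j * d * neu t r 0 \<le> j * d * (2 * theta_sup t)"
    using j d neu_nonneg[OF t] neu_le[OF t] by (auto intro!: mult_left_mono mult_nonneg_nonneg)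
  moreover have "snd (heat t (Kd j d (0, \<rho>))) r - snd (heat t (0, \<rho>)) r = j * d * neu t r 0 - W"
    using t fK by (simp add: heat_UI W)
  moreover have "2 * theta_sup t * (j * d) = 2 * j * d * theta_sup t" "j * d * (2 * theta_sup t) = 2 * j * d * theta_sup t"
    by simp_all
  ultimately show ?thesis by linarith
qed

text \<open>The cuts of the last \<open>Suc l\<close> steps are dropped one at a time; in the sum, k
  d is the time during which a cut has been smoothed. The oldest is treated by
  \<open>heat_Kd_diff\<close> after the later flows are merged by \<open>heat_semigroup\<close>; the
  induction hypothesis, started at \<open>Suc n\<close>, covers the others.\<close>

lemma Splus_heat_diff:
  assumes adm: "adm (0, u)" and m: "mass (0, u) > j * d" and j: "j > 0" and d: "d > 0"
  shows "\<bar>snd (Splus j d u (n + Suc l)) r - snd (heat (real (Suc l) * d) (Splus j d u n)) r\<bar>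
    \<le> (\<Sum>k=1..Suc l. 2 * j * d * theta_sup (real k * d))"
proof (induction l arbitrary: n)
  case 0
  define \<rho> where "\<rho> = snd (Splus j d u n)"
  have S: "Splus j d u n = (0, \<rho>)" "adm (0, \<rho>)" "mass (0, \<rho>) > j * d"
    using Splus_props[OF assms, of n] m by (auto simp: \<rho>_def prod_eq_iff)
      (metis prod.collapse)+
  show ?case using heat_Kd_diff[OF S(2,3) j d d, of r] S by simp
next
  case (Suc l)
  define \<rho> where "\<rho> = snd (Splus j d u n)"
  have S: "Splus j d u n = (0, \<rho>)" "adm (0, \<rho>)" "mass (0, \<rho>) > j * d"
    using Splus_props[OF assms, of n] m by (auto simp: \<rho>_def prod_eq_iff)
      (metis prod.collapse)+
  have jd: "j * d > 0" using j d by simp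
  note K = Kd_props[OF S(2,3) jd]
  define e where "e = real (Suc l) * d"
  have e: "e > 0" using d by (simp add: e_def)
  have ed: "real (Suc (Suc l)) * d = e + d" by (simp add: e_def algebra_simps)
  have 1: "heat e (Splus j d u (Suc n)) = heat (e + d) (Kd j d (0, \<rho>))"
    using heat_semigroup[OF e d, of "Kd j d (0, \<rho>)"] K(1) S by (simp add: adm_def)
  have 2: "\<bar>snd (heat (e + d) (Kd j d (0, \<rho>))) r - snd (heat (e + d) (0, \<rho>)) r\<bar> \<le> 2 * j * d * theta_sup (e + d)"
    using e d by (intro heat_Kd_diff S j) auto
  have 3: "\<bar>snd (Splus j d u (n + Suc (Suc l))) r - snd (heat e (Splus j d u (Suc n))) r\<bar>
     \<le> (\<Sum>k=1..Suc l. 2 * j * d * theta_sup (real k * d))"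
    using Suc[of "Suc n"] by (simp add: e_def)
  have "\<bar>snd (Splus j d u (n + Suc (Suc l))) r - snd (heat (e + d) (0, \<rho>)) r\<bar>
     \<le> (\<Sum>k=1..Suc l. 2 * j * d * theta_sup (real k * d)) + 2 * j * d * theta_sup (e + d)"
    using 2 3[unfolded 1] by linarith
  moreover have "(\<Sum>k=1..Suc (Suc l). 2 * j * d * theta_sup (real k * d))
     = (\<Sum>k=1..Suc l. 2 * j * d * theta_sup (real k * d)) + 2 * j * d * theta_sup (real (Suc (Suc l)) * d)"
    by (rule sum.cl_ivl_Suc[THEN trans]) (simp del: of_nat_Suc)
  ultimately show ?case unfolding ed S by (simp only: ed)
qed

section \<open>Summation of the smoothing errors\<close>

lemma sum_inverse_sqrt_le: "(\<Sum>k=1..n. 1 / sqrt (real k)) \<le> 2 * sqrt (real n)"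
proof (induction n)
  case (Suc n)
  have "1 / sqrt (real (Suc n)) \<le> 2 * (sqrt (real (Suc n)) - sqrt (real n))"
  proof -
    define a b where "a = sqrt (real (Suc n))" and "b = sqrt (real n)"
    have ab: "0 \<le> b" "b \<le> a" "0 < a" by (auto simp: a_def b_def)
    have "(a - b) * (a + b) = 1" by (simp add: a_def b_def algebra_simps)
    moreover have "(a - b) * (a + b) \<le> (a - b) * (2 * a)" using ab by (intro mult_left_mono) auto
    ultimately have "1 \<le> (2 * (a - b)) * a" by (simp add: algebra_simps)
    then have "1 / a \<le> 2 * (a - b)" using ab(3) by (simp only: pos_divide_le_eq)
    then show ?thesis by (simp only: a_def b_def)
  qed
  then show ?case using Suc by simp
qed simp

lemma theta_sup_le:
  assumes "0 < s" "s \<le> T"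
  shows "theta_sup s \<le> (1 + tail_const * T\<^sup>2) / sqrt s"
proof -
  have "sqrt (2 * pi * s) \<ge> sqrt s" using assms pi_ge_two by simp
  then have "1 / sqrt (2 * pi * s) \<le> 1 / sqrt s" using assms by (intro divide_left_mono) auto
  moreover have "tail_const * s\<^sup>2 / sqrt s \<le> tail_const * T\<^sup>2 / sqrt s"
    using assms tail_const_nonneg by (intro divide_right_mono mult_left_mono power_mono) auto
  ultimately show ?thesis by (simp add: theta_sup_def eps_def add_divide_distrib)
qed

text \<open>A Riemann sum of the integrable singularity s^(-1/2): the terms d / sqrt(k d) add up to
  at most 2 sqrt(l d), whatever the step d. With the factor 2 j this gives the 4 j.\<close>

lemma sum_theta_sup_le:
  assumes d: "d > 0" and j: "j > 0" and T: "real l * d \<le> T"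
  shows "(\<Sum>k=1..l. 2 * j * d * theta_sup (real k * d)) \<le> 4 * j * (1 + tail_const * T\<^sup>2) * sqrt (real l * d)"
proof -
  let ?C = "1 + tail_const * T\<^sup>2"
  have C: "?C \<ge> 0" using tail_const_nonneg by simp
  have "(\<Sum>k=1..l. 2 * j * d * theta_sup (real k * d)) \<le> (\<Sum>k=1..l. (2 * j * sqrt d * ?C) * (1 / sqrt (real k)))"
  proof (rule sum_mono)
    fix k assume k: "k \<in> {1..l}"
    have "real k * d \<le> real l * d" using k d by (intro mult_right_mono) auto
    then have "theta_sup (real k * d) \<le> ?C / sqrt (real k * d)"
      using k d order_trans[OF \<open>real k * d \<le> real l * d\<close> T] by (intro theta_sup_le) auto
    then have "2 * j * d * theta_sup (real k * d) \<le> 2 * j * d * (?C / sqrt (real k * d))"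
      using j d by (intro mult_left_mono) auto
    also have "\<dots> = (2 * j * sqrt d * ?C) * (1 / sqrt (real k))"
    proof -
      have "d / sqrt d = sqrt d" using d by (simp add: real_div_sqrt)
      then have "d / sqrt (real k * d) = sqrt d * (1 / sqrt (real k))" by (simp add: real_sqrt_mult divide_divide_eq_left'[symmetric])
      moreover have "2 * j * d * (?C / sqrt (real k * d)) = 2 * j * ?C * (d / sqrt (real k * d))" by simp
      ultimately show ?thesis by (simp only: ac_simps)
    qed
    finally show "2 * j * d * theta_sup (real k * d) \<le> (2 * j * sqrt d * ?C) * (1 / sqrt (real k))" .
  qed
  also have "\<dots> = (2 * j * sqrt d * ?C) * (\<Sum>k=1..l. 1 / sqrt (real k))" by (rule sum_distrib_left[symmetric])
  also have "\<dots> \<le> (2 * j * sqrt d * ?C) * (2 * sqrt (real l))"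
    using j d C by (intro mult_left_mono sum_inverse_sqrt_le) auto
  also have "\<dots> = 4 * j * ?C * sqrt (real l * d)" by (simp add: real_sqrt_mult ac_simps)
  finally show ?thesis .
qed

lemma heat_diff_le:
  assumes t: "t > 0" and adm: "adm mu" and r: "\<And>y. y \<in> {0..1} \<Longrightarrow> \<bar>neu t r y - neu t r' y\<bar> \<le> e"
  shows "\<bar>snd (heat t mu) r - snd (heat t mu) r'\<bar> \<le> e * mass mu"
proof -
  have i: "integrable UI (snd mu)" and nn: "AE y in UI. 0 \<le> snd mu y" and c: "0 \<le> fst mu" using adm by (auto simp: adm_def)
  note I = neu_integrable[OF t i]
  let ?D = "LINT y|UI. (neu t r y - neu t r' y) * snd mu y"
  have eq: "snd (heat t mu) r - snd (heat t mu) r' = fst mu * (neu t r 0 - neu t r' 0) + ?D"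
    using t I[of r] I[of r'] by (simp add: heat_UI left_diff_distrib algebra_simps)
  have iD: "integrable UI (\<lambda>y. (neu t r y - neu t r' y) * snd mu y)"
    using I[of r] I[of r'] by (simp add: left_diff_distrib)
  have "\<bar>?D\<bar> \<le> (LINT y|UI. \<bar>(neu t r y - neu t r' y) * snd mu y\<bar>)" by (rule integral_abs_bound)
  also have "\<dots> \<le> (LINT y|UI. e * snd mu y)"
  proof (rule integral_mono_AE)
    show "AE y in UI. \<bar>(neu t r y - neu t r' y) * snd mu y\<bar> \<le> e * snd mu y"
      using nn AE_UI_mem by eventually_elim (auto simp: abs_mult intro!: mult_right_mono r)
  qed (use i iD in auto)
  finally have "\<bar>?D\<bar> \<le> e * (LINT y|UI. snd mu y)" by simp
  moreover have "\<bar>fst mu * (neu t r 0 - neu t r' 0)\<bar> \<le> e * fst mu"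
    using r[of 0] c mult_left_mono[OF r[of 0] c] by (simp add: abs_mult mult.commute)
  ultimately show ?thesis unfolding eq mass_def by (simp add: distrib_left)
qed

section \<open>The separating function\<close>

lemma Theta_continuous_t:
  assumes r: "r \<in> {0..1}"
  shows "continuous_on {0<..} (\<lambda>t. Theta t r)"
proof -
  have "continuous_on ({0<..} \<times> cbox 0 r) (\<lambda>(t, x). theta t x)"
    using theta_continuous by (rule continuous_on_subset) auto
  then have "continuous_on {0<..} (\<lambda>t. integral (cbox 0 r) (theta t))"
    by (rule integral_continuous_on_param)
  then show ?thesis using r by (simp add: Theta_def)
qed

lemma theta_sup_continuous: "continuous_on {0<..} theta_sup"
proof -
  have "continuous_on {0<..} (\<lambda>t. 1 / sqrt (2 * pi * t) + tail_const * t\<^sup>2 / sqrt t)"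
    by (intro continuous_intros) auto
  then show ?thesis by (simp add: theta_sup_def[abs_def] eps_def)
qed

text \<open>The dyadic barrier at time t has step t / 2^m, so continuity in t requires continuity in
  the step. Dominated convergence applies because \<open>theta_sup\<close> is bounded along a
  sequence of steps with positive limit.\<close>

lemma Ap_pow_continuous:
  assumes j: "j \<ge> 0" and M: "M \<ge> 0" and f: "cls M f" and r: "r \<in> {0..1}"
  shows "continuous_on {0<..} (\<lambda>d. (Ap j M d ^^ n) f r)"
  using r
proof (induction n arbitrary: r)
  case (Suc n)
  let ?g = "\<lambda>d y. Kop (j * d) ((Ap j M d ^^ n) f) y"
  have gc: "cls M (?g d)" if "d > 0" for d
    using that j by (intro Kop_cls Ap_pow_cls j M f) auto
  have "continuous_on {0<..} (\<lambda>d. LINT y|UI. dir d r y * ?g d y)"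
  proof (rule continuous_on_sequentiallyI)
    fix x :: "nat \<Rightarrow> real" and a assume x: "\<forall>n. x n \<in> {0<..}" and a: "a \<in> {0<..}" and lim: "x \<longlonglongrightarrow> a"
    have "(\<lambda>n. theta_sup (x n)) \<longlonglongrightarrow> theta_sup a"
      using theta_sup_continuous x a lim unfolding continuous_on_sequentially comp_def by blast
    then have "Bseq (\<lambda>n. theta_sup (x n))" by (rule convergent_imp_Bseq[OF convergentI])
    then obtain B where B: "\<And>n. \<bar>theta_sup (x n)\<bar> \<le> B" unfolding Bseq_def by auto
    have B0: "0 \<le> B" using B[of 0] by linarith
    show "(\<lambda>n. LINT y|UI. dir (x n) r y * ?g (x n) y) \<longlonglongrightarrow> (LINT y|UI. dir a r y * ?g a y)"
    proof (rule integral_dominated_convergence[where w = "\<lambda>_. 2 * B * M"])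
      show "(\<lambda>y. dir a r y * ?g a y) \<in> borel_measurable UI"
        using dir_integrable[OF _ cls_integrable[OF gc]] a by auto
      show "(\<lambda>y. dir (x n) r y * ?g (x n) y) \<in> borel_measurable UI" for n
        using dir_integrable[OF _ cls_integrable[OF gc]] x by auto
      show "AE y in UI. (\<lambda>i. dir (x i) r y * ?g (x i) y) \<longlonglongrightarrow> dir a r y * ?g a y"
      proof (rule AE_I2)
        fix y :: real assume "y \<in> space UI" then have y: "y \<in> {0..1}" by simp
        have "continuous_on {0<..} (\<lambda>d. dir d r y * ?g d y)"
          unfolding Kop_def by (intro continuous_intros Suc.IH y) auto
        then show "(\<lambda>i. dir (x i) r y * ?g (x i) y) \<longlonglongrightarrow> dir a r y * ?g a y"
          using x a lim unfolding continuous_on_sequentially comp_def by blast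
      qed
      show "AE y in UI. norm (dir (x i) r y * ?g (x i) y) \<le> 2 * B * M" for i
      proof (rule AE_I2)
        fix y :: real assume "y \<in> space UI" then have y: "y \<in> {0..1}" by simp
        have "\<bar>dir (x i) r y\<bar> \<le> 2 * B" using dir_bound[of "x i" r y] x B[of i] by auto
        moreover have "\<bar>?g (x i) y\<bar> \<le> M" using gc[of "x i"] x y by (auto simp: cls_def)
        ultimately show "norm (dir (x i) r y * ?g (x i) y) \<le> 2 * B * M"
          unfolding real_norm_def abs_mult using B0 by (intro mult_mono) auto
      qed
    qed simp
  qed
  then have "continuous_on {0<..} (\<lambda>d. M * (1 - 2 * Theta d r) + (LINT y|UI. dir d r y * ?g d y))"
    by (intro continuous_intros Theta_continuous_t Suc.prems)
  moreover have "(Ap j M d ^^ Suc n) f r = M * (1 - 2 * Theta d r) + (LINT y|UI. dir d r y * ?g d y)" for d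
    by (simp add: Ap_def[of j M d "(Ap j M d ^^ n) f"] Top_def)
  ultimately show ?case by (simp only:)
qed (simp add: continuous_on_const)

lemma Vlim_continuous:
  assumes j: "j \<ge> 0" and M: "M \<ge> 0" and f: "cls M f" and r: "r \<in> {0..1}"
  shows "continuous_on {0<..} (\<lambda>t. Vlim j M f t r)"
proof -
  have A: "continuous_on {0<..<b} (\<lambda>t. Vlim j M f t r)" if b: "b > 0" for b
  proof (rule uniform_limit_theorem)
    show "\<forall>\<^sub>F m in sequentially. continuous_on {0<..<b} (\<lambda>t. (Ap j M (t / 2 ^ m) ^^ (2 ^ m)) f r)"
    proof (rule always_eventually, rule allI)
      fix m :: nat
      show "continuous_on {0<..<b} (\<lambda>t. (Ap j M (t / 2 ^ m) ^^ (2 ^ m)) f r)"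
        by (rule continuous_on_compose2[OF Ap_pow_continuous[OF j M f r]]) (auto intro!: continuous_intros)
    qed
    show "uniform_limit {0<..<b} (\<lambda>m t. (Ap j M (t / 2 ^ m) ^^ (2 ^ m)) f r) (\<lambda>t. Vlim j M f t r) sequentially"
    proof (rule uniform_limitI)
      fix e :: real assume e: "e > 0"
      have "(\<lambda>m. j * b * (1 / 2) ^ m) \<longlonglongrightarrow> j * b * 0"
        by (intro tendsto_intros LIMSEQ_realpow_zero) auto
      then have "\<forall>\<^sub>F m in sequentially. j * b * (1 / 2) ^ m < e" using e by (intro order_tendstoD) auto
      then show "\<forall>\<^sub>F m in sequentially. \<forall>t\<in>{0<..<b}. dist ((Ap j M (t / 2 ^ m) ^^ (2 ^ m)) f r) (Vlim j M f t r) < e"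
      proof eventually_elim
        case (elim m)
        show ?case
        proof
          fix t assume t: "t \<in> {0<..<b}"
          have "j * t / 2 ^ m \<le> j * b / 2 ^ m" using t j by (intro divide_right_mono mult_left_mono) auto
          also have "\<dots> < e" using elim by (simp add: power_one_over)
          finally show "dist ((Ap j M (t / 2 ^ m) ^^ (2 ^ m)) f r) (Vlim j M f t r) < e"
            using Vlim_approx[OF j M _ f r, of t m] t by (simp add: dist_real_def)
        qed
      qed
    qed
  qed simp
  show ?thesis
  proof (rule continuous_at_imp_continuous_on, rule ballI)
    fix t :: real assume t: "t \<in> {0<..}"
    then have "continuous_on {0<..<t + 1} (\<lambda>t. Vlim j M f t r)" by (intro A) simp
    then show "isCont (\<lambda>t. Vlim j M f t r) t" using t by (simp add: continuous_on_eq_continuous_at)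
  qed
qed

text \<open>Recovers the value of a density with known modulus of continuity from its distribution function.\<close>
lemma density_average:
  assumes f: "integrable UI f" and a: "0 \<le> a" "a + h \<le> 1" "h \<ge> 0"
    and close: "\<And>y. y \<in> {a..a + h} \<Longrightarrow> \<bar>f y - c\<bar> \<le> e"
  shows "\<bar>h * c - (Fm a (0, f) - Fm (a + h) (0, f))\<bar> \<le> h * e"
proof -
  have I: "integrable UI (\<lambda>y. indicator {a..a + h} y * g y)" if "integrable UI g" for g :: "real \<Rightarrow> real"
    by (rule UI_indicator_integrable[OF that])
  have "Fm a (0, f) - Fm (a + h) (0, f) = (LINT y|UI. indicator {a..1} y * f y - indicator {a + h..1} y * f y)"
    using a f by (simp add: Fm_UI UI_indicator_integrable)
  also have "\<dots> = (LINT y|UI. indicator {a..a + h} y * f y)"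
  proof (rule integral_cong_AE)
    show "AE y in UI. indicator {a..1} y * f y - indicator {a + h..1} y * f y = indicator {a..a + h} y * f y"
      using AE_UI_neq[of "a + h"] AE_UI_mem by eventually_elim (use a in \<open>auto simp: indicator_def\<close>)
  qed (use f in \<open>auto intro!: borel_measurable_integrable UI_indicator_integrable Bochner_Integration.integrable_diff\<close>)
  finally have 1: "Fm a (0, f) - Fm (a + h) (0, f) = (LINT y|UI. indicator {a..a + h} y * f y)" .
  have c: "(LINT y|UI. indicator {a..a + h} y * k) = h * k" for k :: real
    using has_integral_UI_Icc[of "\<lambda>_. k" "h * k" a "a + h"] has_integral_const_real[of k a "a + h"] a by simp
  have "h * c - (Fm a (0, f) - Fm (a + h) (0, f)) = (LINT y|UI. indicator {a..a + h} y * (c - f y))"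
    unfolding 1 using I[OF f] I[of "\<lambda>_. c"] by (simp add: c[of c, symmetric] right_diff_distrib)
  also have "\<bar>\<dots>\<bar> \<le> (LINT y|UI. \<bar>indicator {a..a + h} y * (c - f y)\<bar>)" by (rule integral_abs_bound)
  also have "\<dots> \<le> (LINT y|UI. indicator {a..a + h} y * e)"
  proof (rule integral_mono)
    show "integrable UI (\<lambda>y. \<bar>indicator {a..a + h} y * (c - f y)\<bar>)"
      using f by (intro integrable_abs I) auto
    show "integrable UI (\<lambda>y. indicator {a..a + h} y * e)" by (intro I) simp
    show "\<bar>indicator {a..a + h} y * (c - f y)\<bar> \<le> indicator {a..a + h} y * e" for y
      using close[of y] by (auto simp: indicator_def abs_minus_commute)
  qed
  finally show ?thesis by (simp only: c)
qed

text \<open>Moving the interval inwards near r = 1 allows averages up to the endpoints of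
  [0,1].\<close>

lemma interval_containing:
  assumes "r \<in> {0..1::real}" "0 \<le> h" "h \<le> 1"
  obtains a where "0 \<le> a" "a + h \<le> 1" "r \<in> {a..a + h}"
  using that[of "min r (1 - h)"] assms by auto

section \<open>Convergence of the densities of the upper barriers\<close>

locale barrier_limit =
  fixes j :: real and u :: "real \<Rightarrow> real" and M :: real
  assumes j: "j > 0" and adm: "adm (0, u)" and M: "M = mass (0, u)" and Mpos: "M > 0"
begin

abbreviation "F0 \<equiv> \<lambda>r. Fm r (0, u)"

text \<open>Upper barriers are used because they end with a flow, which leaves no atom and gives a
  density at every point; lower barriers end with a cut, which truncates the density and creates an
  atom.\<close>

definition dens :: "nat \<Rightarrow> real \<Rightarrow> real \<Rightarrow> real" where
  "dens m t r = snd (Splus j (t / 2 ^ m) u (2 ^ m)) r"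

lemma F0_cls: "cls M F0"
  using adm_Fm_cls[OF adm] M by simp

lemma eventually_small_step: "\<forall>\<^sub>F m in sequentially. j * (b / 2 ^ m) < M"
proof -
  have "(\<lambda>m. j * b * (1 / 2) ^ m) \<longlonglongrightarrow> j * b * 0"
    by (intro tendsto_intros LIMSEQ_realpow_zero) auto
  then have "\<forall>\<^sub>F m in sequentially. j * b * (1 / 2) ^ m < M" using Mpos by (intro order_tendstoD) auto
  then show ?thesis by (simp add: power_one_over)
qed

lemma small_step_mono: "j * (b / 2 ^ m) < M \<Longrightarrow> t \<le> b \<Longrightarrow> j * (t / 2 ^ m) < M"
proof -
  assume b: "j * (b / 2 ^ m) < M" and t: "t \<le> b"
  have "j * (t / 2 ^ m) \<le> j * (b / 2 ^ m)" using t j by (intro mult_left_mono divide_right_mono) auto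
  then show ?thesis using b by simp
qed

lemma Splus_dens:
  assumes "t > 0" "j * (t / 2 ^ m) < M"
  shows "Splus j (t / 2 ^ m) u (2 ^ m) = (0, dens m t)" "adm (0, dens m t)"
    "r \<in> {0..1} \<Longrightarrow> Fm r (0, dens m t) = (Ap j M (t / 2 ^ m) ^^ (2 ^ m)) F0 r"
proof -
  note S = Splus_props[OF adm _ j, of "t / 2 ^ m" "2 ^ m", folded M]
  show 1: "Splus j (t / 2 ^ m) u (2 ^ m) = (0, dens m t)"
    using S assms by (simp add: dens_def[abs_def] prod_eq_iff)
  show "adm (0, dens m t)" using S assms by (simp add: 1)
  show "r \<in> {0..1} \<Longrightarrow> Fm r (0, dens m t) = (Ap j M (t / 2 ^ m) ^^ (2 ^ m)) F0 r"
    using S assms by (simp add: 1)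
qed

text \<open>At time t the density is uniformly close to a heat flow of duration t / 2^i, and the latter has a
  modulus of continuity independent of m.\<close>
lemma dens_equicontinuous:
  assumes a: "0 < a" "a \<le> b" and e: "e > 0"
  shows "\<exists>h>0. \<forall>\<^sub>F m in sequentially. \<forall>t\<in>{a..b}. \<forall>r\<in>{0..1}. \<forall>r'\<in>{0..1}. \<bar>r - r'\<bar> < h \<longrightarrow> \<bar>dens m t r - dens m t r'\<bar> \<le> e"
proof -
  define C where "C = 4 * j * (1 + tail_const * b\<^sup>2)"
  have C: "C \<ge> 0" using j tail_const_nonneg by (auto simp: C_def)
  have "(\<lambda>i. C * sqrt (b * (1 / 2) ^ i)) \<longlonglongrightarrow> C * sqrt (b * 0)"
    by (intro tendsto_intros LIMSEQ_realpow_zero) auto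
  then have "\<forall>\<^sub>F i in sequentially. C * sqrt (b * (1 / 2) ^ i) < e / 3" using e by (intro order_tendstoD) auto
  \<comment> \<open>Dropping the cuts of a final time span of length at most b / 2^i will cost at
    most e / 3; this \<open>i\<close> depends neither on m nor on t.\<close>
  then obtain i where i: "C * sqrt (b / 2 ^ i) < e / 3" 
    by (auto simp: eventually_sequentially power_one_over)
  \<comment> \<open>All flow times that occur lie in a compact interval away from 0, where the
    Neumann kernel is uniformly continuous.\<close>
  define K where "K = {a / 2 ^ i..b / 2 ^ i} \<times> {0..1::real} \<times> {0..1::real}"
  have K: "compact K" unfolding K_def by (intro compact_Times compact_Icc)
  have "0 < a / 2 ^ i" using a by simp
  then have "0 < fst p" if "p \<in> K" for p using that unfolding K_def by auto
  then have "continuous_on K (\<lambda>p. neu (fst p) (fst (snd p)) (snd (snd p)))"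
    by (intro continuous_intros) auto
  then have "uniformly_continuous_on K (\<lambda>p. neu (fst p) (fst (snd p)) (snd (snd p)))"
    using K by (rule compact_uniformly_continuous)
  moreover have "e / (3 * M) > 0" using e Mpos by simp
  ultimately obtain h where h: "h > 0" and
    uc: "\<And>p p'. p \<in> K \<Longrightarrow> p' \<in> K \<Longrightarrow> dist p' p < h \<Longrightarrow>
       dist (neu (fst p') (fst (snd p')) (snd (snd p'))) (neu (fst p) (fst (snd p)) (snd (snd p))) < e / (3 * M)"
    unfolding uniformly_continuous_on_def by metis
  have "\<forall>\<^sub>F m in sequentially. \<forall>t\<in>{a..b}. \<forall>r\<in>{0..1}. \<forall>r'\<in>{0..1}. \<bar>r - r'\<bar> < h \<longrightarrow> \<bar>dens m t r - dens m t r'\<bar> \<le> e"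
    using eventually_small_step[of b] eventually_ge_at_top[of i]
  proof eventually_elim
    case (elim m)
    show ?case
    proof (intro ballI impI)
      fix t r r' :: real assume t: "t \<in> {a..b}" and r: "r \<in> {0..1}" and r': "r' \<in> {0..1}" and rr: "\<bar>r - r'\<bar> < h"
      have t0: "t > 0" using t a by auto
      define d where "d = t / 2 ^ m"
      have d: "d > 0" using t0 by (simp add: d_def)
      have md: "mass (0, u) > j * d" using small_step_mono[OF elim(1), of t] t M by (simp add: d_def)
      obtain l where l: "2 ^ (m - i) = Suc l" by (metis not0_implies_Suc power_not_zero zero_neq_numeral)
      \<comment> \<open>The last \<open>Suc l\<close> = 2^(m - i) steps have total length t / 2^i
        for every m; \<open>n\<close> counts the steps before them.\<close>
      define n where "n = (2::nat) ^ m - Suc l"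
      have "(2::nat) ^ (m - i) \<le> 2 ^ m" by (intro power_increasing) auto
      then have nl: "n + Suc l = 2 ^ m" unfolding n_def l[symmetric] by simp
      have "real (Suc l) = 2 ^ (m - i)" unfolding l[symmetric] by simp
      also have "\<dots> = 2 ^ m / 2 ^ i" using elim(2) by (simp add: power_diff)
      finally have ld: "real (Suc l) * d = t / 2 ^ i" by (simp add: d_def)
      define s where "s = t / 2 ^ i"
      have s: "s > 0" "s \<in> {a / 2 ^ i..b / 2 ^ i}" using t t0 by (auto simp: s_def intro: divide_right_mono)
      define mu where "mu = Splus j d u n"
      have mu: "adm mu" "mass mu = M" using Splus_props[OF adm md j d, of n] M by (auto simp: mu_def)
      have sb: "s \<le> b"
      proof -
        have "b / 2 ^ i \<le> b / 1" using a by (intro divide_left_mono) auto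
        then show ?thesis using s by simp
      qed
      have A: "\<bar>dens m t x - snd (heat s mu) x\<bar> \<le> e / 3" for x
      proof -
        have "\<bar>dens m t x - snd (heat s mu) x\<bar> \<le> (\<Sum>k=1..Suc l. 2 * j * d * theta_sup (real k * d))"
          using Splus_heat_diff[OF adm md j d, of n l x] unfolding nl ld by (simp add: dens_def d_def s_def mu_def)
        also have "\<dots> \<le> C * sqrt s"
          using sum_theta_sup_le[OF d j, of "Suc l" b] sb unfolding ld by (simp add: s_def C_def)
        also have "\<dots> \<le> C * sqrt (b / 2 ^ i)" using s C by (intro mult_left_mono) auto
        finally show ?thesis using i by simp
      qed
      have "\<bar>snd (heat s mu) r - snd (heat s mu) r'\<bar> \<le> (e / (3 * M)) * mass mu"
      proof (rule heat_diff_le[OF s(1) mu(1)])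
        fix y :: real assume y: "y \<in> {0..1}"
        have "dist (s, r, y) (s, r', y) < h" using rr by (simp add: dist_Pair_Pair dist_real_def)
        then show "\<bar>neu s r y - neu s r' y\<bar> \<le> e / (3 * M)"
          using uc[of "(s, r', y)" "(s, r, y)"] s r r' y by (auto simp: K_def dist_real_def)
      qed
      also have "\<dots> = e / 3" using mu Mpos by simp
      finally show "\<bar>dens m t r - dens m t r'\<bar> \<le> e" using A[of r] A[of r'] by linarith
    qed
  qed
  then show ?thesis using h by blast
qed

text \<open>The integral of the density over an interval of length h is an increment of F, known
  from \<open>Vlim\<close> up to 2 h e / 8; equicontinuity adds h e / 4. Hence all late densities at
  r are within e / 2 of the same number, the increment of \<open>Vlim\<close> divided by h.\<close>

lemma dens_Cauchy:
  assumes a: "0 < a" "a \<le> b" and e: "e > 0"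
  shows "\<exists>N. \<forall>m\<ge>N. \<forall>n\<ge>N. \<forall>t\<in>{a..b}. \<forall>r\<in>{0..1}. \<bar>dens m t r - dens n t r\<bar> \<le> e"
proof -
  have e4: "e / 4 > 0" using e by simp
  obtain h0 where h0: "h0 > 0" and eq: "\<forall>\<^sub>F m in sequentially. \<forall>t\<in>{a..b}. \<forall>r\<in>{0..1}. \<forall>r'\<in>{0..1}. \<bar>r - r'\<bar> < h0 \<longrightarrow> \<bar>dens m t r - dens m t r'\<bar> \<le> e / 4"
    using dens_equicontinuous[OF a e4] by blast
  define h where "h = min (h0 / 2) 1"
  have h: "0 < h" "h \<le> 1" "h < h0" using h0 by (auto simp: h_def)
  have "(\<lambda>m. j * b * (1 / 2) ^ m) \<longlonglongrightarrow> j * b * 0"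
    by (intro tendsto_intros LIMSEQ_realpow_zero) auto
  moreover have "h * e / 8 > 0" using h e by simp
  ultimately have "\<forall>\<^sub>F m in sequentially. j * b * (1 / 2) ^ m < h * e / 8" by (intro order_tendstoD) auto
  then have "\<forall>\<^sub>F m in sequentially. (\<forall>t\<in>{a..b}. \<forall>r\<in>{0..1}. \<forall>r'\<in>{0..1}. \<bar>r - r'\<bar> < h0 \<longrightarrow> \<bar>dens m t r - dens m t r'\<bar> \<le> e / 4)
     \<and> j * (b / 2 ^ m) < M \<and> j * b / 2 ^ m < h * e / 8"
    using eq eventually_small_step[of b] by eventually_elim (auto simp: power_one_over)
  then obtain N where N: "\<And>m t r r'. m \<ge> N \<Longrightarrow> t \<in> {a..b} \<Longrightarrow> r \<in> {0..1} \<Longrightarrow> r' \<in> {0..1} \<Longrightarrow> \<bar>r - r'\<bar> < h0 \<Longrightarrow> \<bar>dens m t r - dens m t r'\<bar> \<le> e / 4"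
    "\<And>m. m \<ge> N \<Longrightarrow> j * (b / 2 ^ m) < M" "\<And>m. m \<ge> N \<Longrightarrow> j * b / 2 ^ m < h * e / 8"
    unfolding eventually_sequentially by metis
  have F: "\<bar>Fm r (0, dens m t) - Vlim j M F0 t r\<bar> \<le> h * e / 8" if "m \<ge> N" "t \<in> {a..b}" "r \<in> {0..1}" for m t r
  proof -
    have t: "t > 0" using that a by auto
    have "j * (t / 2 ^ m) < M" using small_step_mono[OF N(2)] that by auto
    then have "\<bar>Fm r (0, dens m t) - Vlim j M F0 t r\<bar> \<le> j * t / 2 ^ m"
      using Vlim_approx[of j M t F0 r m] Splus_dens(3)[OF t _ that(3)] j Mpos t F0_cls that(3) by simp
    also have "\<dots> \<le> j * b / 2 ^ m" using that j by (intro divide_right_mono mult_left_mono) auto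
    finally show ?thesis using N(3)[OF that(1)] by linarith
  qed
  have avg: "\<bar>h * dens m t r - (Vlim j M F0 t c - Vlim j M F0 t (c + h))\<bar> \<le> h * (e / 2)"
    if "m \<ge> N" "t \<in> {a..b}" "r \<in> {0..1}" "0 \<le> c" "c + h \<le> 1" "r \<in> {c..c + h}" for m t r c
  proof -
    have t: "t > 0" using that a by auto
    have "j * (t / 2 ^ m) < M" using small_step_mono[OF N(2)] that by auto
    then have i: "integrable UI (dens m t)" using Splus_dens(2)[OF t] by (simp add: adm_def)
    have "\<bar>h * dens m t r - (Fm c (0, dens m t) - Fm (c + h) (0, dens m t))\<bar> \<le> h * (e / 4)"
    proof (rule density_average[OF i])
      fix y assume "y \<in> {c..c + h}"
      then have "y \<in> {0..1}" "\<bar>y - r\<bar> < h0" using that h by auto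
      then show "\<bar>dens m t y - dens m t r\<bar> \<le> e / 4" using N(1)[of m t y r] that by blast
    qed (use that h in auto)
    moreover have "\<bar>Fm c (0, dens m t) - Vlim j M F0 t c\<bar> \<le> h * e / 8"
      "\<bar>Fm (c + h) (0, dens m t) - Vlim j M F0 t (c + h)\<bar> \<le> h * e / 8"
      using F[OF that(1,2)] that h by auto
    moreover have "h * (e / 4) = h * e / 4" "h * (e / 2) = h * e / 2" by simp_all
    ultimately show ?thesis by linarith
  qed
  have "\<bar>dens m t r - dens n t r\<bar> \<le> e" if mn: "m \<ge> N" "n \<ge> N" "t \<in> {a..b}" "r \<in> {0..1}" for m n t r
  proof -
    obtain c where c: "0 \<le> c" "c + h \<le> 1" "r \<in> {c..c + h}"
      using interval_containing[OF mn(4), of h] h by auto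
    have "\<bar>h * dens m t r - h * dens n t r\<bar> \<le> h * e"
      using avg[OF mn(1,3,4) c] avg[OF mn(2,3,4) c] by linarith
    then have "h * \<bar>dens m t r - dens n t r\<bar> \<le> h * e"
      using h by (simp add: abs_mult right_diff_distrib[symmetric])
    then show ?thesis using h by simp
  qed
  then show ?thesis by blast
qed

definition U :: "real \<Rightarrow> real \<Rightarrow> real" where "U r t = lim (\<lambda>m. dens m t r)"

lemma dens_tendsto:
  assumes t: "t > 0" and r: "r \<in> {0..1}"
  shows "(\<lambda>m. dens m t r) \<longlonglongrightarrow> U r t"
proof -
  have "Cauchy (\<lambda>m. dens m t r)"
  proof (rule metric_CauchyI)
    fix e :: real assume e: "e > 0"
    have e2: "e / 2 > 0" using e by simp
    obtain N where N: "\<forall>m\<ge>N. \<forall>n\<ge>N. \<forall>s\<in>{t..t}. \<forall>r\<in>{0..1}. \<bar>dens m s r - dens n s r\<bar> \<le> e / 2"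
      using dens_Cauchy[OF t order_refl e2] by blast
    show "\<exists>N. \<forall>m\<ge>N. \<forall>n\<ge>N. dist (dens m t r) (dens n t r) < e"
    proof (intro exI[of _ N] allI impI)
      fix m n assume "m \<ge> N" "n \<ge> N"
      then have "\<bar>dens m t r - dens n t r\<bar> \<le> e / 2" using N[rule_format, of m n t r] r by simp
      then show "dist (dens m t r) (dens n t r) < e" using e by (simp add: dist_real_def)
    qed
  qed
  then have "convergent (\<lambda>m. dens m t r)" by (rule Cauchy_convergent)
  then show ?thesis unfolding U_def by (simp add: convergent_LIMSEQ_iff)
qed

lemma U_equicontinuous:
  assumes a: "0 < a" "a \<le> b" and e: "e > 0"
  shows "\<exists>h>0. \<forall>t\<in>{a..b}. \<forall>r\<in>{0..1}. \<forall>r'\<in>{0..1}. \<bar>r - r'\<bar> < h \<longrightarrow> \<bar>U r t - U r' t\<bar> \<le> e"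
proof -
  obtain h where h: "h > 0" and eq: "\<forall>\<^sub>F m in sequentially. \<forall>t\<in>{a..b}. \<forall>r\<in>{0..1}. \<forall>r'\<in>{0..1}. \<bar>r - r'\<bar> < h \<longrightarrow> \<bar>dens m t r - dens m t r'\<bar> \<le> e"
    using dens_equicontinuous[OF assms] by blast
  show ?thesis
  proof (intro exI[of _ h] conjI h ballI impI)
    fix t r r' :: real assume *: "t \<in> {a..b}" "r \<in> {0..1}" "r' \<in> {0..1}" "\<bar>r - r'\<bar> < h"
    have t: "t > 0" using * a by auto
    have "(\<lambda>m. \<bar>dens m t r - dens m t r'\<bar>) \<longlonglongrightarrow> \<bar>U r t - U r' t\<bar>"
      using * t by (intro tendsto_intros dens_tendsto)
    moreover have "\<forall>\<^sub>F m in sequentially. \<bar>dens m t r - dens m t r'\<bar> \<le> e"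
      using eq by eventually_elim (use * in blast)
    ultimately show "\<bar>U r t - U r' t\<bar> \<le> e" by (intro tendsto_upperbound[of _ _ sequentially]) auto
  qed
qed

lemma U_integrable:
  assumes t: "t > 0"
  shows "integrable UI (\<lambda>r. U r t)"
proof -
  have "continuous_on {0..1} (\<lambda>r. U r t)"
    unfolding continuous_on_iff dist_real_def
  proof (intro ballI allI impI)
    fix x e :: real assume x: "x \<in> {0..1}" and e: "e > 0"
    have e2: "e / 2 > 0" using e by simp
    obtain h where h: "h > 0" "\<forall>s\<in>{t..t}. \<forall>r\<in>{0..1}. \<forall>r'\<in>{0..1}. \<bar>r - r'\<bar> < h \<longrightarrow> \<bar>U r s - U r' s\<bar> \<le> e / 2"
      using U_equicontinuous[OF t order_refl e2] by blast
    show "\<exists>d>0. \<forall>x'\<in>{0..1}. \<bar>x' - x\<bar> < d \<longrightarrow> \<bar>U x' t - U x t\<bar> < e"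
    proof (intro exI[of _ h] conjI h ballI impI)
      fix x' assume "x' \<in> {0..1}" "\<bar>x' - x\<bar> < h"
      then have "\<bar>U x' t - U x t\<bar> \<le> e / 2" using h(2)[rule_format, of t x' x] x by simp
      then show "\<bar>U x' t - U x t\<bar> < e" using e by simp
    qed
  qed
  from borel_integrable_atLeastAtMost'[OF this] show ?thesis by (simp add: set_integrable_UI)
qed

text \<open>The distribution functions of \<open>dens m t\<close> have two limits in m:
  \<open>Vlim\<close>, by \<open>Vlim_approx\<close>, and that of \<open>U\<close>, by uniform
  convergence of the densities.\<close>

lemma Fm_U:
  assumes t: "t > 0" and r: "r \<in> {0..1}"
  shows "Fm r (0, \<lambda>r. U r t) = Vlim j M F0 t r"
proof (rule LIMSEQ_unique)
  have ev: "\<forall>\<^sub>F m in sequentially. j * (t / 2 ^ m) < M" by (rule eventually_small_step)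
  show "(\<lambda>m. Fm r (0, dens m t)) \<longlonglongrightarrow> Vlim j M F0 t r"
  proof (rule LIM_zero_cancel, rule Lim_null_comparison)
    show "\<forall>\<^sub>F m in sequentially. norm (Fm r (0, dens m t) - Vlim j M F0 t r) \<le> j * t * (1 / 2) ^ m"
      using ev
    proof eventually_elim
      case (elim m)
      have "\<bar>(Ap j M (t / 2 ^ m) ^^ (2 ^ m)) F0 r - Vlim j M F0 t r\<bar> \<le> j * t / 2 ^ m"
        using j Mpos by (intro Vlim_approx t F0_cls r) auto
      then show ?case unfolding Splus_dens(3)[OF t elim r] by (simp add: power_one_over)
    qed
    have "(\<lambda>m. j * t * (1 / 2) ^ m) \<longlonglongrightarrow> j * t * 0"
      by (intro tendsto_intros LIMSEQ_realpow_zero) auto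
    then show "(\<lambda>m. j * t * (1 / 2) ^ m) \<longlonglongrightarrow> 0" by simp
  qed
  show "(\<lambda>m. Fm r (0, dens m t)) \<longlonglongrightarrow> Fm r (0, \<lambda>r. U r t)"
  proof (rule metric_LIMSEQ_I)
    fix e :: real assume e: "e > 0"
    have e2: "e / 2 > 0" using e by simp
    obtain N where N0: "\<forall>m\<ge>N. \<forall>n\<ge>N. \<forall>s\<in>{t..t}. \<forall>r\<in>{0..1}. \<bar>dens m s r - dens n s r\<bar> \<le> e / 2"
      using dens_Cauchy[OF t order_refl e2] by blast
    have N: "\<bar>dens m t r - dens n t r\<bar> \<le> e / 2" if "m \<ge> N" "n \<ge> N" "r \<in> {0..1}" for m n r
      using N0[rule_format, of m n t r] that by simp
    obtain N' where N': "\<forall>m\<ge>N'. j * (t / 2 ^ m) < M" using ev unfolding eventually_sequentially ..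
    show "\<exists>N. \<forall>m\<ge>N. dist (Fm r (0, dens m t)) (Fm r (0, \<lambda>r. U r t)) < e"
    proof (intro exI[of _ "max N N'"] allI impI)
      fix m assume m: "max N N' \<le> m"
      have N'm: "N' \<le> m" using m by (rule max.boundedE)
      have "N' \<le> m \<longrightarrow> j * (t / 2 ^ m) < M" using N' by (rule spec)
      from this N'm have "j * (t / 2 ^ m) < M" by (rule mp)
      from Splus_dens(2)[OF t this] have i: "integrable UI (dens m t)" by (simp add: adm_def)
      have c: "\<bar>dens m t y - U y t\<bar> \<le> e / 2" if y: "y \<in> {0..1}" for y
      proof (rule tendsto_upperbound)
        show "(\<lambda>n. \<bar>dens m t y - dens n t y\<bar>) \<longlonglongrightarrow> \<bar>dens m t y - U y t\<bar>"
          by (intro tendsto_intros dens_tendsto t y)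
        show "\<forall>\<^sub>F n in sequentially. \<bar>dens m t y - dens n t y\<bar> \<le> e / 2"
          using eventually_ge_at_top[of N]
        proof eventually_elim
          case (elim n)
          have "N \<le> m" using m by (rule max.boundedE)
          then show ?case using elim y by (rule N)
        qed
      qed simp
      let ?D = "LINT y|UI. indicator {r..1} y * (dens m t y - U y t)"
      have D: "Fm r (0, dens m t) - Fm r (0, \<lambda>r. U r t) = (LINT y|UI. indicator {r..1} y * (dens m t y - U y t))"
      proof -
        have F: "Fm r (0, f) = (LINT y|UI. indicator {r..1} y * f y)" for f using r by (simp add: Fm_UI)
        show ?thesis unfolding F right_diff_distrib
          by (rule Bochner_Integration.integral_diff[symmetric]; rule UI_indicator_integrable) (rule i U_integrable[OF t])+
      qed
      have "\<bar>?D\<bar> \<le> (LINT y|UI. \<bar>indicator {r..1} y * (dens m t y - U y t)\<bar>)" by (rule integral_abs_bound)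
      also have "\<dots> \<le> (LINT y|UI. e / 2)"
      proof (rule integral_mono)
        show "integrable UI (\<lambda>y. \<bar>indicator {r..1} y * (dens m t y - U y t)\<bar>)"
          using i U_integrable[OF t] by (intro integrable_abs UI_indicator_integrable) auto
        show "\<bar>indicator {r..1} y * (dens m t y - U y t)\<bar> \<le> e / 2" if "y \<in> space UI" for y
        proof (cases "y \<in> {r..1}")
          case True
          then show ?thesis using c[of y] that by simp
        next
          case False
          then show ?thesis using e by simp
        qed
      qed simp
      also have "\<dots> = e / 2" by simp
      finally show "dist (Fm r (0, dens m t)) (Fm r (0, \<lambda>r. U r t)) < e"
        unfolding dist_real_def D using e by linarith
    qed
  qed
qed

text \<open>Regularity in time is taken from \<open>Vlim\<close>: h U r s is close to the increment
  of \<open>Vlim\<close> at time s over a fixed interval of length h, uniformly for s near t. Three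
  errors of h e / 6 bound the change in time by e / 2; the change in r adds e / 6.\<close>

lemma U_continuous: "continuous_on ({0..1} \<times> {0<..}) (\<lambda>(r, t). U r t)"
  unfolding continuous_on_iff
proof (intro ballI allI impI)
  fix z :: "real \<times> real" and e :: real assume z: "z \<in> {0..1} \<times> {0<..}" and e: "e > 0"
  obtain r t where zz: "z = (r, t)" by (cases z)
  have r: "r \<in> {0..1}" and t: "t > 0" using z zz by auto
  have e6: "e / 6 > 0" using e by simp
  obtain h0 where h0: "h0 > 0" and eq: "\<forall>s\<in>{t/2..2*t}. \<forall>x\<in>{0..1}. \<forall>y\<in>{0..1}. \<bar>x - y\<bar> < h0 \<longrightarrow> \<bar>U x s - U y s\<bar> \<le> e / 6"
    using U_equicontinuous[of "t/2" "2*t", OF _ _ e6] t by auto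
  define h where "h = min (h0 / 2) 1"
  have h: "0 < h" "h \<le> 1" "h < h0" using h0 by (auto simp: h_def)
  obtain c where c: "0 \<le> c" "c + h \<le> 1" "r \<in> {c..c + h}"
    using interval_containing[OF r, of h] h by auto
  let ?G = "\<lambda>s. Vlim j M F0 s c - Vlim j M F0 s (c + h)"
  have "continuous_on {0<..} ?G"
    using j Mpos F0_cls c h by (intro continuous_intros Vlim_continuous) auto
  then have "isCont ?G t" using t by (simp add: continuous_on_eq_continuous_at)
  moreover have "h * (e / 6) > 0" using h e by simp
  ultimately obtain k where k: "k > 0" "\<And>s. \<bar>s - t\<bar> < k \<Longrightarrow> \<bar>?G s - ?G t\<bar> < h * (e / 6)"
    unfolding continuous_at_eps_delta dist_real_def by metis
  have avg: "\<bar>h * U r s - ?G s\<bar> \<le> h * (e / 6)" if s: "s \<in> {t/2..2*t}" for s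
  proof -
    have s0: "s > 0" using s t by auto
    have "\<bar>h * U r s - (Fm c (0, \<lambda>r. U r s) - Fm (c + h) (0, \<lambda>r. U r s))\<bar> \<le> h * (e / 6)"
    proof (rule density_average[OF U_integrable[OF s0]])
      fix y assume "y \<in> {c..c + h}"
      then have "y \<in> {0..1}" "\<bar>y - r\<bar> < h0" using c h by auto
      then show "\<bar>U y s - U r s\<bar> \<le> e / 6" using eq s r by blast
    qed (use c h in auto)
    then show ?thesis using Fm_U[OF s0] c h by simp
  qed
  define \<delta> where "\<delta> = min (min k h0) (t / 2)"
  show "\<exists>d>0. \<forall>z'\<in>{0..1} \<times> {0<..}. dist z' z < d \<longrightarrow> dist (case z' of (r, t) \<Rightarrow> U r t) (case z of (r, t) \<Rightarrow> U r t) < e"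
  proof (intro exI[of _ \<delta>] conjI ballI impI)
    show "\<delta> > 0" using k h0 t by (simp add: \<delta>_def)
    fix z' :: "real \<times> real" assume z': "z' \<in> {0..1} \<times> {0<..}" and d: "dist z' z < \<delta>"
    obtain x s where zz': "z' = (x, s)" by (cases z')
    have x: "x \<in> {0..1}" using z' zz' by auto
    have dx: "\<bar>x - r\<bar> < \<delta>" and ds: "\<bar>s - t\<bar> < \<delta>"
      using d dist_fst_le[of z' z] dist_snd_le[of z' z] by (auto simp: zz zz' dist_real_def)
    have "\<bar>s - t\<bar> < t / 2" using ds by (simp add: \<delta>_def)
    then have s: "s \<in> {t/2..2*t}" unfolding atLeastAtMost_iff by linarith
    have t': "t \<in> {t/2..2*t}" using t by auto
    have "\<bar>x - r\<bar> < h0" using dx by (simp add: \<delta>_def)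
    then have 1: "\<bar>U x s - U r s\<bar> \<le> e / 6" using eq s x r by blast
    have "\<bar>?G s - ?G t\<bar> < h * (e / 6)" using ds by (intro k) (simp add: \<delta>_def)
    then have "\<bar>h * U r s - h * U r t\<bar> \<le> h * (e / 2)"
      using avg[OF s] avg[OF t'] by linarith
    then have "h * \<bar>U r s - U r t\<bar> \<le> h * (e / 2)"
      using h by (simp add: abs_mult right_diff_distrib[symmetric])
    then have 2: "\<bar>U r s - U r t\<bar> \<le> e / 2" using h by simp
    show "dist (case z' of (r, t) \<Rightarrow> U r t) (case z of (r, t) \<Rightarrow> U r t) < e"
      unfolding zz zz' prod.case dist_real_def using 1 2 e by linarith
  qed
qed

end

section \<open>Initial condition\<close>

lemma continuous_bounded_unit:
  fixes h :: "real \<Rightarrow> real"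
  assumes "continuous_on {0..1} h"
  obtains C where "\<And>y. y \<in> {0..1} \<Longrightarrow> \<bar>h y\<bar> \<le> C"
proof -
  have "bounded (h ` {0..1})" using assms by (intro compact_imp_bounded compact_continuous_image) auto
  then obtain C where "\<forall>x\<in>h ` {0..1}. norm x \<le> C" unfolding bounded_iff by blast
  then have "\<And>y. y \<in> {0..1} \<Longrightarrow> \<bar>h y\<bar> \<le> C" by simp
  then show ?thesis by (rule that)
qed

lemma Theta_abs_le_1: 
  assumes t: "t > 0" and x: "\<bar>x\<bar> \<le> 2"
  shows "\<bar>Theta t x\<bar> \<le> 1"
proof -
  have 2: "Theta t 2 = 1" using Theta_reflect_1[OF t, of 1] by (simp add: Theta_0)
  have "Theta t x \<le> 1" "- 1 \<le> Theta t x"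
    using Theta_mono[OF t, of x 2] Theta_mono[OF t, of "-2" x] x Theta_minus[of t 2] by (auto simp: 2 abs_le_iff)
  then show ?thesis by simp
qed

lemma Theta_near_half:
  assumes t: "t > 0" and x: "0 < x" "x \<le> 1"
  shows "\<bar>Theta t x - 1 / 2\<bar> \<le> Gk t x 0 + eps t"
proof -
  have I: "(theta t has_integral Theta t 1 - Theta t x) {x..1}" by (rule integral_theta_Theta[OF t x(2)])
  have b: "theta t y \<le> Gk t x 0 + eps t" if "y \<in> {x..1}" for y
  proof -
    have "theta t y \<le> Gk t y 0 + eps t" using theta_upper[OF t, of y] that x by (simp add: eps_def)
    also have "Gk t y 0 \<le> Gk t x 0"
    proof -
      have "x\<^sup>2 \<le> y\<^sup>2" using that x by (intro power_mono) auto
      then show ?thesis using t by (auto simp: Gk_def intro!: divide_right_mono)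
    qed
    finally show ?thesis by simp
  qed
  have nn: "0 \<le> Gk t x 0 + eps t" using Gk_nonneg[OF t] eps_nonneg[OF t] by (intro add_nonneg_nonneg)
  have "Theta t 1 - Theta t x \<le> (1 - x) * (Gk t x 0 + eps t)"
    using has_integral_le[OF I has_integral_const_real[of "Gk t x 0 + eps t"]] b x by simp
  also have "\<dots> \<le> 1 * (Gk t x 0 + eps t)" using x nn by (intro mult_right_mono) auto
  finally show ?thesis using Theta_le_half[OF t x(2)] Theta_1[OF t] by simp
qed

lemma Theta_tendsto_half:
  assumes x: "0 < x" "x < 2"
  shows "((\<lambda>t. Theta t x) \<longlongrightarrow> 1 / 2) (at_right 0)"
proof -
  have *: "((\<lambda>t. Theta t x) \<longlongrightarrow> 1 / 2) (at_right 0)" if x: "0 < x" "x \<le> 1" for x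
  proof (rule LIM_zero_cancel, rule Lim_null_comparison)
    show "\<forall>\<^sub>F t in at_right 0. norm (Theta t x - 1 / 2) \<le> Gk t x 0 + eps t"
      using eventually_at_right_less[of 0] by eventually_elim (use Theta_near_half x in auto)
    have "((\<lambda>t. exp (- (x\<^sup>2) / (2 * t)) / sqrt (2 * pi * t)) \<longlongrightarrow> 0) (at_right 0)"
      using x by real_asymp
    moreover have "((\<lambda>t. tail_const * (t\<^sup>2 / sqrt t)) \<longlongrightarrow> tail_const * 0) (at_right 0)"
      by (intro tendsto_mult tendsto_const) real_asymp
    ultimately have "((\<lambda>t. exp (- (x\<^sup>2) / (2 * t)) / sqrt (2 * pi * t) + tail_const * (t\<^sup>2 / sqrt t)) \<longlongrightarrow> 0 + tail_const * 0) (at_right 0)"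
      by (rule tendsto_add)
    then show "((\<lambda>t. Gk t x 0 + eps t) \<longlongrightarrow> 0) (at_right 0)" by (simp add: Gk_def eps_def)
  qed
  show ?thesis
  proof (cases "x \<le> 1")
    case True then show ?thesis using * x by blast
  next
    case False
    have "((\<lambda>t. 1 - Theta t (2 - x)) \<longlongrightarrow> 1 - 1 / 2) (at_right 0)"
      using False x by (intro tendsto_intros *) auto
    moreover have "\<forall>\<^sub>F t in at_right 0. 1 - Theta t (2 - x) = Theta t x"
      using eventually_at_right_less[of 0]
    proof eventually_elim
      case (elim t)
      then show ?case using Theta_reflect_1[OF elim, of "x - 1"] by simp
    qed
    ultimately show ?thesis by (simp add: tendsto_cong)
  qed
qed

text \<open>For 0 < r < 1 the sum r + y stays in (0, 2), where \<open>Theta\<close> tends to 1/2.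
  The point y = r, at which the limit would be 1/2, is left out.\<close>

lemma tail_kernel_tendsto:
  assumes r: "r \<in> {0<..<1}" and y: "y \<in> {0..1}" "y \<noteq> r"
  shows "((\<lambda>t. 1 - Theta t (r - y) - Theta t (r + y)) \<longlongrightarrow> indicator {r..1} y) (at_right 0)"
proof (cases "y < r")
  case True
  then have "((\<lambda>t. 1 - Theta t (r - y) - Theta t (r + y)) \<longlongrightarrow> 1 - 1 / 2 - 1 / 2) (at_right 0)"
    using r y by (intro tendsto_intros Theta_tendsto_half) auto
  then show ?thesis using True by simp
next
  case False
  then have "((\<lambda>t. 1 + Theta t (y - r) - Theta t (r + y)) \<longlongrightarrow> 1 + 1 / 2 - 1 / 2) (at_right 0)"
    using r y by (intro tendsto_intros Theta_tendsto_half) auto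
  moreover have "Theta t (r - y) = - Theta t (y - r)" for t using Theta_minus[of t "y - r"] by simp
  ultimately show ?thesis using False y by simp
qed

lemma Fm_heat_tendsto:
  assumes r: "r \<in> {0<..<1}" and i: "integrable UI u" and x: "\<And>n. x n > 0" "x \<longlonglongrightarrow> 0"
  shows "(\<lambda>n. Fm r (heat (x n) (0, u))) \<longlonglongrightarrow> Fm r (0, u)"
proof -
  have r': "r \<in> {0..1}" using r by auto
  have X: "filterlim x (at_right 0) sequentially"
  proof -
    have "x n \<in> {0<..} \<and> x n \<noteq> 0" for n using x(1)[of n] by auto
    then show ?thesis using x(2) by (simp add: filterlim_at)
  qed
  have [measurable]: "u \<in> borel_measurable UI" using i by simp
  let ?k = "\<lambda>t y. 1 - Theta t (r - y) - Theta t (r + y)"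
  have "(\<lambda>n. LINT y|UI. ?k (x n) y * u y) \<longlonglongrightarrow> (LINT y|UI. indicator {r..1} y * u y)"
  proof (rule integral_dominated_convergence[where w = "\<lambda>y. 3 * \<bar>u y\<bar>"])
    show "(\<lambda>y. indicator {r..1} y * u y) \<in> borel_measurable UI"
      using UI_indicator_integrable[OF i] by (rule borel_measurable_integrable)
    show "(\<lambda>y. ?k (x n) y * u y) \<in> borel_measurable UI" for n using x(1)[of n] by measurable
    show "AE y in UI. (\<lambda>n. ?k (x n) y * u y) \<longlonglongrightarrow> indicator {r..1} y * u y"
      using AE_UI_neq[of r] AE_UI_mem
    proof eventually_elim
      case (elim y)
      show ?case
        by (intro tendsto_mult tendsto_const filterlim_compose[OF tail_kernel_tendsto X]) (use r elim in auto)
    qed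
    show "AE y in UI. norm (?k (x n) y * u y) \<le> 3 * \<bar>u y\<bar>" for n
    proof (rule AE_I2)
      fix y assume "y \<in> space UI"
      then have "\<bar>r - y\<bar> \<le> 2" "\<bar>r + y\<bar> \<le> 2" using r by auto
      then have "\<bar>?k (x n) y\<bar> \<le> 3"
        using Theta_abs_le_1[OF x(1)[of n], of "r - y"] Theta_abs_le_1[OF x(1)[of n], of "r + y"] by linarith
      then show "norm (?k (x n) y * u y) \<le> 3 * \<bar>u y\<bar>" by (auto simp: abs_mult intro!: mult_right_mono)
    qed
  qed (use i in auto)
  moreover have "Fm r (heat (x n) (0, u)) = (LINT y|UI. ?k (x n) y * u y)" for n
    using Fm_heat_tail[OF x(1) _ r', of "(0, u)" n] i by simp
  moreover have "Fm r (0, u) = (LINT y|UI. indicator {r..1} y * u y)" using r r' by (simp add: Fm_UI)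
  ultimately show ?thesis by (simp only:)
qed

section \<open>Behaviour as t tends to 0\<close>

context barrier_limit
begin

text \<open>These are the barriers with the single step t: the lower one is at least the pure heat
  flow minus j t, the upper one at most the heat flow. As operators on distribution functions they
  exist for every t > 0.\<close>

lemma Vlim_bounds:
  assumes t: "t > 0" and r: "r \<in> {0..1}"
  shows "Fm r (heat t (0, u)) - j * t \<le> Vlim j M F0 t r" "Vlim j M F0 t r \<le> Fm r (heat t (0, u))"
proof -
  have u: "integrable UI (snd (0, u))" using adm by (simp add: adm_def)
  have H: "Fm r (heat t (0, u)) = Top t M F0 r" using Fm_heat[OF t u r] M by simp
  have j0: "0 \<le> j" "0 \<le> M" using j Mpos by auto
  have "Am j M t F0 r \<le> Vlim j M F0 t r"
    using Am_le_Vlim[OF j0 t F0_cls r, of 1] by simp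
  then show "Fm r (heat t (0, u)) - j * t \<le> Vlim j M F0 t r" unfolding H by (simp add: Am_def Kop_def)
  have jt: "0 \<le> j * t" using j t by simp
  have "le01 (Top t M (Kop (j * t) F0)) (Top t M F0)"
  proof (rule Top_mono[OF t Kop_cls[OF jt F0_cls] F0_cls])
    show "le01 (Kop (j * t) F0) F0" using F0_cls jt by (auto simp: le01_def Kop_def cls_def)
  qed
  then have "Ap j M t F0 r \<le> Top t M F0 r" using r unfolding Ap_def le01_def by blast
  moreover have "Vlim j M F0 t r \<le> Ap j M t F0 r"
    using Vlim_le_Ap[OF j0 t F0_cls r, of 1] by simp
  ultimately show "Vlim j M F0 t r \<le> Fm r (heat t (0, u))" unfolding H by linarith
qed

lemma Vlim_tendsto_F0:
  assumes r: "r \<in> {0<..<1}" and x: "\<And>n. x n > 0" "x \<longlonglongrightarrow> 0"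
  shows "(\<lambda>n. Vlim j M F0 (x n) r) \<longlonglongrightarrow> F0 r"
proof (rule real_tendsto_sandwich)
  have i: "integrable UI u" using adm by (simp add: adm_def)
  have r': "r \<in> {0..1}" using r by auto
  have L: "(\<lambda>n. Fm r (heat (x n) (0, u))) \<longlonglongrightarrow> F0 r" by (rule Fm_heat_tendsto[OF r i x])
  show "\<forall>\<^sub>F n in sequentially. Fm r (heat (x n) (0, u)) - j * x n \<le> Vlim j M F0 (x n) r"
    "\<forall>\<^sub>F n in sequentially. Vlim j M F0 (x n) r \<le> Fm r (heat (x n) (0, u))"
    using Vlim_bounds[OF x(1) r'] by auto
  show "(\<lambda>n. Fm r (heat (x n) (0, u))) \<longlonglongrightarrow> F0 r" by (rule L)
  have "(\<lambda>n. Fm r (heat (x n) (0, u)) - j * x n) \<longlonglongrightarrow> F0 r - j * 0" by (intro tendsto_intros L x)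
  then show "(\<lambda>n. Fm r (heat (x n) (0, u)) - j * x n) \<longlonglongrightarrow> F0 r" by simp
qed

text \<open>\<open>adm\<close> gives the sign only almost everywhere; the pointwise sign comes from
  \<open>heat_nonneg\<close>, as the last of the 2^m steps ends with a flow.\<close>

lemma U_nonneg: 
  assumes t: "t > 0" and r: "r \<in> {0..1}"
  shows "0 \<le> U r t"
proof (rule tendsto_lowerbound[OF dens_tendsto[OF assms]])
  show "\<forall>\<^sub>F m in sequentially. 0 \<le> dens m t r"
    using eventually_small_step[of t]
  proof eventually_elim
    case (elim m)
    define d where "d = t / 2 ^ m"
    have d: "d > 0" "mass (0, u) > j * d" using t elim M by (auto simp: d_def)
    obtain n where n: "(2::nat) ^ m = Suc n" by (metis not0_implies_Suc power_not_zero zero_neq_numeral)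
    define \<rho> where "\<rho> = snd (Splus j d u n)"
    have S: "Splus j d u n = (0, \<rho>)" "adm (Splus j d u n)" "mass (Splus j d u n) > j * d"
      using Splus_props[OF adm d(2) j d(1), of n] d by (auto simp: \<rho>_def prod_eq_iff)
    have "adm (Kd j d (0, \<rho>))" using Kd_props(1)[of \<rho> j d] S j d by simp
    then have "0 \<le> snd (heat d (Kd j d (0, \<rho>))) r" by (rule heat_nonneg[OF d(1)])
    then show ?case unfolding dens_def d_def[symmetric] n by (simp add: S(1))
  qed
qed simp

text \<open>At r = 0 the Dirichlet kernel and \<open>Theta\<close> vanish, so \<open>Top\<close>
  returns M whatever its argument. Hence all upper barriers after at least one step, and their
  limit, equal M there.\<close>

lemma mass_U: "t > 0 \<Longrightarrow> (LINT r|UI. U r t) = M"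
proof -
  assume t: "t > 0"
  have j0: "0 \<le> j" "0 \<le> M" using j Mpos by auto
  have z: "(0::real) \<in> {0..1}" by simp
  have T0: "Top d M f 0 = M" for d f by (simp add: Top_def Theta_0 dir_def theta_minus)
  have "Vlim j M F0 t 0 = M"
  proof (rule antisym)
    show "Vlim j M F0 t 0 \<le> M" using Vlim_le_Ap[OF j0 t F0_cls z, of 1] by (simp add: Ap_def T0)
    show "M \<le> Vlim j M F0 t 0"
    proof (rule LIMSEQ_le_const[OF _ exI[of _ 0]])
      have "(\<lambda>m. (Ap j M (t / 2 ^ m) ^^ (2 ^ m)) F0 0 ) \<longlonglongrightarrow> Vlim j M F0 t 0"
      proof (rule LIM_zero_cancel, rule Lim_null_comparison)
        show "\<forall>\<^sub>F m in sequentially. norm ((Ap j M (t / 2 ^ m) ^^ (2 ^ m)) F0 0 - Vlim j M F0 t 0) \<le> j * t * (1 / 2) ^ m"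
          using Vlim_approx[OF j0 t F0_cls z] by (simp add: power_one_over)
        have "(\<lambda>m. j * t * (1 / 2) ^ m) \<longlonglongrightarrow> j * t * 0"
          by (intro tendsto_intros LIMSEQ_realpow_zero) auto
        then show "(\<lambda>m. j * t * (1 / 2) ^ m) \<longlonglongrightarrow> 0" by simp
      qed
      moreover have "(Ap j M (t / 2 ^ m) ^^ (2 ^ m)) F0 0 = M" for m
      proof -
        obtain n where n: "(2::nat) ^ m = Suc n" by (metis not0_implies_Suc power_not_zero zero_neq_numeral)
        show ?thesis unfolding n by (simp add: Ap_def[of j M _ "(Ap j M _ ^^ n) F0"] T0)
      qed
      ultimately show "(\<lambda>m. M) \<longlonglongrightarrow> Vlim j M F0 t 0" by simp
    qed simp
  qed
  then have "Fm 0 (0, \<lambda>r. U r t) = M" using Fm_U[OF t z] by simp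
  then show ?thesis by (simp add: Fm_0 mass_def)
qed

text \<open>Convergence of the distribution functions gives convergence of integrals of polynomials by
  partial integration, and the conserved mass allows passing to uniform limits.\<close>
lemma U_weak_convergence:
  assumes f: "continuous_on {0..1} f"
  shows "((\<lambda>t. LINT r|UI. f r * U r t) \<longlongrightarrow> (LINT r|UI. f r * u r)) (at_right 0)"
proof (rule tendsto_at_right_sequentially[of 0 1])
  fix x :: "nat \<Rightarrow> real" assume x: "\<And>n. 0 < x n" "\<And>n. x n < 1" "x \<longlonglongrightarrow> 0"
  have i: "integrable UI u" and nn: "AE y in UI. 0 \<le> u y" using adm by (auto simp: adm_def)
  have Mu: "(LINT y|UI. u y) = M" using M by (simp add: mass_def)
  have pol: "(\<lambda>n. LINT r|UI. p r * U r (x n)) \<longlonglongrightarrow> (LINT r|UI. p r * u r)" if p: "real_polynomial_function p" for p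
  proof -
    obtain q where q: "real_polynomial_function q" "\<And>y. (p has_real_derivative q y) (at y)"
      using has_real_derivative_polynomial_function[OF p] by blast
    have qc: "continuous_on UNIV q" 
      using q(1) by (simp add: continuous_on_polymonial_function real_polynomial_function_eq)
    have G: "(q has_integral p z - p 0) {0..z}" if "z \<in> {0..1}" for z
      using that by (intro fundamental_theorem_of_calculus)
        (auto intro!: has_field_derivative_at_within q(2) simp: has_real_derivative_iff_has_vector_derivative[symmetric])
    \<comment> \<open>Partial integration with the primitive p z - p 0; the remaining term is p 0
      times the mass, which is the same for all times.\<close>
    have P: "(LINT z|UI. p z * g z) = p 0 * (LINT z|UI. g z) + (LINT y|UI. q y * Fm y (0, g))" if g: "integrable UI g" for g
    proof -
      have g': "integrable UI (snd (0, g))" using g by simp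
      note B = Fm_by_parts[OF qc G g', simplified]
      have "(LINT z|UI. p z * g z) = (LINT z|UI. p 0 * g z + (p z - p 0) * g z)"
        by (intro Bochner_Integration.integral_cong) (auto simp: algebra_simps)
      then show ?thesis using B g by simp
    qed
    have "continuous_on {0..1} q" using qc by (rule continuous_on_subset) simp
    then obtain C where C: "\<And>y. y \<in> {0..1} \<Longrightarrow> \<bar>q y\<bar> \<le> C" by (rule continuous_bounded_unit) blast
    have [measurable]: "q \<in> borel_measurable UI" 
      by (intro measurable_UI_borel borel_measurable_continuous_onI qc)
    have "(\<lambda>n. LINT y|UI. q y * Fm y (0, \<lambda>r. U r (x n))) \<longlonglongrightarrow> (LINT y|UI. q y * F0 y)"
    proof (rule integral_dominated_convergence[where w = "\<lambda>_. C * M"])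
      have [measurable]: "F0 \<in> borel_measurable UI" using F0_cls by (simp add: cls_def)
      show "(\<lambda>y. q y * F0 y) \<in> borel_measurable UI" by measurable
      have m: "(\<lambda>y. Fm y (0, \<lambda>r. U r (x n))) \<in> borel_measurable UI" for n
        using U_integrable[OF x(1)] by (intro Fm_measurable) simp
      then show "(\<lambda>y. q y * Fm y (0, \<lambda>r. U r (x n))) \<in> borel_measurable UI" for n by (intro borel_measurable_times) auto
      \<comment> \<open>\<open>Vlim_tendsto_F0\<close> covers interior points only; the endpoints
        form a null set.\<close>
      show "AE y in UI. (\<lambda>n. q y * Fm y (0, \<lambda>r. U r (x n))) \<longlonglongrightarrow> q y * F0 y"
        using AE_UI_neq[of 0] AE_UI_neq[of 1] AE_UI_mem
      proof eventually_elim
        case (elim y)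
        then have "(\<lambda>n. q y * Vlim j M F0 (x n) y) \<longlonglongrightarrow> q y * F0 y"
          using x by (intro tendsto_mult tendsto_const Vlim_tendsto_F0) auto
        then show ?case using Fm_U[OF x(1) elim(3)] by simp
      qed
      show "AE y in UI. norm (q y * Fm y (0, \<lambda>r. U r (x n))) \<le> C * M" for n
      proof (rule AE_I2)
        fix y assume "y \<in> space UI"
        then have y: "y \<in> {0..1}" by simp
        have "adm (0, \<lambda>r. U r (x n))" using U_integrable[OF x(1)] U_nonneg[OF x(1)] by (auto simp: adm_def intro!: AE_I2)
        then have "cls M (\<lambda>y. Fm y (0, \<lambda>r. U r (x n)))"
          using adm_Fm_cls mass_U[OF x(1)] by (simp add: mass_def)
        then have "\<bar>Fm y (0, \<lambda>r. U r (x n))\<bar> \<le> M" using y by (auto simp: cls_def)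
        then show "norm (q y * Fm y (0, \<lambda>r. U r (x n))) \<le> C * M"
          unfolding real_norm_def abs_mult using C[OF y] abs_ge_zero[of "q y"] by (intro mult_mono) linarith+
      qed
    qed simp
    then have "(\<lambda>n. p 0 * M + (LINT y|UI. q y * Fm y (0, \<lambda>r. U r (x n)))) \<longlonglongrightarrow> p 0 * M + (LINT y|UI. q y * F0 y)"
      by (intro tendsto_intros)
    then show ?thesis using P[OF i] P[OF U_integrable[OF x(1)]] mass_U[OF x(1)] Mu by simp
  qed
  have close: "\<bar>(LINT r|UI. f r * g r) - (LINT r|UI. p r * g r)\<bar> \<le> e * M"
    if g: "integrable UI g" "AE y in UI. 0 \<le> g y" "(LINT y|UI. g y) = M" 
      and p: "continuous_on {0..1} p" "\<And>y. y \<in> {0..1} \<Longrightarrow> \<bar>f y - p y\<bar> \<le> e" for g p e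
  proof -
    have I: "integrable UI (\<lambda>r. h r * g r)" if h: "continuous_on {0..1} h" for h
    proof -
      obtain C where C: "\<And>y. y \<in> {0..1} \<Longrightarrow> \<bar>h y\<bar> \<le> C" using h by (rule continuous_bounded_unit) blast
      have [measurable]: "h \<in> borel_measurable UI" "g \<in> borel_measurable UI" using continuous_measurable_UI[OF h] g by auto
      show ?thesis
      proof (rule Bochner_Integration.integrable_bound)
        show "integrable UI (\<lambda>y. C * g y)" using g by simp
        have "norm (h y * g y) \<le> norm (C * g y)" if "y \<in> {0..1}" for y
        proof -
          have "\<bar>h y\<bar> \<le> \<bar>C\<bar>" using C[OF that] by linarith
          then show ?thesis by (simp add: abs_mult mult_right_mono)
        qed
        then show "AE y in UI. norm (h y * g y) \<le> norm (C * g y)" by (intro AE_I2) simp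
      qed measurable
    qed
    have "(LINT r|UI. f r * g r) - (LINT r|UI. p r * g r) = (LINT r|UI. (f r - p r) * g r)"
      using I[OF f] I[OF p(1)] by (simp add: left_diff_distrib)
    moreover have "\<bar>LINT r|UI. (f r - p r) * g r\<bar> \<le> (LINT r|UI. \<bar>(f r - p r) * g r\<bar>)"
      by (rule integral_abs_bound)
    moreover have "(LINT r|UI. \<bar>(f r - p r) * g r\<bar>) \<le> (LINT r|UI. e * g r)"
    proof (rule integral_mono_AE)
      show "integrable UI (\<lambda>r. \<bar>(f r - p r) * g r\<bar>)" using I[OF f] I[OF p(1)] by (simp add: left_diff_distrib)
      show "AE r in UI. \<bar>(f r - p r) * g r\<bar> \<le> e * g r"
        using g(2) AE_UI_mem by eventually_elim (auto simp: abs_mult intro!: mult_right_mono p)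
    qed (use g in simp)
    moreover have "(LINT r|UI. e * g r) = e * M" using g by simp
    ultimately show ?thesis by linarith
  qed
  show "(\<lambda>n. LINT r|UI. f r * U r (x n)) \<longlonglongrightarrow> (LINT r|UI. f r * u r)"
  proof (rule LIMSEQ_I)
    fix e :: real assume e: "e > 0"
    \<comment> \<open>Replacing f by the polynomial costs d M = e / 4 for each of the two densities;
      convergence for the polynomial takes another e / 4.\<close>
    define d where "d = e / (4 * M)"
    have d: "d > 0" "d * M = e / 4" using e Mpos by (auto simp: d_def)
    obtain p where p: "real_polynomial_function p" "\<And>y. y \<in> {0..1} \<Longrightarrow> \<bar>f y - p y\<bar> < d"
      using Stone_Weierstrass_real_polynomial_function[OF compact_Icc f d(1)] by blast
    have pc: "continuous_on {0..1} p" 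
      using p(1) by (simp add: continuous_on_polymonial_function real_polynomial_function_eq)
    have pd: "\<And>y. y \<in> {0..1} \<Longrightarrow> \<bar>f y - p y\<bar> \<le> d" using p(2) less_imp_le by blast
    have "e / 4 > 0" using e by simp
    from LIMSEQ_D[OF pol[OF p(1)] this] obtain N where
      N: "\<And>n. n \<ge> N \<Longrightarrow> norm ((LINT r|UI. p r * U r (x n)) - (LINT r|UI. p r * u r)) < e / 4" by blast
    show "\<exists>N. \<forall>n\<ge>N. norm ((LINT r|UI. f r * U r (x n)) - (LINT r|UI. f r * u r)) < e"
    proof (intro exI[of _ N] allI impI)
      fix n assume n: "n \<ge> N"
      have nnU: "AE y in UI. 0 \<le> U y (x n)" using U_nonneg[OF x(1)] by (intro AE_I2) simp
      have 1: "\<bar>(LINT r|UI. f r * U r (x n)) - (LINT r|UI. p r * U r (x n))\<bar> \<le> e / 4"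
        using close[OF U_integrable[OF x(1)] nnU mass_U[OF x(1)] pc pd] d by simp
      have 2: "\<bar>(LINT r|UI. f r * u r) - (LINT r|UI. p r * u r)\<bar> \<le> e / 4"
        using close[OF i nn Mu pc pd] d by simp
      show "norm ((LINT r|UI. f r * U r (x n)) - (LINT r|UI. f r * u r)) < e"
        using 1 2 N[OF n] e unfolding real_norm_def by linarith
    qed
  qed
qed simp

end

section \<open>Separation and uniqueness\<close>

text \<open>The positive and negative parts of w = f - g define two finite measures that agree on
  every ray {x<..} and are therefore equal. Their densities then agree almost everywhere, which
  forces w = 0.\<close>

lemma AE_eq_if_Fm_eq:
  assumes f: "integrable UI f" and g: "integrable UI g"
    and eq: "\<And>r. r \<in> {0..1} \<Longrightarrow> Fm r (0, f) = Fm r (0, g)"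
  shows "AE x in UI. f x = g x"
proof -
  define w where "w = (\<lambda>x. f x - g x)"
  have w: "integrable UI w" using f g by (simp add: w_def)
  have tail: "(LINT y|UI. indicator {r..1} y * w y) = 0" if "r \<in> {0..1}" for r
    using eq[OF that] that f g by (simp add: Fm_UI w_def UI_indicator_integrable right_diff_distrib split: if_splits)
  define D where "D = (\<lambda>h. density lborel (\<lambda>y. ennreal (indicator {0..1::real} y * max 0 (h y))))"
  have m: "(\<lambda>y. indicator {0..1} y * max 0 (h y)) \<in> borel_measurable lborel" if "integrable UI h" for h :: "real \<Rightarrow> real"
  proof -
    have [measurable]: "h \<in> borel_measurable UI" using that by simp
    have "(\<lambda>y. max 0 (h y)) \<in> borel_measurable UI" by measurable
    then show ?thesis unfolding UI_def by (subst (asm) borel_measurable_restrict_space_iff) auto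
  qed
  have tail2: "(LINT y|UI. indicator {x<..} y * w y) = 0" for x
  proof -
    \<comment> \<open>Clamping x to [0,1] reduces rays with arbitrary endpoint to the tails already
      known to vanish.\<close>
    define r where "r = max 0 (min x 1)"
    have "(LINT y|UI. indicator {x<..} y * w y) = (LINT y|UI. indicator {r..1} y * w y)"
    proof (rule integral_cong_AE)
      have [measurable]: "w \<in> borel_measurable UI" using w by simp
      have "(\<lambda>y. indicator {x<..} y * w y) = (\<lambda>y. (if x < y then 1 else 0) * w y)" by auto
      also have "\<dots> \<in> borel_measurable UI" by measurable
      finally show "(\<lambda>y. indicator {x<..} y * w y) \<in> borel_measurable UI" .
      show "(\<lambda>y. indicator {r..1} y * w y) \<in> borel_measurable UI"
        using UI_indicator_integrable[OF w] by (rule borel_measurable_integrable)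
      show "AE y in UI. indicator {x<..} y * w y = indicator {r..1} y * w y"
        using AE_UI_neq[of x] AE_UI_neq[of 1] AE_UI_mem
        by eventually_elim (auto simp: indicator_def r_def)
    qed
    then show ?thesis using tail[of r] by (simp add: r_def)
  qed
  have em: "emeasure (D h) {x<..} = ennreal (LINT y|UI. indicator {x<..} y * max 0 (h y))"
    "integrable UI (\<lambda>y. indicator {x<..} y * max 0 (h y))"
    if h: "integrable UI h" for h :: "real \<Rightarrow> real" and x
  proof -
    have [measurable]: "h \<in> borel_measurable UI" using h by simp
    have "(\<lambda>y. indicator {x<..} y * max 0 (h y)) = (\<lambda>y. (if x < y then 1 else 0) * max 0 (h y))" by auto
    also have "\<dots> \<in> borel_measurable UI" by measurable
    finally have mm: "(\<lambda>y. indicator {x<..} y * max 0 (h y)) \<in> borel_measurable UI" .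
    show i: "integrable UI (\<lambda>y. indicator {x<..} y * max 0 (h y))"
      by (rule Bochner_Integration.integrable_bound[OF h mm]) (auto intro!: AE_I2 simp: indicator_def)
    have "emeasure (D h) {x<..} = (\<integral>\<^sup>+y. ennreal (indicator {0..1} y * max 0 (h y)) * indicator {x<..} y \<partial>lborel)"
      unfolding D_def using m[OF h] by (subst emeasure_density) auto
    also have "\<dots> = (\<integral>\<^sup>+y. ennreal (indicator {x<..} y * max 0 (h y)) * indicator {0..1} y \<partial>lborel)"
      by (intro nn_integral_cong) (auto simp: indicator_def)
    also have "\<dots> = (\<integral>\<^sup>+y. ennreal (indicator {x<..} y * max 0 (h y)) \<partial>UI)"
      unfolding UI_def by (subst nn_integral_restrict_space) auto
    also have "\<dots> = ennreal (LINT y|UI. indicator {x<..} y * max 0 (h y))"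
      by (rule nn_integral_eq_integral[OF i]) (auto intro!: AE_I2)
    finally show "emeasure (D h) {x<..} = ennreal (LINT y|UI. indicator {x<..} y * max 0 (h y))" .
  qed
  have w': "integrable UI (\<lambda>y. - w y)" using w by simp
  have "D w = D (\<lambda>y. - w y)"
  proof (rule measure_eqI_lessThan)
    show "sets (D w) = sets borel" "sets (D (\<lambda>y. - w y)) = sets borel" by (simp_all add: D_def)
    show "emeasure (D w) {x<..} < \<infinity>" for x by (simp add: em[OF w])
    fix x
    have "(LINT y|UI. indicator {x<..} y * max 0 (w y)) - (LINT y|UI. indicator {x<..} y * max 0 (- w y))
       = (LINT y|UI. indicator {x<..} y * max 0 (w y) - indicator {x<..} y * max 0 (- w y))"
      using em(2)[OF w, of x] em(2)[OF w', of x] by simp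
    also have "\<dots> = (LINT y|UI. indicator {x<..} y * w y)"
      by (intro Bochner_Integration.integral_cong) (auto simp: indicator_def)
    finally show "emeasure (D w) {x<..} = emeasure (D (\<lambda>y. - w y)) {x<..}"
      using em(1)[OF w, of x] em(1)[OF w', of x] tail2[of x] by simp
  qed
  then have "AE y in lborel. ennreal (indicator {0..1} y * max 0 (w y)) = ennreal (indicator {0..1} y * max 0 (- w y))"
    unfolding D_def using m[OF w] m[OF w'] by (intro sigma_finite_measure.density_unique[OF sigma_finite_lborel]) simp_all
  then have "AE y in UI. w y = 0"
    unfolding AE_UI by eventually_elim (auto simp: max_def split: if_splits)
  then show ?thesis by eventually_elim (simp add: w_def)
qed

context barrier_limit
begin

lemma Fm_Sminus: 
  assumes "d > 0" "j * d < M" "r \<in> {0<..1}"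
  shows "Fm r (Sminus j d u n) = (Am j M d ^^ n) F0 r"
  using Sminus_props[OF adm _ j, of d n] assms M by simp

lemma Fm_Splus: 
  assumes "d > 0" "j * d < M" "r \<in> {0..1}"
  shows "Fm r (Splus j d u n) = (Ap j M d ^^ n) F0 r"
  using Splus_props[OF adm _ j, of d n] assms M by simp

lemma mass_barriers: 
  assumes "d > 0" "j * d < M"
  shows "Fm 0 (Sminus j d u n) = M" "Fm 0 (Splus j d u n) = M"
  using Sminus_props[OF adm _ j, of d n] Splus_props[OF adm _ j, of d n] assms M by (simp_all add: Fm_0)

lemma U_separates: "separates j u U"
  unfolding separates_def
proof (intro allI impI)
  fix d :: real and k :: nat
  assume d: "d > 0" and m: "Fm 0 (0, u) > j * d" and k: "k \<ge> 1"
  have m': "j * d < M" using m by (simp add: Fm_0 M)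
  have kd: "real k * d > 0" using d k by simp
  have j0: "0 \<le> j" "0 \<le> M" using j Mpos by auto
  have U0: "Fm 0 (0, \<lambda>r. U r (real k * d)) = M" using mass_U[OF kd] by (simp add: Fm_0 mass_def)
  have "Fm r (Sminus j d u k) \<le> Fm r (0, \<lambda>r. U r (real k * d)) \<and> Fm r (0, \<lambda>r. U r (real k * d)) \<le> Fm r (Splus j d u k)"
    if r: "r \<in> {0..1}" for r
  proof (cases "r = 0")
    \<comment> \<open>The formula for the lower barrier holds for r > 0 only; at 0 all three
      quantities equal the mass M.\<close>
    case True
    then show ?thesis using mass_barriers[OF d m'] U0 by simp
  next
    case False
    then have r': "r \<in> {0<..1}" using r by auto
    show ?thesis
      unfolding Fm_U[OF kd r] Fm_Sminus[OF d m' r'] Fm_Splus[OF d m' r]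
      using Am_le_Vlim[OF j0 d F0_cls r k] Vlim_le_Ap[OF j0 d F0_cls r k] by blast
  qed
  then show "ule (Sminus j d u k) (0, \<lambda>r. U r (real k * d)) \<and> ule (0, \<lambda>r. U r (real k * d)) (Splus j d u k)"
    by (simp add: ule_def)
qed

text \<open>Once t / 2^m is small enough, the function at time t is squeezed between barriers of
  this step, which are at most j t / 2^m apart for r > 0 and also enclose \<open>Vlim\<close>. At r
  = 0 both barriers have mass M.\<close>

lemma Fm_separating:
  assumes V: "separates j u V" and t: "t > 0" and r: "r \<in> {0..1}"
  shows "Fm r (0, \<lambda>r. V r t) = Fm r (0, \<lambda>r. U r t)"
proof -
  have j0: "0 \<le> j" "0 \<le> M" using j Mpos by auto
  have sep: "Fm r (Sminus j (t / 2 ^ m) u (2 ^ m)) \<le> Fm r (0, \<lambda>r. V r t)"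
    "Fm r (0, \<lambda>r. V r t) \<le> Fm r (Splus j (t / 2 ^ m) u (2 ^ m))" if m: "j * (t / 2 ^ m) < M" for m
  proof -
    have "t / 2 ^ m > 0" "Fm 0 (0, u) > j * (t / 2 ^ m)" "(2::nat) ^ m \<ge> 1"
      using t m M by (simp_all add: Fm_0)
    then have "ule (Sminus j (t / 2 ^ m) u (2 ^ m)) (0, \<lambda>r. V r (real (2 ^ m) * (t / 2 ^ m))) \<and>
       ule (0, \<lambda>r. V r (real (2 ^ m) * (t / 2 ^ m))) (Splus j (t / 2 ^ m) u (2 ^ m))"
      using V unfolding separates_def by blast
    then show "Fm r (Sminus j (t / 2 ^ m) u (2 ^ m)) \<le> Fm r (0, \<lambda>r. V r t)"
      "Fm r (0, \<lambda>r. V r t) \<le> Fm r (Splus j (t / 2 ^ m) u (2 ^ m))"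
      using r by (simp_all add: ule_def)
  qed
  show ?thesis
  proof (cases "r = 0")
    case True
    obtain m where m: "j * (t / 2 ^ m) < M" using eventually_small_step[of t] unfolding eventually_sequentially by blast
    have d: "t / 2 ^ m > 0" using t by simp
    show ?thesis using sep[OF m] mass_barriers[OF d m] mass_U[OF t] True by (simp add: Fm_0 mass_def)
  next
    case False
    then have r': "r \<in> {0<..1}" using r by auto
    have "(\<lambda>m::nat. Fm r (0, \<lambda>r. V r t)) \<longlonglongrightarrow> Vlim j M F0 t r"
    proof (rule LIM_zero_cancel, rule Lim_null_comparison)
      show "\<forall>\<^sub>F m in sequentially. norm (Fm r (0, \<lambda>r. V r t) - Vlim j M F0 t r) \<le> j * t * (1 / 2) ^ m"
        using eventually_small_step[of t]
      proof eventually_elim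
        case (elim m)
        have d: "t / 2 ^ m > 0" using t by simp
        have 1: "(Am j M (t / 2 ^ m) ^^ (2 ^ m)) F0 r \<le> Fm r (0, \<lambda>r. V r t)"
          "Fm r (0, \<lambda>r. V r t) \<le> (Ap j M (t / 2 ^ m) ^^ (2 ^ m)) F0 r"
          using sep[OF elim] unfolding Fm_Sminus[OF d elim r'] Fm_Splus[OF d elim r] by auto
        have 2: "(Ap j M (t / 2 ^ m) ^^ (2 ^ m)) F0 r \<le> (Am j M (t / 2 ^ m) ^^ (2 ^ m)) F0 r + j * (t / 2 ^ m)"
          by (rule Ap_pow_gap[OF j0 d F0_cls r])
        have 3: "(Am j M (t / 2 ^ m) ^^ (2 ^ m)) F0 r \<le> Vlim j M F0 t r"
          using Am_le_Vlim[OF j0 d F0_cls r, of "2 ^ m"] by simp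
        have 4: "Vlim j M F0 t r \<le> (Ap j M (t / 2 ^ m) ^^ (2 ^ m)) F0 r"
          by (rule Vlim_le[OF j0 t F0_cls r])
        have 5: "j * t * (1 / 2) ^ m = j * (t / 2 ^ m)" by (simp add: power_one_over)
        show ?case unfolding real_norm_def 5 using 1 2 3 4 by linarith
      qed
      have "(\<lambda>m. j * t * (1 / 2) ^ m) \<longlonglongrightarrow> j * t * 0"
        by (intro tendsto_intros LIMSEQ_realpow_zero) auto
      then show "(\<lambda>m. j * t * (1 / 2) ^ m) \<longlonglongrightarrow> 0" by simp
    qed
    then have "Fm r (0, \<lambda>r. V r t) = Vlim j M F0 t r" using tendsto_const LIMSEQ_unique by blast
    then show ?thesis using Fm_U[OF t r] by simp
  qed
qed

lemma separating_unique:
  assumes V: "separates j u V" and i: "\<And>t. t > 0 \<Longrightarrow> integrable UI (\<lambda>r. V r t)" and t: "t > 0"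
  shows "AE r in UI. V r t = U r t"
  by (rule AE_eq_if_Fm_eq[OF i[OF t] U_integrable[OF t] Fm_separating[OF V t]])

end

lemma adm_Linf:
  fixes u :: "real \<Rightarrow> real"
  assumes m: "set_borel_measurable lborel {0..1} u"
    and B: "AE x in lborel. x \<in> {0..1} \<longrightarrow> 0 \<le> u x \<and> u x \<le> B"
  shows "adm (0, u)"
proof -
  have um: "u \<in> borel_measurable UI"
    unfolding UI_def using m by (subst borel_measurable_restrict_space_iff) (auto simp: set_borel_measurable_def)
  have b: "AE x in UI. 0 \<le> u x \<and> u x \<le> B" unfolding AE_UI by (rule B)
  then have "integrable UI u"
  proof (intro UI.integrable_const_bound[of _ B] um)
    show "AE x in UI. norm (u x) \<le> B" using b by eventually_elim simp
  qed
  moreover have "AE x in UI. 0 \<le> u x" using b by eventually_elim simp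
  ultimately show ?thesis by (simp add: adm_def)
qed

text \<open>Separation sees only distribution functions, so uniqueness means equality for almost
  every r at each t > 0. It is stated among functions with integrable time slices, because for a
  non-integrable slice the integral in \<open>Fm\<close> can be the default value 0.\<close>

theorem mainTheorem3:
  fixes j :: real and u :: "real \<Rightarrow> real"
  assumes j_pos: "j > 0"
    and u_meas: "set_borel_measurable lborel {0..1} u"
    and u_Linf: "\<exists>B. AE x in lborel. x \<in> {0..1} \<longrightarrow> 0 \<le> u x \<and> u x \<le> B"
    and u_mass: "Fm 0 (0, u) > 0"
  shows "\<exists>U :: real \<Rightarrow> real \<Rightarrow> real.
           (\<forall>t>0. set_integrable lborel {0..1} (\<lambda>r. U r t))
         \<and> separates j u U
         \<and> (\<forall>V :: real \<Rightarrow> real \<Rightarrow> real.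
               (\<forall>t>0. set_integrable lborel {0..1} (\<lambda>r. V r t)) \<and> separates j u V \<longrightarrow>
               (\<forall>t>0. AE r in lborel. r \<in> {0..1} \<longrightarrow> V r t = U r t))
         \<and> continuous_on ({0..1} \<times> {0<..}) (\<lambda>(r, t). U r t)
         \<and> (\<forall>f. continuous_on {0..1} f \<longrightarrow>
               ((\<lambda>t. LINT r:{0..1}|lborel. f r * U r t)
                  \<longlongrightarrow> (LINT r:{0..1}|lborel. f r * u r)) (at_right 0))"
proof -
  obtain B where "AE x in lborel. x \<in> {0..1} \<longrightarrow> 0 \<le> u x \<and> u x \<le> B" using u_Linf by blast
  from adm_Linf[OF u_meas this] have adm: "adm (0, u)" .
  interpret barrier_limit j u "mass (0, u)"
    by unfold_locales (use j_pos adm u_mass in \<open>auto simp: Fm_0\<close>)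
  show ?thesis
    unfolding set_integral_UI set_integrable_UI AE_UI[symmetric]
    using U_integrable U_separates separating_unique U_continuous U_weak_convergence
    by (intro exI[of _ U]) simp
qed

end
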